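(* Let $A$ generate a strongly continuous semigroup on the Hilbert space $\mathbb{H}$, let $B\in\mathcal{L}(\mathbb{U},\mathcal{D}(A^* )')$ be an admissible control operator, and let $C\in\mathcal{L}(\mathbb{H})$. Let $P_0\in\mathcal{L}(\mathbb{H})$ be symmetric and nonnegative, let $z\in\mathbb{H}$ and $T>0$. For large positive $k$ let $B_k=J_kB$. Then for every $\xi\in\mathbb{H}$, $$\lim_{k\to+\infty}\inf_{u\in L^2((0,T);\mathbb{U})}\left(\int_0^T\left(\|Cx_k(t)-z\|_{\mathbb{H}}^2+\|u(t)\|_{\mathbb{U}}^2\right)dt+\langle P_0x_k(T),x_k(T)\rangle\right)=\inf_{u\in L^2((0,T);\mathbb{U})}\left(\int_0^T\left(\|Cx(t)-z\|_{\mathbb{H}}^2+\|u(t)\|_{\mathbb{U}}^2\right)dt+\langle P_0x(T),x(T)\rangle\right),$$ where $x_k'=Ax_k+B_ku$ on $(0,T)$, $x_k(0)=\xi$, and $x'=Ax+Bu$ on $(0,T)$, $x(0)=\xi$. Moreover, let $u_{T,\mathrm{opt},k}$ and $u_{T,\mathrm{opt}}$ be the optimal controls of these two problems (with $B_k$ and with $B$, respectively), $x_{T,\mathrm{opt},k}$ and $x_{T,\mathrm{opt}}$ the corresponding solutions, and $y_{T,\mathrm{opt},k}$ and $y_{T,\mathrm{opt}}$ the corresponding adjoint states. Then, as $k\to+\infty$, $$u_{T,\mathrm{opt},k}\to u_{T,\mathrm{opt}}\ \text{in }L^2((0,T);\mathbb{U}),\qquad x_{T,\mathrm{opt},k}\to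 x_{T,\mathrm{opt}}\ \text{in }C([0,T];\mathbb{H}),\qquad y_{T,\mathrm{opt},k}\to y_{T,\mathrm{opt}}\ \text{in }C([0,T];\mathbb{H}).$$
   Context: $\mathbb{H}$ and $\mathbb{U}$ are Hilbert spaces, identified with their duals. $A:\mathcal{D}(A)\to\mathbb{H}$ generates a strongly continuous semigroup $(e^{tA})_{t\ge0}$. $\mathcal{D}(A^* )$ carries the graph inner product and $\mathcal{D}(A^* )'$ is its dual with respect to the pivot space $\mathbb{H}$; $e^{tA}$ extends to $\mathcal{D}(A^* )'$. $B$ is admissible if for all $T>0$ and $u\in L^2((0,T);\mathbb{U})$ the function $t\mapsto\int_0^te^{(t-s)A}Bu(s)\,ds$ belongs to $C([0,T];\mathbb{H})$. Solutions of $x'=Ax+Bu$, $x(0)=\xi$ are given by $x(t)=e^{tA}\xi+\int_0^te^{(t-s)A}Bu(s)\,ds$. For $k\in\mathbb{N}$ large (larger than the growth bound of the semigroup), $J_k$ is the Yosida approximation of the identity, $J_kx=k\int_0^\infty e^{-ks}e^{sA}x\,ds$ for $x\in\mathbb{H}$, i.e. $J_k=k(k\,\mathrm{id}-A)^{-1}$, which extends to a bounded operator from $\mathcal{D}(A^* )'$ to $\mathbb{H}$; hence $B_k=J_kB\in\mathcal{L}(\mathbb{U},\mathbb{H})$. The adjoint state associated with a solution $x$ is the (mild) solution $y\in C([0,T];\mathbb{H})$ of $y'=-A^*y-C^*(Cx-z)$ on $(0,T)$ with $y(T)=P_0x(T)$. Optimal controls are unique by strict convexity. *)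

theory Defs
  imports "HOL-Analysis.Analysis"
begin

text \<open>
  Hilbert spaces are types of sort \<open>{real_inner, banach}\<close>; no separability is assumed.
  An unbounded operator is given by its domain \<open>DA\<close> and a function \<open>A\<close>, whose values
  outside \<open>DA\<close> are irrelevant.  Likewise only the values \<open>S t\<close> with \<open>t \<ge> 0\<close> of a
  semigroup \<open>S\<close> are relevant.
\<close>

definition C0_semigroup :: "(real \<Rightarrow> ('h::real_normed_vector \<Rightarrow>\<^sub>L 'h)) \<Rightarrow> bool" where
  "C0_semigroup S \<longleftrightarrow>
     S 0 = id_blinfun \<and>
     (\<forall>s\<ge>0. \<forall>t\<ge>0. S (s + t) = S s o\<^sub>L S t) \<and>
     (\<forall>x. ((\<lambda>t. S t x) \<longlongrightarrow> x) (at_right 0))"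

definition generates_semigroup ::
  "'h::real_normed_vector set \<Rightarrow> ('h \<Rightarrow> 'h) \<Rightarrow> (real \<Rightarrow> ('h \<Rightarrow>\<^sub>L 'h)) \<Rightarrow> bool" where
  "generates_semigroup DA A S \<longleftrightarrow>
     C0_semigroup S \<and>
     DA = {x. \<exists>y. ((\<lambda>t. (1 / t) *\<^sub>R (S t x - x)) \<longlongrightarrow> y) (at_right 0)} \<and>
     (\<forall>x\<in>DA. ((\<lambda>t. (1 / t) *\<^sub>R (S t x - x)) \<longlongrightarrow> A x) (at_right 0))"


section \<open>The space \<open>D(A*)'\<close>\<close>

definition adj_dom :: "'h::real_inner set \<Rightarrow> ('h \<Rightarrow> 'h) \<Rightarrow> 'h set" where
  "adj_dom DA A = {\<phi>. \<exists>\<psi>. \<forall>x\<in>DA. A x \<bullet> \<phi> = x \<bullet> \<psi>}"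

definition adj_op :: "'h::real_inner set \<Rightarrow> ('h \<Rightarrow> 'h) \<Rightarrow> 'h \<Rightarrow> 'h" where
  "adj_op DA A \<phi> = (THE \<psi>. \<forall>x\<in>DA. A x \<bullet> \<phi> = x \<bullet> \<psi>)"

text \<open>The norm of the graph inner product of \<open>D(A*)\<close>.\<close>

definition adj_graph_norm :: "'h::real_inner set \<Rightarrow> ('h \<Rightarrow> 'h) \<Rightarrow> 'h \<Rightarrow> real" where
  "adj_graph_norm DA A \<phi> = sqrt (\<phi> \<bullet> \<phi> + adj_op DA A \<phi> \<bullet> adj_op DA A \<phi>)"

text \<open>
  Since \<open>D(A*)\<close> depends on \<open>A\<close>, its dual is a set of functionals rather than a type.  The
  functionals are taken extensional, so that equality in \<open>D(A*)'\<close> is equality of functions.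
\<close>

definition adj_dual :: "'h::real_inner set \<Rightarrow> ('h \<Rightarrow> 'h) \<Rightarrow> ('h \<Rightarrow> real) set" where
  "adj_dual DA A =
     {f \<in> extensional (adj_dom DA A).
        (\<forall>\<phi>\<in>adj_dom DA A. \<forall>\<psi>\<in>adj_dom DA A. f (\<phi> + \<psi>) = f \<phi> + f \<psi>) \<and>
        (\<forall>c. \<forall>\<phi>\<in>adj_dom DA A. f (c *\<^sub>R \<phi>) = c * f \<phi>) \<and>
        (\<exists>K. \<forall>\<phi>\<in>adj_dom DA A. \<bar>f \<phi>\<bar> \<le> K * adj_graph_norm DA A \<phi>)}"

definition adj_dual_norm :: "'h::real_inner set \<Rightarrow> ('h \<Rightarrow> 'h) \<Rightarrow> ('h \<Rightarrow> real) \<Rightarrow> real" where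
  "adj_dual_norm DA A f =
     (SUP \<phi>\<in>{\<phi> \<in> adj_dom DA A. adj_graph_norm DA A \<phi> \<le> 1}. \<bar>f \<phi>\<bar>)"

text \<open>The embedding of the pivot space into \<open>D(A*)'\<close>.\<close>

definition pivot :: "'h::real_inner set \<Rightarrow> ('h \<Rightarrow> 'h) \<Rightarrow> 'h \<Rightarrow> 'h \<Rightarrow> real" where
  "pivot DA A h = (\<lambda>\<phi>\<in>adj_dom DA A. h \<bullet> \<phi>)"

text \<open>The bounded linear operators from the control space to \<open>D(A*)'\<close>.\<close>

definition control_operators ::
  "'h::real_inner set \<Rightarrow> ('h \<Rightarrow> 'h) \<Rightarrow> ('u::real_normed_vector \<Rightarrow> 'h \<Rightarrow> real) set" where
  "control_operators DA A =
     {B. (\<forall>v. B v \<in> adj_dual DA A) \<and>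
         (\<forall>v w. B (v + w) = (\<lambda>\<phi>\<in>adj_dom DA A. B v \<phi> + B w \<phi>)) \<and>
         (\<forall>c v. B (c *\<^sub>R v) = (\<lambda>\<phi>\<in>adj_dom DA A. c * B v \<phi>)) \<and>
         (\<exists>K. \<forall>v. adj_dual_norm DA A (B v) \<le> K * norm v)}"

text \<open>
  The continuous extension of \<open>S t\<close> to \<open>D(A*)'\<close>, which is the transpose of the restriction of
  the Hilbert space adjoint of \<open>S t\<close> to \<open>D(A*)\<close>.
\<close>

definition semigroup_ext ::
  "'h::real_inner set \<Rightarrow> ('h \<Rightarrow> 'h) \<Rightarrow> (real \<Rightarrow> ('h \<Rightarrow>\<^sub>L 'h)) \<Rightarrow> real \<Rightarrow> ('h \<Rightarrow> real) \<Rightarrow> 'h \<Rightarrow> real" where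
  "semigroup_ext DA A S t f = (\<lambda>\<phi>\<in>adj_dom DA A. f (adjoint (blinfun_apply (S t)) \<phi>))"


section \<open>Controls, admissibility and solutions\<close>

text \<open>
  Strong (Bochner) measurability: almost everywhere limit of simple functions.  On a
  non-separable space this is stronger than Borel measurability, and the Bochner integral of
  the library is restricted to second countable types.
\<close>

definition strongly_measurable :: "'a measure \<Rightarrow> ('a \<Rightarrow> 'b::topological_space) \<Rightarrow> bool" where
  "strongly_measurable M f \<longleftrightarrow>
     (\<exists>g::nat \<Rightarrow> 'a \<Rightarrow> 'b. (\<forall>n. simple_function M (g n)) \<and>
        (AE x in M. (\<lambda>n. g n x) \<longlonglongrightarrow> f x))"

definition L2_controls :: "real \<Rightarrow> (real \<Rightarrow> 'u::real_normed_vector) set" where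
  "L2_controls T =
     {u. strongly_measurable (lebesgue_on {0<..<T}) u \<and>
         integrable (lebesgue_on {0<..<T}) (\<lambda>t. (norm (u t))\<^sup>2)}"

text \<open>
  The \<open>D(A*)'\<close>-valued integral of \<open>S (t - s) (B (u s))\<close> over \<open>0 < s < t\<close>; integrals in the
  dual space \<open>D(A*)'\<close> are evaluated by pairing with the elements of \<open>D(A*)\<close>.
\<close>

definition input_map ::
  "'h::real_inner set \<Rightarrow> ('h \<Rightarrow> 'h) \<Rightarrow> (real \<Rightarrow> ('h \<Rightarrow>\<^sub>L 'h)) \<Rightarrow> ('u \<Rightarrow> 'h \<Rightarrow> real) \<Rightarrow>
   (real \<Rightarrow> 'u) \<Rightarrow> real \<Rightarrow> 'h \<Rightarrow> real" where
  "input_map DA A S B u t =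
     (\<lambda>\<phi>\<in>adj_dom DA A. LINT s|lebesgue_on {0<..<t}. semigroup_ext DA A S (t - s) (B (u s)) \<phi>)"

definition admissible ::
  "'h::real_inner set \<Rightarrow> ('h \<Rightarrow> 'h) \<Rightarrow> (real \<Rightarrow> ('h \<Rightarrow>\<^sub>L 'h)) \<Rightarrow>
   ('u::real_normed_vector \<Rightarrow> 'h \<Rightarrow> real) \<Rightarrow> bool" where
  "admissible DA A S B \<longleftrightarrow>
     (\<forall>T>0. \<forall>u\<in>L2_controls T.
        \<exists>w. continuous_on {0..T} w \<and> (\<forall>t\<in>{0..T}. pivot DA A (w t) = input_map DA A S B u t))"

text \<open>
  The solution of \<open>x' = A x + B u\<close>, \<open>x 0 = \<xi>\<close>: the element \<open>x t\<close> of the pivot space that equals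
  \<open>S t \<xi>\<close> plus the input term in \<open>D(A*)'\<close>.
\<close>

definition state ::
  "'h::real_inner set \<Rightarrow> ('h \<Rightarrow> 'h) \<Rightarrow> (real \<Rightarrow> ('h \<Rightarrow>\<^sub>L 'h)) \<Rightarrow> ('u \<Rightarrow> 'h \<Rightarrow> real) \<Rightarrow>
   'h \<Rightarrow> (real \<Rightarrow> 'u) \<Rightarrow> real \<Rightarrow> 'h" where
  "state DA A S B \<xi> u t =
     (THE h. pivot DA A h =
        (\<lambda>\<phi>\<in>adj_dom DA A. pivot DA A (S t \<xi>) \<phi> + input_map DA A S B u t \<phi>))"


section \<open>Yosida approximation\<close>

text \<open>
  \<open>J\<^sub>k = k (k id - A)\<^sup>-\<^sup>1\<close> for \<open>k\<close> larger than the growth bound of \<open>S\<close>; for smaller \<open>k\<close> the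
  integral may fail to exist.
\<close>

definition yosida :: "(real \<Rightarrow> ('h::{real_inner, banach} \<Rightarrow>\<^sub>L 'h)) \<Rightarrow> nat \<Rightarrow> 'h \<Rightarrow> 'h" where
  "yosida S k x = real k *\<^sub>R integral {0..} (\<lambda>s. exp (- (real k * s)) *\<^sub>R S s x)"

text \<open>
  The continuous extension of \<open>J\<^sub>k\<close> to an operator from \<open>D(A*)'\<close> to the pivot space: the
  transpose of the adjoint of \<open>J\<^sub>k\<close>, which maps the pivot space into \<open>D(A*)\<close>.
\<close>

definition yosida_ext :: "(real \<Rightarrow> ('h::{real_inner, banach} \<Rightarrow>\<^sub>L 'h)) \<Rightarrow> nat \<Rightarrow> ('h \<Rightarrow> real) \<Rightarrow> 'h" where
  "yosida_ext S k f = (THE h. \<forall>\<phi>. h \<bullet> \<phi> = f (adjoint (yosida S k) \<phi>))"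

text \<open>\<open>B\<^sub>k = J\<^sub>k B\<close>, with values in the pivot space, which is then regarded as a subspace of
  \<open>D(A*)'\<close>.\<close>

definition yosida_control ::
  "(real \<Rightarrow> ('h::{real_inner, banach} \<Rightarrow>\<^sub>L 'h)) \<Rightarrow> ('u \<Rightarrow> 'h \<Rightarrow> real) \<Rightarrow> nat \<Rightarrow> 'u \<Rightarrow> 'h" where
  "yosida_control S B k v = yosida_ext S k (B v)"

definition yosida_control_dual ::
  "'h::{real_inner, banach} set \<Rightarrow> ('h \<Rightarrow> 'h) \<Rightarrow> (real \<Rightarrow> ('h \<Rightarrow>\<^sub>L 'h)) \<Rightarrow>
   ('u \<Rightarrow> 'h \<Rightarrow> real) \<Rightarrow> nat \<Rightarrow> 'u \<Rightarrow> 'h \<Rightarrow> real" where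
  "yosida_control_dual DA A S B k v = pivot DA A (yosida_control S B k v)"


section \<open>The optimal control problem\<close>

definition cost ::
  "'h::real_inner set \<Rightarrow> ('h \<Rightarrow> 'h) \<Rightarrow> (real \<Rightarrow> ('h \<Rightarrow>\<^sub>L 'h)) \<Rightarrow>
   ('u::real_normed_vector \<Rightarrow> 'h \<Rightarrow> real) \<Rightarrow> ('h \<Rightarrow>\<^sub>L 'h) \<Rightarrow> ('h \<Rightarrow>\<^sub>L 'h) \<Rightarrow> 'h \<Rightarrow> real \<Rightarrow>
   'h \<Rightarrow> (real \<Rightarrow> 'u) \<Rightarrow> real" where
  "cost DA A S B C P0 z T \<xi> u =
     (LINT t|lebesgue_on {0<..<T}. (norm (C (state DA A S B \<xi> u t) - z))\<^sup>2 + (norm (u t))\<^sup>2) +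
     P0 (state DA A S B \<xi> u T) \<bullet> state DA A S B \<xi> u T"

definition optimal_control ::
  "'h::real_inner set \<Rightarrow> ('h \<Rightarrow> 'h) \<Rightarrow> (real \<Rightarrow> ('h \<Rightarrow>\<^sub>L 'h)) \<Rightarrow>
   ('u::real_normed_vector \<Rightarrow> 'h \<Rightarrow> real) \<Rightarrow> ('h \<Rightarrow>\<^sub>L 'h) \<Rightarrow> ('h \<Rightarrow>\<^sub>L 'h) \<Rightarrow> 'h \<Rightarrow> real \<Rightarrow>
   'h \<Rightarrow> (real \<Rightarrow> 'u) \<Rightarrow> bool" where
  "optimal_control DA A S B C P0 z T \<xi> u \<longleftrightarrow>
     u \<in> L2_controls T \<and>
     (\<forall>v\<in>L2_controls T. cost DA A S B C P0 z T \<xi> u \<le> cost DA A S B C P0 z T \<xi> v)"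

text \<open>
  The mild solution of \<open>y' = - A* y - C* (C x - z)\<close>, \<open>y T = P0 (x T)\<close>, where \<open>A*\<close> generates the
  semigroup of the adjoints of the \<open>S t\<close>.
\<close>

definition adjoint_state ::
  "(real \<Rightarrow> ('h::{real_inner, banach} \<Rightarrow>\<^sub>L 'h)) \<Rightarrow> ('h \<Rightarrow>\<^sub>L 'h) \<Rightarrow> ('h \<Rightarrow>\<^sub>L 'h) \<Rightarrow> 'h \<Rightarrow> real \<Rightarrow>
   (real \<Rightarrow> 'h) \<Rightarrow> real \<Rightarrow> 'h" where
  "adjoint_state S C P0 z T x t =
     adjoint (blinfun_apply (S (T - t))) (P0 (x T)) +
     integral {t..T}
       (\<lambda>s. adjoint (blinfun_apply (S (s - t))) (adjoint (blinfun_apply C) (C (x s) - z)))"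


section \<open>Modes of convergence\<close>

definition converges_L2 :: "real \<Rightarrow> (nat \<Rightarrow> real \<Rightarrow> 'u::real_normed_vector) \<Rightarrow> (real \<Rightarrow> 'u) \<Rightarrow> bool" where
  "converges_L2 T f g \<longleftrightarrow>
     (\<forall>\<^sub>F k in sequentially. f k \<in> L2_controls T) \<and> g \<in> L2_controls T \<and>
     (\<lambda>k. sqrt (LINT t|lebesgue_on {0<..<T}. (norm (f k t - g t))\<^sup>2)) \<longlonglongrightarrow> 0"

definition converges_C :: "real \<Rightarrow> (nat \<Rightarrow> real \<Rightarrow> 'h::metric_space) \<Rightarrow> (real \<Rightarrow> 'h) \<Rightarrow> bool" where
  "converges_C T f g \<longleftrightarrow>
     (\<forall>\<^sub>F k in sequentially. continuous_on {0..T} (f k)) \<and> continuous_on {0..T} g \<and>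
     uniform_limit {0..T} f g sequentially"

end

(* Fix a real k0 above the growth bound and let R be the resolvent of A at k0. Then D(A-star) is
   the range of the adjoint of R, so B = (k0 - A) b in D(A-star)' for a bounded operator b from U
   to H, and the input term L_t u of the state is determined by its pairings with D(A-star), which
   are inner products of u with continuous functions. Admissibility and uniform boundedness make
   L_t bounded on L2, uniformly in t. Since J_k commutes with the semigroup, the states of the
   approximate problems are S(t) xi + J_k L_t u: the approximation only inserts J_k.

   Both problems are thus the minimization of a strongly convex quadratic functional on L2. Let u_k
   and u be the minimizers. Testing both Euler equations with u_k - u and subtracting, the terms
   that are quadratic in the difference of the states have a good sign, and what remains is
   controlled by (J_k - id) along L_t u and by (J_k-star - id) along C-star (C x(t) - z) and P0 x(T).
   J_k and its adjoint are bounded and converge strongly to the identity, hence uniformly on these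
   compact sets. So u_k tends to u in norm, without weak compactness, and the states, the adjoint
   states and the minima follow. *)

theory Submission
  imports Defs
begin

section \<open>Hilbert spaces and uniform boundedness\<close>

text \<open>The control space may be non-separable, so the Hilbert space of controls is built as a
  quotient of strongly measurable functions; its completeness carries both the uniform boundedness
  argument and the existence of minimizers. Its elements live on the whole line: controls on (0,t)
  for all t up to T, extended by zero, then lie in one space, and pairing the input term at time t
  with \<open>R' p\<close> becomes an inner product with a continuous function of s, namely the
  adjoint of \<open>b\<close> applied to \<open>S' (t - s) p\<close>, with \<open>S'\<close> the
  adjoint semigroup. The recurring obstacle is that strong convergence does not pass to adjoints.
  Operator norm estimates do, so the smoothing factor R is put in front: R (J_k - id) = (k0 R - id)
  R_k, with R_k the resolvent at k, is of order 1/k, and R (S h - id) is of order h. Taking adjoints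
  yields convergence on the range of \<open>R'\<close>, which is dense because R is injective, and
  bounds uniform in k or h extend it to all of H. Continuity of the kernels, convergence of the
  adjoint of J_k and even density of D(A) are obtained along this route.\<close>

text \<open>The midpoint of two near minimizers stays in \<open>V\<close> and cannot fall below the
  infimum, so the gain in \<open>conv\<close> bounds their distance: minimizing sequences are
  Cauchy. This serves three times, for Riesz representation, orthogonal projection and optimal
  controls.\<close>

lemma quadratic_minimum:
  fixes V :: "'a::{real_inner, banach} set" and J :: "'a \<Rightarrow> real"
  assumes V: "closed V" "V \<noteq> {}" "\<And>x y. x \<in> V \<Longrightarrow> y \<in> V \<Longrightarrow> (1/2) *\<^sub>R (x + y) \<in> V"
    and cont: "continuous_on V J"
    and bdd: "\<And>x. x \<in> V \<Longrightarrow> K \<le> J x"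
    and conv: "\<And>x y. x \<in> V \<Longrightarrow> y \<in> V \<Longrightarrow>
      J ((1/2) *\<^sub>R (x + y)) \<le> (J x + J y) / 2 - (norm (x - y))\<^sup>2 / 4"
  obtains x where "x \<in> V" "\<And>y. y \<in> V \<Longrightarrow> J x \<le> J y"
proof -
  define m where "m = (INF x\<in>V. J x)"
  have bb: "bdd_below (J ` V)" using bdd by (intro bdd_belowI2)
  have m_le: "m \<le> J x" if "x \<in> V" for x
    unfolding m_def using bb that by (rule cINF_lower)
  have "\<exists>x\<in>V. J x < m + 1 / real (Suc n)" for n
  proof -
    have "m < m + 1 / real (Suc n)" by simp
    then show ?thesis unfolding m_def using cINF_less_iff[OF V(2) bb] by blast
  qed
  then obtain X where X: "\<And>n. X n \<in> V" "\<And>n. J (X n) < m + 1 / real (Suc n)" by metis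
  have est: "(norm (X i - X j))\<^sup>2 \<le> 2 / real (Suc i) + 2 / real (Suc j)" for i j
  proof -
    have "m \<le> (J (X i) + J (X j)) / 2 - (norm (X i - X j))\<^sup>2 / 4"
      using conv[OF X(1)[of i] X(1)[of j]] m_le[OF V(3)[OF X(1)[of i] X(1)[of j]]] by linarith
    then have "(norm (X i - X j))\<^sup>2 \<le> 2 * (J (X i) - m) + 2 * (J (X j) - m)" by argo
    also have "\<dots> \<le> 2 * (1 / real (Suc i)) + 2 * (1 / real (Suc j))"
      using X(2)[of i] X(2)[of j] by argo
    finally show ?thesis by simp
  qed
  have "Cauchy X"
  proof (rule metric_CauchyI)
    fix e :: real assume "0 < e"
    obtain N where N: "4 / e\<^sup>2 < real (Suc N)" by (meson reals_Archimedean2 less_trans lessI of_nat_less_iff)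
    have "dist (X i) (X j) < e" if "i \<ge> N" "j \<ge> N" for i j
    proof -
      have "2 / real (Suc i) \<le> 2 / real (Suc N)" "2 / real (Suc j) \<le> 2 / real (Suc N)"
        using that by (auto intro!: divide_left_mono)
      then have "(norm (X i - X j))\<^sup>2 \<le> 4 / real (Suc N)" using est[of i j] by simp
      also have "\<dots> < e\<^sup>2" using N \<open>0 < e\<close> by (simp add: field_simps)
      finally show ?thesis using \<open>0 < e\<close> by (simp add: dist_norm power_less_imp_less_base)
    qed
    then show "\<exists>M. \<forall>m\<ge>M. \<forall>n\<ge>M. dist (X m) (X n) < e" by blast
  qed
  then obtain x where x: "X \<longlonglongrightarrow> x" by (auto simp: Cauchy_convergent_iff convergent_def)
  have xV: "x \<in> V" using V(1) X(1) x closed_sequentially by blast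
  have "(\<lambda>n. J (X n)) \<longlonglongrightarrow> J x"
    using continuous_on_tendsto_compose[OF cont x xV] X(1) by simp
  moreover have "(\<lambda>n. m + 1 / real (Suc n)) \<longlonglongrightarrow> m"
    using tendsto_add[OF tendsto_const[of m] LIMSEQ_inverse_real_of_nat] by (simp add: inverse_eq_divide)
  ultimately have "J x \<le> m"
    by (rule LIMSEQ_le) (use X(2) less_imp_le in blast)
  then show ?thesis using that xV m_le by fastforce
qed

lemma quadratic_nonneg_imp_linear_term_zero:
  fixes a b :: real
  assumes "\<And>t. 0 \<le> 2 * t * a + t\<^sup>2 * b"
  shows "a = 0"
proof (rule ccontr)
  assume "a \<noteq> 0"
  \<comment> \<open>\<open>c\<close> is positive and exceeds \<open>b\<close> whatever the sign of
    \<open>b\<close>; at t = -a/c the quadratic is negative.\<close>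
  define c where "c = \<bar>b\<bar> + 1"
  have c: "c > 0" "b < c" "c \<noteq> 0" by (auto simp: c_def)
  have "0 \<le> 2 * (- a / c) * a + (- a / c)\<^sup>2 * b" by (rule assms)
  also have "\<dots> = (a\<^sup>2 / c) * (b / c - 2)"
    using c by (simp add: power2_eq_square field_simps)
  finally have "0 \<le> (a\<^sup>2 / c) * (b / c - 2)" .
  moreover have "b / c - 2 < 0" using c by (simp add: field_simps)
  moreover have "a\<^sup>2 / c > 0" using c \<open>a \<noteq> 0\<close> by simp
  ultimately show False using mult_pos_neg[of "a\<^sup>2 / c" "b / c - 2"] by linarith
qed

lemma midpoint_norm:
  fixes x y :: "'a::real_inner"
  shows "(norm ((1/2) *\<^sub>R (x + y)))\<^sup>2 = ((norm x)\<^sup>2 + (norm y)\<^sup>2) / 2 - (norm (x - y))\<^sup>2 / 4"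
  by (simp add: power_mult_distrib power2_norm_eq_inner inner_simps inner_commute field_simps)

text \<open>The representing vector is the minimizer of |x|^2 - 2 l x, which completing the square
  bounds below by -K^2; vanishing of the first variation is the claim.\<close>

lemma riesz_representation:
  fixes l :: "'a::{real_inner, banach} \<Rightarrow> real"
  assumes "bounded_linear l"
  obtains b where "\<And>x. l x = b \<bullet> x"
proof -
  interpret bounded_linear l by fact
  obtain K where K: "\<And>x. norm (l x) \<le> norm x * K" using bounded by blast
  define J where "J x = (norm x)\<^sup>2 - 2 * l x" for x
  obtain b where b: "\<And>y. J b \<le> J y"
  proof (rule quadratic_minimum[of UNIV J "- K\<^sup>2"])
    show "continuous_on UNIV J"
      unfolding J_def by (intro continuous_intros linear_continuous_on assms)
    show "- K\<^sup>2 \<le> J x" for x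
    proof -
      have "0 \<le> (norm x - K)\<^sup>2" by simp
      then show ?thesis using K[of x] by (simp add: J_def power2_eq_square algebra_simps abs_le_iff)
    qed
    show "J ((1/2) *\<^sub>R (x + y)) \<le> (J x + J y) / 2 - (norm (x - y))\<^sup>2 / 4" for x y
      unfolding J_def midpoint_norm by (simp only: scaleR add) (simp add: field_simps)
  qed (use that in auto)
  have "l x = b \<bullet> x" for x
  proof -
    have "b \<bullet> x - l x = 0"
    proof (rule quadratic_nonneg_imp_linear_term_zero)
      fix t :: real
      have "J b \<le> J (b + t *\<^sub>R x)" by (rule b)
      then show "0 \<le> 2 * t * (b \<bullet> x - l x) + t\<^sup>2 * (x \<bullet> x)"
        unfolding J_def add scaleR power2_norm_eq_inner
        by (simp add: inner_simps inner_commute[of b x] algebra_simps power2_eq_square)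
    qed
    then show ?thesis by simp
  qed
  then show ?thesis using that by blast
qed

text \<open>The point \<open>p\<close> of the closure nearest to \<open>x\<close> differs from
  \<open>x\<close> by a vector orthogonal to \<open>W\<close>, and \<open>perp\<close> makes that
  vector zero.\<close>

lemma dense_subspace_criterion:
  fixes W :: "'a::{real_inner, banach} set"
  assumes W: "subspace W" and perp: "\<And>y. (\<And>w. w \<in> W \<Longrightarrow> w \<bullet> y = 0) \<Longrightarrow> y = 0"
  shows "closure W = UNIV"
proof -
  have sub: "subspace (closure W)"
  proof (rule subspaceI)
    show "0 \<in> closure W" using subspace_0[OF W] closure_subset by blast
    show "x + y \<in> closure W" if xy: "x \<in> closure W" "y \<in> closure W" for x y
    proof -
      obtain f g where "\<forall>n. f n \<in> W" "f \<longlonglongrightarrow> x" "\<forall>n. g n \<in> W" "g \<longlonglongrightarrow> y"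
        using xy unfolding closure_sequential by blast
      then have "\<forall>n. f n + g n \<in> W" "(\<lambda>n. f n + g n) \<longlonglongrightarrow> x + y"
        by (auto intro: subspace_add[OF W] tendsto_add)
      then show ?thesis unfolding closure_sequential by (intro exI[of _ "\<lambda>n. f n + g n"]) blast
    qed
    show "c *\<^sub>R x \<in> closure W" if x: "x \<in> closure W" for c x
    proof -
      obtain f where "\<And>n. f n \<in> W" "f \<longlonglongrightarrow> x"
        using x unfolding closure_sequential by blast
      then have "\<forall>n. c *\<^sub>R f n \<in> W" "(\<lambda>n. c *\<^sub>R f n) \<longlonglongrightarrow> c *\<^sub>R x"
        by (auto intro: subspace_scale[OF W] tendsto_scaleR)
      then show ?thesis unfolding closure_sequential by (intro exI[of _ "\<lambda>n. c *\<^sub>R f n"]) blast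
    qed
  qed
  have "x \<in> closure W" for x
  proof -
    obtain p where p: "p \<in> closure W" "\<And>y. y \<in> closure W \<Longrightarrow> (norm (p - x))\<^sup>2 \<le> (norm (y - x))\<^sup>2"
    proof (rule quadratic_minimum[of "closure W" "\<lambda>y. (norm (y - x))\<^sup>2" 0])
      show "closure W \<noteq> {}" using subspace_0[OF sub] by auto
      show "(1/2) *\<^sub>R (y + w) \<in> closure W" if "y \<in> closure W" "w \<in> closure W" for y w
        by (intro subspace_scale[OF sub] subspace_add[OF sub] that)
      show "continuous_on (closure W) (\<lambda>y. (norm (y - x))\<^sup>2)" by (intro continuous_intros)
      show "(norm ((1/2) *\<^sub>R (y + w) - x))\<^sup>2 \<le> ((norm (y - x))\<^sup>2 + (norm (w - x))\<^sup>2) / 2 - (norm (y - w))\<^sup>2 / 4"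
        for y w
      proof -
        have *: "(1/2) *\<^sub>R (y + w) - x = (1/2) *\<^sub>R ((y - x) + (w - x))"
          by (simp add: algebra_simps flip: scaleR_add_left)
        show ?thesis unfolding * midpoint_norm by simp
      qed
    qed (use that in auto)
    have "w \<bullet> (p - x) = 0" if "w \<in> W" for w
    proof (rule quadratic_nonneg_imp_linear_term_zero)
      fix t :: real
      have "(norm (p - x))\<^sup>2 \<le> (norm (p + t *\<^sub>R w - x))\<^sup>2"
        by (intro p(2) subspace_add[OF sub] subspace_scale[OF sub] p(1)) (use that closure_subset in blast)
      then show "0 \<le> 2 * t * (w \<bullet> (p - x)) + t\<^sup>2 * (w \<bullet> w)"
        unfolding power2_norm_eq_inner
        by (simp add: inner_simps inner_commute algebra_simps power2_eq_square)
    qed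
    then have "p - x = 0" by (rule perp)
    then show ?thesis using p(1) by simp
  qed
  then show ?thesis by blast
qed

text \<open>\<open>adjoint\<close> chooses some map satisfying the adjoint identity, so it has
  content only once such a map exists; Riesz representation supplies it. The norm bound results from
  testing the identity with x = \<open>adjoint f y\<close>.\<close>

lemma
  fixes f :: "'a::{real_inner, banach} \<Rightarrow> 'b::real_inner"
  assumes f: "bounded_linear f"
  shows inner_adjoint: "f x \<bullet> y = x \<bullet> adjoint f y"
    and bounded_linear_adjoint: "bounded_linear (adjoint f)"
    and norm_adjoint_le: "0 \<le> K \<Longrightarrow> (\<And>x. norm (f x) \<le> K * norm x) \<Longrightarrow> norm (adjoint f y) \<le> K * norm y"
proof -
  have "\<exists>b. \<forall>x. f x \<bullet> y = x \<bullet> b" for y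
  proof -
    have "bounded_linear (\<lambda>x. f x \<bullet> y)" by (rule bounded_linear_inner_left_comp[OF f])
    from riesz_representation[OF this] show ?thesis by (metis inner_commute)
  qed
  then have "\<exists>g. \<forall>x y. f x \<bullet> y = x \<bullet> g y" by metis
  then have *: "\<forall>x y. f x \<bullet> y = x \<bullet> adjoint f y" unfolding adjoint_def by (rule someI_ex)
  then show adj: "f x \<bullet> y = x \<bullet> adjoint f y" for x y by blast
  have bd: "norm (adjoint f y) \<le> K * norm y" if K0: "0 \<le> K" and K: "\<And>x. norm (f x) \<le> K * norm x" for y K
  proof -
    let ?a = "adjoint f y"
    have "norm ?a * norm ?a = f ?a \<bullet> y"
      by (metis adj power2_norm_eq_inner power2_eq_square)
    also have "\<dots> \<le> norm (f ?a) * norm y" by (rule norm_cauchy_schwarz)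
    also have "\<dots> \<le> (K * norm ?a) * norm y" by (intro mult_right_mono K) auto
    finally have "norm ?a * norm ?a \<le> norm ?a * (K * norm y)" by (simp add: algebra_simps)
    moreover have "0 \<le> K * norm y" using K0 by simp
    ultimately show ?thesis by (cases "?a = 0") auto
  qed
  then show "0 \<le> K \<Longrightarrow> (\<And>x. norm (f x) \<le> K * norm x) \<Longrightarrow> norm (adjoint f y) \<le> K * norm y" .
  obtain K where K: "0 \<le> K" "\<And>x. norm (f x) \<le> norm x * K" using bounded_linear.nonneg_bounded[OF f] by blast
  show "bounded_linear (adjoint f)"
  proof (rule bounded_linear_intro)
    show "adjoint f (y + z) = adjoint f y + adjoint f z" for y z
      by (rule vector_eq_ldot[THEN iffD1]) (simp add: inner_add_right flip: adj)
    show "adjoint f (r *\<^sub>R y) = r *\<^sub>R adjoint f y" for r y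
      by (rule vector_eq_ldot[THEN iffD1]) (simp flip: adj)
    show "norm (adjoint f y) \<le> norm y * K" for y
      using bd[of K y] K by (simp add: mult.commute)
  qed
qed

lemma adjoint_eqI:
  fixes f :: "'a::{real_inner, banach} \<Rightarrow> 'b::real_inner"
  assumes "bounded_linear f" "\<And>x. f x \<bullet> y = x \<bullet> w"
  shows "adjoint f y = w"
  using assms by (metis inner_adjoint vector_eq_ldot)

text \<open>By Baire, some closed set \<open>E n\<close> of points where the family is bounded by n
  contains a ball; subtracting values at its centre bounds the family on a sphere around 0.\<close>

lemma uniform_boundedness:
  fixes F :: "('a::banach \<Rightarrow> 'b::real_normed_vector) set"
  assumes lin: "\<And>f. f \<in> F \<Longrightarrow> bounded_linear f"
    and pt: "\<And>x. \<exists>K. \<forall>f\<in>F. norm (f x) \<le> K"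
  obtains K where "0 < K" "\<And>f x. f \<in> F \<Longrightarrow> norm (f x) \<le> K * norm x"
proof -
  define E where "E n = (\<Inter>f\<in>F. {x. norm (f x) \<le> real n})" for n :: nat
  have clo: "closed (E n)" for n
    unfolding E_def
    by (intro closed_INT ballI closed_Collect_le continuous_intros linear_continuous_on lin)
  have "x \<in> (\<Union>n. E n)" for x
  proof -
    obtain K where "\<forall>f\<in>F. norm (f x) \<le> K" using pt by blast
    moreover obtain n :: nat where "K \<le> real n" using real_arch_simple by blast
    ultimately have "\<forall>f\<in>F. norm (f x) \<le> real n" by fastforce
    then show ?thesis unfolding E_def by blast
  qed
  then have cover: "(\<Union>n. E n) = UNIV" by blast
  have "\<exists>n. interior (E n) \<noteq> {}"
  proof (rule ccontr)
    assume "\<not> ?thesis"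
    then have "euclidean interior_of \<Union>(range E) = {}"
      by (intro Baire_category_alt disjI1 completely_metrizable_space_euclidean) (auto simp: clo)
    then show False using cover by simp
  qed
  then obtain n a where "a \<in> interior (E n)" by blast
  then obtain e where e: "0 < e" "cball a e \<subseteq> E n" by (meson mem_interior_cball)
  \<comment> \<open>\<open>real n + 1\<close> rather than \<open>real n\<close>: the constant has to
    be positive and \<open>n\<close> may be 0.\<close>
  have bd: "norm (f x) \<le> (2 * (real n + 1) / e) * norm x" if f: "f \<in> F" for f x
  proof (cases "x = 0")
    case True
    then show ?thesis using bounded_linear.linear[OF lin[OF f]] by (simp add: linear_0)
  next
    case False
    interpret bounded_linear f by (rule lin[OF f])
    define y where "y = (e / norm x) *\<^sub>R x"
    have "norm y = e" using False e(1) by (simp add: y_def)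
    then have "a + y \<in> E n" "a \<in> E n" using e by (auto intro!: subsetD[OF e(2)] simp: dist_norm)
    then have "norm (f (a + y)) \<le> real n" "norm (f a) \<le> real n" using f by (auto simp: E_def)
    then have "norm (f y) \<le> 2 * real n" using norm_triangle_ineq4[of "f (a + y)" "f a"] by (simp add: add)
    then have "(e / norm x) * norm (f x) \<le> 2 * real n" using e(1) by (simp add: y_def scaleR)
    then have "e * norm (f x) \<le> 2 * real n * norm x" using False by (simp add: field_simps)
    also have "\<dots> \<le> 2 * (real n + 1) * norm x" by (simp add: algebra_simps)
    finally show ?thesis using e(1) by (simp add: field_simps)
  qed
  show ?thesis using that[of "2 * (real n + 1) / e"] bd e(1) by simp
qed

text \<open>Approximation within \<open>d\<close> costs e/2 uniformly in k thanks to the common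
  bound. Linearity and bound are asked only eventually, because the Yosida operators make sense only
  for k above the growth bound.\<close>

lemma strong_null_dense:
  fixes D :: "nat \<Rightarrow> 'a::real_normed_vector \<Rightarrow> 'b::real_normed_vector"
  assumes lin: "\<forall>\<^sub>F k in sequentially. linear (D k)"
    and bd: "\<forall>\<^sub>F k in sequentially. \<forall>x. norm (D k x) \<le> M * norm x"
    and null: "\<And>x. x \<in> W \<Longrightarrow> (\<lambda>k. D k x) \<longlonglongrightarrow> 0" and dense: "closure W = UNIV"
  shows "(\<lambda>k. D k x) \<longlonglongrightarrow> 0"
proof (rule tendstoI)
  fix e :: real assume "0 < e"
  define d where "d = e / (2 * (\<bar>M\<bar> + 1))"
  have d: "d > 0" using \<open>0 < e\<close> by (simp add: d_def)
  have "x \<in> closure W" using dense by simp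
  then obtain w where w: "w \<in> W" "dist w x < d" using d closure_approachable by blast
  have "\<forall>\<^sub>F k in sequentially. dist (D k w) 0 < e / 2"
    using tendstoD[OF null[OF w(1)]] \<open>0 < e\<close> by (meson half_gt_zero)
  with lin bd show "\<forall>\<^sub>F k in sequentially. dist (D k x) 0 < e"
  proof eventually_elim
    case (elim k)
    have "norm (D k (x - w)) \<le> M * norm (x - w)" using elim by blast
    also have "\<dots> \<le> (\<bar>M\<bar> + 1) * norm (x - w)" by (intro mult_right_mono) auto
    also have "\<dots> \<le> (\<bar>M\<bar> + 1) * d" using w(2) by (intro mult_left_mono) (auto simp: dist_norm norm_minus_commute)
    also have "\<dots> = e / 2" by (simp add: d_def field_simps)
    finally have "norm (D k (x - w)) \<le> e / 2" .
    moreover have "D k x = D k (x - w) + D k w" using elim by (metis diff_add_cancel linear_add)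
    ultimately show ?case using elim norm_triangle_ineq[of "D k (x - w)" "D k w"] by simp
  qed
qed

text \<open>A finite net reduces uniformity to finitely many null sequences; the common bound covers
  the distance to the net.\<close>

lemma strong_null_uniform_on_compact:
  fixes D :: "nat \<Rightarrow> 'a::real_normed_vector \<Rightarrow> 'b::real_normed_vector"
  assumes lin: "\<forall>\<^sub>F k in sequentially. linear (D k)"
    and bd: "\<forall>\<^sub>F k in sequentially. \<forall>x. norm (D k x) \<le> M * norm x"
    and null: "\<And>x. (\<lambda>k. D k x) \<longlonglongrightarrow> 0" and K: "compact K" and e: "0 < e"
  shows "\<forall>\<^sub>F k in sequentially. \<forall>x\<in>K. norm (D k x) < e"
proof -
  define d where "d = e / (2 * (\<bar>M\<bar> + 1))"
  have d: "d > 0" using \<open>0 < e\<close> by (simp add: d_def)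
  obtain F where F: "finite F" "K \<subseteq> (\<Union>x\<in>F. ball x d)"
    using K d unfolding compact_eq_totally_bounded by blast
  have "\<forall>\<^sub>F k in sequentially. \<forall>w\<in>F. norm (D k w) < e / 2"
  proof (rule eventually_ball_finite[OF F(1)], rule ballI)
    fix w assume "w \<in> F"
    show "\<forall>\<^sub>F k in sequentially. norm (D k w) < e / 2"
      using tendstoD[OF null[of w], of "e / 2"] e by simp
  qed
  with lin bd show ?thesis
  proof eventually_elim
    case (elim k)
    show ?case
    proof
      fix x assume "x \<in> K"
      then obtain w where w: "w \<in> F" "norm (x - w) < d"
        using F(2) by (fastforce simp: dist_norm norm_minus_commute)
      have "norm (D k (x - w)) \<le> M * norm (x - w)" using elim by blast
      also have "\<dots> \<le> (\<bar>M\<bar> + 1) * norm (x - w)" by (intro mult_right_mono) auto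
      also have "\<dots> \<le> (\<bar>M\<bar> + 1) * d" using w(2) by (intro mult_left_mono) auto
      also have "\<dots> = e / 2" by (simp add: d_def field_simps)
      finally have "norm (D k (x - w)) \<le> e / 2" .
      moreover have "D k x = D k (x - w) + D k w" using elim by (metis diff_add_cancel linear_add)
      moreover have "norm (D k w) < e / 2" using elim w(1) by blast
      ultimately show "norm (D k x) < e" using norm_triangle_ineq[of "D k (x - w)" "D k w"] by simp
    qed
  qed
qed

section \<open>Strongly measurable functions\<close>

lemma strongly_measurable_simple: "simple_function M f \<Longrightarrow> strongly_measurable M f"
  unfolding strongly_measurable_def by (rule exI[of _ "\<lambda>_. f"]) simp

lemma strongly_measurable_cong_AE:
  assumes "strongly_measurable M f" "AE x in M. f x = g x"
  shows "strongly_measurable M g"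
proof -
  obtain s where s: "\<And>n. simple_function M (s n)" "AE x in M. (\<lambda>n. s n x) \<longlonglongrightarrow> f x"
    using assms(1) unfolding strongly_measurable_def by blast
  have "AE x in M. (\<lambda>n. s n x) \<longlonglongrightarrow> g x" using s(2) assms(2) by eventually_elim simp
  then show ?thesis unfolding strongly_measurable_def using s(1) by blast
qed

lemma strongly_measurable_compose2:
  assumes f: "strongly_measurable M f" and g: "strongly_measurable M g"
    and h: "continuous_on UNIV (\<lambda>p. h (fst p) (snd p))"
  shows "strongly_measurable M (\<lambda>x. h (f x) (g x))"
proof -
  obtain s where s: "\<And>n. simple_function M (s n)" "AE x in M. (\<lambda>n. s n x) \<longlonglongrightarrow> f x"
    using f unfolding strongly_measurable_def by blast
  obtain t where t: "\<And>n. simple_function M (t n)" "AE x in M. (\<lambda>n. t n x) \<longlonglongrightarrow> g x"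
    using g unfolding strongly_measurable_def by blast
  have "AE x in M. (\<lambda>n. h (s n x) (t n x)) \<longlonglongrightarrow> h (f x) (g x)"
    using s(2) t(2)
  proof eventually_elim
    case (elim x)
    from continuous_on_tendsto_compose[OF h tendsto_Pair[OF elim]] show ?case by simp
  qed
  moreover have "simple_function M (\<lambda>x. h (s n x) (t n x))" for n
    by (rule simple_function_compose2[OF s(1) t(1)])
  ultimately show ?thesis unfolding strongly_measurable_def
    by (intro exI[of _ "\<lambda>n x. h (s n x) (t n x)"]) blast
qed

lemma strongly_measurable_compose:
  assumes f: "strongly_measurable M f" and h: "continuous_on UNIV h"
  shows "strongly_measurable M (\<lambda>x. h (f x))"
proof -
  have "continuous_on UNIV (\<lambda>p::'b \<times> 'b. h (fst p))"
    by (intro continuous_on_compose2[OF h] continuous_intros) auto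
  from strongly_measurable_compose2[OF f f, of "\<lambda>a b. h a", OF this] show ?thesis .
qed

lemma (in complete_measure) borel_measurable_cong_AE:
  assumes f: "f \<in> borel_measurable M" and ae: "AE x in M. f x = g x"
  shows "g \<in> borel_measurable M"
proof (rule measurableI)
  fix A :: "'b set" assume "A \<in> sets borel"
  then have "f -` A \<inter> space M \<in> sets M" using f by (rule measurable_sets[rotated])
  then show "g -` A \<inter> space M \<in> sets M"
  proof (rule in_sets_AE[rotated])
    show "AE x in M. x \<in> f -` A \<inter> space M \<longleftrightarrow> x \<in> g -` A \<inter> space M"
      using ae by eventually_elim auto
  qed auto
qed auto

text \<open>The simple functions converge only off a null set. Both they and \<open>f\<close> are
  made constant there, and completeness transfers measurability back to \<open>f\<close>.\<close>

lemma (in complete_measure) strongly_measurable_imp_borel: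
  fixes f :: "'a \<Rightarrow> 'b::metric_space"
  assumes "strongly_measurable M f"
  shows "f \<in> borel_measurable M"
proof -
  obtain s where s: "\<And>n. simple_function M (s n)" "AE x in M. (\<lambda>n. s n x) \<longlonglongrightarrow> f x"
    using assms unfolding strongly_measurable_def by blast
  obtain N where N: "N \<in> null_sets M" "{x \<in> space M. \<not> (\<lambda>n. s n x) \<longlonglongrightarrow> f x} = N"
    using s(2) AE_iff_null_sets by blast
  \<comment> \<open>Any constant serves; a metric space has no distinguished point.\<close>
  define a where "a = f undefined"
  define t where "t n x = (if x \<in> N then a else s n x)" for n x
  define g where "g x = (if x \<in> N then a else f x)" for x
  have "g \<in> borel_measurable M"
  proof (rule borel_measurable_LIMSEQ_metric)
    show "t n \<in> borel_measurable M" for n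
      unfolding t_def using N(1) s(1)[of n]
      by (intro measurable_If_set borel_measurable_simple_function) auto
    show "(\<lambda>n. t n x) \<longlonglongrightarrow> g x" if "x \<in> space M" for x
      using that N(2) by (auto simp: t_def g_def)
  qed
  moreover have "AE x in M. g x = f x"
    using AE_not_in[OF N(1)] by eventually_elim (simp add: g_def)
  ultimately show ?thesis by (rule borel_measurable_cong_AE)
qed

text \<open>Pettis: strong measurability is measurability of the distances to points together with
  essentially separable range. Unlike the definition, this form passes to limits.\<close>

lemma (in complete_measure) strongly_measurable_separable:
  fixes f :: "'a \<Rightarrow> 'b::metric_space"
  assumes "strongly_measurable M f"
  shows "\<exists>D. countable D \<and> (AE x in M. f x \<in> closure D)"
    and "(\<lambda>x. dist (f x) v) \<in> borel_measurable M"
proof -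
  obtain s where s: "\<And>n. simple_function M (s n)" "AE x in M. (\<lambda>n. s n x) \<longlonglongrightarrow> f x"
    using assms unfolding strongly_measurable_def by blast
  define D where "D = (\<Union>n. s n ` space M)"
  have "countable D" unfolding D_def
    by (rule countable_UN[OF countableI_type countable_finite[OF simple_functionD(1)[OF s(1)]]])
  moreover have "AE x in M. f x \<in> closure D"
    using s(2) AE_space
  proof eventually_elim
    case (elim x)
    then have "\<forall>n. s n x \<in> D" by (auto simp: D_def)
    then show ?case unfolding closure_sequential using elim(1) by (intro exI[of _ "\<lambda>n. s n x"]) blast
  qed
  ultimately show "\<exists>D. countable D \<and> (AE x in M. f x \<in> closure D)" by blast
  show "(\<lambda>x. dist (f x) v) \<in> borel_measurable M"
    by (intro strongly_measurable_imp_borel strongly_measurable_compose[OF assms] continuous_intros)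
qed

text \<open>The n-th approximant takes the point nearest to \<open>f x\<close> among the first n + 1
  points of \<open>D\<close>, ties going to the least index. Only distances are compared, hence
  measurability of the distances is enough to make it a simple function.\<close>

lemma strongly_measurable_if_separable:
  fixes f :: "'a \<Rightarrow> 'b::metric_space"
  assumes D: "countable D" "AE x in M. f x \<in> closure D"
    and meas: "\<And>v. (\<lambda>x. dist (f x) v) \<in> borel_measurable M"
  shows "strongly_measurable M f"
proof (cases "D = {}")
  \<comment> \<open>With \<open>D\<close> empty almost no point exists, so \<open>f\<close> is
    almost everywhere equal to any constant.\<close>
  case True
  then have "AE x in M. undefined = f x" using D(2) by (auto elim: eventually_mono)
  then show ?thesis by (rule strongly_measurable_cong_AE[OF strongly_measurable_simple, rotated]) simp
next
  case False
  define d where "d = from_nat_into D"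
  have D_eq: "D = range d" using False D(1) by (simp add: d_def range_from_nat_into)
  define best where "best n x i \<longleftrightarrow> i \<le> n \<and> (\<forall>j\<le>n. dist (f x) (d i) \<le> dist (f x) (d j))" for n x i
  define I where "I n x = (LEAST i. best n x i)" for n x
  have "\<exists>i. best n x i" for n x
  proof -
    obtain i where "i \<in> {..n}" "\<And>j. j \<in> {..n} \<Longrightarrow> dist (f x) (d i) \<le> dist (f x) (d j)"
      using arg_min_if_finite(1)[of "{..n}" "\<lambda>j. dist (f x) (d j)"]
        arg_min_least[of "{..n}" _ "\<lambda>j. dist (f x) (d j)"] by blast
    then show ?thesis by (auto simp: best_def)
  qed
  then have best: "best n x (I n x)" for n x unfolding I_def by (rule LeastI_ex)
  have sf: "simple_function M (I n)" for n
    unfolding simple_function_eq_measurable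
  proof
    have "I n ` space M \<subseteq> {..n}" using best by (auto simp: best_def)
    then show "finite (I n ` space M)" by (rule finite_subset) simp
    have "Measurable.pred M (\<lambda>x. best n x i)" for i
      unfolding best_def using meas by measurable
    then show "I n \<in> measurable M (count_space UNIV)"
      unfolding I_def[abs_def] by measurable
  qed
  have "AE x in M. (\<lambda>n. d (I n x)) \<longlonglongrightarrow> f x"
    using D(2)
  proof eventually_elim
    case (elim x)
    show ?case
    proof (rule tendstoI)
      fix e :: real assume "0 < e"
      with elim obtain k where k: "dist (f x) (d k) < e"
        unfolding D_eq closure_approachable by (metis dist_commute imageE)
      show "\<forall>\<^sub>F n in sequentially. dist (d (I n x)) (f x) < e"
        using eventually_ge_at_top[of k]
      proof eventually_elim
        case (elim n)
        then have "dist (f x) (d (I n x)) \<le> dist (f x) (d k)" using best[of n x] by (simp add: best_def)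
        with k show ?case by (simp add: dist_commute)
      qed
    qed
  qed
  then show ?thesis unfolding strongly_measurable_def
    using simple_function_compose1[OF sf, of d] by (intro exI[of _ "\<lambda>n x. d (I n x)"]) simp
qed

text \<open>The separable range of the limit is the closure of the union of the countable sets of
  all \<open>f n\<close>, and its distances to points are almost everywhere limits of measurable
  functions.\<close>

lemma (in complete_measure) strongly_measurable_AE_limit:
  fixes f :: "nat \<Rightarrow> 'a \<Rightarrow> 'b::metric_space"
  assumes f: "\<And>n. strongly_measurable M (f n)" and lim: "AE x in M. (\<lambda>n. f n x) \<longlonglongrightarrow> g x"
  shows "strongly_measurable M g"
proof -
  obtain D where D: "\<And>n. countable (D n)" "\<And>n. AE x in M. f n x \<in> closure (D n)"
    using strongly_measurable_separable(1)[OF f] by metis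
  have "AE x in M. \<forall>n. f n x \<in> closure (D n)" using D(2) by (simp add: AE_all_countable)
  with lim have "AE x in M. g x \<in> closure (\<Union>n. D n)"
  proof eventually_elim
    case (elim x)
    have "f n x \<in> closure (\<Union>n. D n)" for n
      using elim(2) closure_mono[of "D n" "\<Union>n. D n"] by blast
    then show ?case by (intro closed_sequentially[OF closed_closure _ elim(1)])
  qed
  moreover have "countable (\<Union>n. D n)" using D(1) by blast
  moreover have "(\<lambda>x. dist (g x) v) \<in> borel_measurable M" for v
  \<comment> \<open>The real function is fed to the same criterion with the rationals as dense set,
    so what is shown measurable is its distance to a constant \<open>c\<close>.\<close>
  proof (rule strongly_measurable_imp_borel, rule strongly_measurable_if_separable)
    show "countable (\<rat> :: real set)" using countable_rat by simp
    show "AE x in M. dist (g x) v \<in> closure (\<rat> :: real set)" by (simp add: Rats_closure_real)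
    fix c :: real
    obtain N where N: "N \<in> null_sets M" "{x \<in> space M. \<not> (\<lambda>n. f n x) \<longlonglongrightarrow> g x} = N"
      using lim AE_iff_null_sets by blast
    define h where "h x = (if x \<in> N then 0 else dist (dist (g x) v) c)" for x
    have "h \<in> borel_measurable M"
    proof (rule borel_measurable_LIMSEQ_metric)
      show "(\<lambda>x. if x \<in> N then 0 else dist (dist (f n x) v) c) \<in> borel_measurable M" for n
        using strongly_measurable_separable(2)[OF f[of n], of v] N(1)
        by (intro measurable_If_set borel_measurable_dist) auto
      show "(\<lambda>n. if x \<in> N then 0 else dist (dist (f n x) v) c) \<longlonglongrightarrow> h x" if "x \<in> space M" for x
        using that N(2) by (auto simp: h_def intro!: tendsto_intros)
    qed
    moreover have "AE x in M. h x = dist (dist (g x) v) c"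
      using AE_not_in[OF N(1)] by eventually_elim (simp add: h_def)
    ultimately show "(\<lambda>x. dist (dist (g x) v) c) \<in> borel_measurable M" by (rule borel_measurable_cong_AE)
  qed
  ultimately show ?thesis using strongly_measurable_if_separable by blast
qed

section \<open>The Hilbert space of square integrable functions on the line\<close>

definition square_integrable :: "(real \<Rightarrow> 'u::real_normed_vector) \<Rightarrow> bool" where
  "square_integrable f \<longleftrightarrow>
     strongly_measurable lebesgue f \<and> integrable lebesgue (\<lambda>x. (norm (f x))\<^sup>2)"

lemma square_integrable_zero: "square_integrable (\<lambda>x. 0)"
  by (simp add: square_integrable_def strongly_measurable_simple)

lemma square_integrable_scaleR: "square_integrable f \<Longrightarrow> square_integrable (\<lambda>x. c *\<^sub>R f x)"
  by (auto simp: square_integrable_def power_mult_distrib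
      intro!: strongly_measurable_compose[of lebesgue f] continuous_intros)

lemma norm_add_square_le:
  fixes a b :: "'a::real_normed_vector"
  shows "(norm (a + b))\<^sup>2 \<le> 2 * (norm a)\<^sup>2 + 2 * (norm b)\<^sup>2"
proof -
  have "(norm (a + b))\<^sup>2 \<le> (norm a + norm b)\<^sup>2" by (intro power_mono norm_triangle_ineq) auto
  also have "\<dots> \<le> 2 * (norm a)\<^sup>2 + 2 * (norm b)\<^sup>2"
    using zero_le_power2[of "norm a - norm b"] by (simp add: power2_eq_square algebra_simps)
  finally show ?thesis .
qed

lemma square_integrable_add:
  assumes f: "square_integrable f" and g: "square_integrable g"
  shows "square_integrable (\<lambda>x. f x + g x)"
proof -
  have s: "strongly_measurable lebesgue (\<lambda>x. f x + g x)"
    by (rule strongly_measurable_compose2[where h = "(+)"])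
      (use f g in \<open>auto simp: square_integrable_def intro!: continuous_intros\<close>)
  have "integrable lebesgue (\<lambda>x. (norm (f x + g x))\<^sup>2)"
  proof (rule Bochner_Integration.integrable_bound)
    show "integrable lebesgue (\<lambda>x. 2 * (norm (f x))\<^sup>2 + 2 * (norm (g x))\<^sup>2)"
      using f g unfolding square_integrable_def by auto
    show "(\<lambda>x. (norm (f x + g x))\<^sup>2) \<in> borel_measurable lebesgue"
      by (intro completion.strongly_measurable_imp_borel strongly_measurable_compose[OF s] continuous_intros)
    show "AE x in lebesgue. norm ((norm (f x + g x))\<^sup>2) \<le> norm (2 * (norm (f x))\<^sup>2 + 2 * (norm (g x))\<^sup>2)"
      using norm_add_square_le[of "f _" "g _"] by simp
  qed
  with s show ?thesis by (simp add: square_integrable_def)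
qed

lemma square_integrable_minus:
  "square_integrable f \<Longrightarrow> square_integrable g \<Longrightarrow> square_integrable (\<lambda>x. f x - g x)"
  using square_integrable_add[of f "\<lambda>x. (-1) *\<^sub>R g x"] square_integrable_scaleR[of g "-1"] by simp

lemma square_integrable_inner:
  assumes f: "square_integrable f" and g: "square_integrable g"
  shows "integrable lebesgue (\<lambda>x. f x \<bullet> g x)"
proof (rule Bochner_Integration.integrable_bound)
  show "integrable lebesgue (\<lambda>x. (norm (f x))\<^sup>2 + (norm (g x))\<^sup>2)"
    using f g unfolding square_integrable_def by auto
  show "(\<lambda>x. f x \<bullet> g x) \<in> borel_measurable lebesgue"
    by (rule completion.strongly_measurable_imp_borel, rule strongly_measurable_compose2[where h = "(\<bullet>)"])
      (use f g in \<open>auto simp: square_integrable_def intro!: continuous_intros\<close>)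
  have "\<bar>f x \<bullet> g x\<bar> \<le> (norm (f x))\<^sup>2 + (norm (g x))\<^sup>2" for x
  proof -
    have "norm (f x) * norm (g x) \<le> (norm (f x))\<^sup>2 + (norm (g x))\<^sup>2"
      using sum_squares_bound[of "norm (f x)" "norm (g x)"] mult_nonneg_nonneg[OF norm_ge_zero[of "f x"] norm_ge_zero[of "g x"]]
      by linarith
    with Cauchy_Schwarz_ineq2[of "f x" "g x"] show ?thesis by linarith
  qed
  then show "AE x in lebesgue. norm (f x \<bullet> g x) \<le> norm ((norm (f x))\<^sup>2 + (norm (g x))\<^sup>2)" by simp
qed

\<comment> \<open>A partial quotient: the relation relates only square integrable functions, so
  every class has such representatives. The domain is the whole line so that kernels on (0,t) with
  varying t share one type.\<close>
quotient_type (overloaded) 'u l2 = "real \<Rightarrow> 'u::real_inner" / partial: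
  "\<lambda>f g. square_integrable f \<and> square_integrable g \<and> (AE x in lebesgue. f x = g x)"
proof (rule part_equivpI)
  show "\<exists>f :: real \<Rightarrow> 'u. square_integrable f \<and> square_integrable f \<and> (AE x in lebesgue. f x = f x)"
    using square_integrable_zero by blast
  show "symp (\<lambda>f g :: real \<Rightarrow> 'u. square_integrable f \<and> square_integrable g \<and> (AE x in lebesgue. f x = g x))"
    by (intro sympI) auto
  show "transp (\<lambda>f g :: real \<Rightarrow> 'u. square_integrable f \<and> square_integrable g \<and> (AE x in lebesgue. f x = g x))"
    by (intro transpI) (auto elim: eventually_elim2)
qed

lemma square_integrable_rep: "square_integrable (rep_l2 X)"
  and abs_rep_l2: "abs_l2 (rep_l2 X) = X"
  using Quotient3_rel_rep[OF Quotient3_l2, of X X] Quotient3_abs_rep[OF Quotient3_l2, of X] by auto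

lemma abs_l2_eq_iff:
  assumes "square_integrable f" "square_integrable g"
  shows "abs_l2 f = abs_l2 g \<longleftrightarrow> (AE x in lebesgue. f x = g x)"
  using Quotient3_rel[OF Quotient3_l2, of f g] assms by auto

lemma rep_abs_l2:
  assumes "square_integrable f"
  shows "AE x in lebesgue. rep_l2 (abs_l2 f) x = f x"
  using abs_l2_eq_iff[OF square_integrable_rep assms, of "abs_l2 f"] by (simp add: abs_rep_l2)

lemma l2_eqI: "(AE x in lebesgue. rep_l2 X x = rep_l2 Y x) \<Longrightarrow> X = Y"
  using abs_l2_eq_iff[OF square_integrable_rep square_integrable_rep, of X Y] by (simp add: abs_rep_l2)

instantiation l2 :: (real_inner) real_inner
begin

definition "zero_l2 = abs_l2 (\<lambda>x. 0)"
definition "plus_l2 X Y = abs_l2 (\<lambda>x. rep_l2 X x + rep_l2 Y x)"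
definition "minus_l2 X Y = abs_l2 (\<lambda>x. rep_l2 X x - rep_l2 Y x)"
definition "scaleR_l2 c X = abs_l2 (\<lambda>x. c *\<^sub>R rep_l2 X x)"
definition uminus_l2 :: "'a l2 \<Rightarrow> 'a l2" where "uminus_l2 X = (-1) *\<^sub>R X"
definition "inner_l2 X Y = (LINT x|lebesgue. rep_l2 X x \<bullet> rep_l2 Y x)"
definition norm_l2 :: "'a l2 \<Rightarrow> real" where "norm_l2 X = sqrt (X \<bullet> X)"
definition dist_l2 :: "'a l2 \<Rightarrow> 'a l2 \<Rightarrow> real" where "dist_l2 X Y = norm (X - Y)"
definition sgn_l2 :: "'a l2 \<Rightarrow> 'a l2" where "sgn_l2 X = inverse (norm X) *\<^sub>R X"
definition uniformity_l2 :: "('a l2 \<times> 'a l2) filter" where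
  "uniformity_l2 = (INF e\<in>{0<..}. principal {(x, y). dist x y < e})"
definition open_l2 :: "'a l2 set \<Rightarrow> bool" where
  "open_l2 U \<longleftrightarrow> (\<forall>x\<in>U. \<forall>\<^sub>F (x', y) in uniformity. x' = x \<longrightarrow> y \<in> U)"

lemma rep_zero_l2: "AE x in lebesgue. rep_l2 (0 :: 'a l2) x = 0"
  unfolding zero_l2_def by (rule rep_abs_l2[OF square_integrable_zero])
lemma rep_plus_l2: "AE x in lebesgue. rep_l2 (X + Y :: 'a l2) x = rep_l2 X x + rep_l2 Y x"
  unfolding plus_l2_def by (intro rep_abs_l2 square_integrable_add square_integrable_rep)
lemma rep_minus_l2: "AE x in lebesgue. rep_l2 (X - Y :: 'a l2) x = rep_l2 X x - rep_l2 Y x"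
  unfolding minus_l2_def by (intro rep_abs_l2 square_integrable_minus square_integrable_rep)
lemma rep_scaleR_l2: "AE x in lebesgue. rep_l2 (c *\<^sub>R X :: 'a l2) x = c *\<^sub>R rep_l2 X x"
  unfolding scaleR_l2_def by (intro rep_abs_l2 square_integrable_scaleR square_integrable_rep)
lemma rep_uminus_l2: "AE x in lebesgue. rep_l2 (- X :: 'a l2) x = - rep_l2 X x"
  using rep_scaleR_l2[of "-1" X] unfolding uminus_l2_def by simp

instance
proof
  fix X Y Z :: "'a l2" and a b :: real
  show "X + Y + Z = X + (Y + Z)"
    by (rule l2_eqI)
      (use rep_plus_l2[of "X + Y" Z] rep_plus_l2[of X Y] rep_plus_l2[of X "Y + Z"] rep_plus_l2[of Y Z]
       in \<open>eventually_elim, simp\<close>)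
  show "X + Y = Y + X"
    by (rule l2_eqI) (use rep_plus_l2[of X Y] rep_plus_l2[of Y X] in \<open>eventually_elim, simp\<close>)
  show "0 + X = X"
    by (rule l2_eqI) (use rep_plus_l2[of 0 X] rep_zero_l2 in \<open>eventually_elim, simp\<close>)
  show "- X + X = 0"
    by (rule l2_eqI)
      (use rep_plus_l2[of "- X" X] rep_uminus_l2[of X] rep_zero_l2 in \<open>eventually_elim, simp\<close>)
  show "X - Y = X + - Y"
    by (rule l2_eqI)
      (use rep_plus_l2[of X "- Y"] rep_uminus_l2[of Y] rep_minus_l2[of X Y] in \<open>eventually_elim, simp\<close>)
  show "a *\<^sub>R (X + Y) = a *\<^sub>R X + a *\<^sub>R Y"
    by (rule l2_eqI)
      (use rep_plus_l2[of X Y] rep_scaleR_l2[of a "X + Y"] rep_scaleR_l2[of a X] rep_scaleR_l2[of a Y]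
        rep_plus_l2[of "a *\<^sub>R X" "a *\<^sub>R Y"] in \<open>eventually_elim, simp add: scaleR_add_right\<close>)
  show "(a + b) *\<^sub>R X = a *\<^sub>R X + b *\<^sub>R X"
    by (rule l2_eqI)
      (use rep_scaleR_l2[of "a + b" X] rep_scaleR_l2[of a X] rep_scaleR_l2[of b X]
        rep_plus_l2[of "a *\<^sub>R X" "b *\<^sub>R X"] in \<open>eventually_elim, simp add: scaleR_add_left\<close>)
  show "a *\<^sub>R b *\<^sub>R X = (a * b) *\<^sub>R X"
    by (rule l2_eqI)
      (use rep_scaleR_l2[of "a * b" X] rep_scaleR_l2[of a "b *\<^sub>R X"] rep_scaleR_l2[of b X]
       in \<open>eventually_elim, simp\<close>)
  show "1 *\<^sub>R X = X"
    by (rule l2_eqI) (use rep_scaleR_l2[of 1 X] in \<open>eventually_elim, simp\<close>)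
  show "dist X Y = norm (X - Y)" by (rule dist_l2_def)
  show "sgn X = inverse (norm X) *\<^sub>R X" by (rule sgn_l2_def)
  show "norm X = sqrt (X \<bullet> X)" by (rule norm_l2_def)
  show "(uniformity :: ('a l2 \<times> 'a l2) filter) = (INF e\<in>{0<..}. principal {(x, y). dist x y < e})"
    by (rule uniformity_l2_def)
  show "open U \<longleftrightarrow> (\<forall>x\<in>U. \<forall>\<^sub>F (x', y) in uniformity. x' = x \<longrightarrow> y \<in> U)" for U :: "'a l2 set"
    by (rule open_l2_def)
  show "X \<bullet> Y = Y \<bullet> X" unfolding inner_l2_def by (simp add: inner_commute)
  have meas: "(\<lambda>x. rep_l2 V x \<bullet> rep_l2 W x) \<in> borel_measurable lebesgue" for V W :: "'a l2"
    using square_integrable_inner[OF square_integrable_rep square_integrable_rep] by blast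
  show "(X + Y) \<bullet> Z = X \<bullet> Z + Y \<bullet> Z"
  proof -
    have "(X + Y) \<bullet> Z = (LINT x|lebesgue. rep_l2 X x \<bullet> rep_l2 Z x + rep_l2 Y x \<bullet> rep_l2 Z x)"
      unfolding inner_l2_def
      by (rule integral_cong_AE)
        (use rep_plus_l2[of X Y] meas in \<open>auto intro!: borel_measurable_add simp: inner_add_left elim!: eventually_mono\<close>)
    also have "\<dots> = X \<bullet> Z + Y \<bullet> Z"
      unfolding inner_l2_def by (intro Bochner_Integration.integral_add square_integrable_inner square_integrable_rep)
    finally show ?thesis .
  qed
  show "a *\<^sub>R X \<bullet> Y = a * (X \<bullet> Y)"
  proof -
    have "a *\<^sub>R X \<bullet> Y = (LINT x|lebesgue. a * (rep_l2 X x \<bullet> rep_l2 Y x))"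
      unfolding inner_l2_def
      by (rule integral_cong_AE)
        (use rep_scaleR_l2[of a X] meas in \<open>auto intro!: borel_measurable_times elim!: eventually_mono\<close>)
    also have "\<dots> = a * (X \<bullet> Y)" unfolding inner_l2_def by simp
    finally show ?thesis .
  qed
  show "0 \<le> X \<bullet> X" unfolding inner_l2_def by simp
  show "X \<bullet> X = 0 \<longleftrightarrow> X = 0"
  proof
    assume "X \<bullet> X = 0"
    then have "AE x in lebesgue. rep_l2 X x \<bullet> rep_l2 X x = 0"
      unfolding inner_l2_def
      by (subst (asm) integral_nonneg_eq_0_iff_AE)
        (auto intro!: square_integrable_inner square_integrable_rep)
    then show "X = 0"
      using rep_zero_l2 by (intro l2_eqI) (auto elim: eventually_elim2)
  next
    assume "X = 0"
    then have "AE x in lebesgue. rep_l2 X x \<bullet> rep_l2 X x = 0" using rep_zero_l2 by (auto elim!: eventually_mono)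
    then show "X \<bullet> X = 0" unfolding inner_l2_def by (simp add: integral_eq_zero_AE)
  qed
qed

end

lemma norm_l2_square: "(norm X)\<^sup>2 = (LINT x|lebesgue. (norm (rep_l2 X x))\<^sup>2)"
  by (simp add: power2_norm_eq_inner inner_l2_def)

lemma norm_abs_l2:
  assumes "square_integrable f"
  shows "(norm (abs_l2 f))\<^sup>2 = (LINT x|lebesgue. (norm (f x))\<^sup>2)"
  unfolding norm_l2_square
  by (rule integral_cong_AE)
    (use rep_abs_l2[OF assms] assms square_integrable_rep[of "abs_l2 f"] in
      \<open>auto simp: square_integrable_def elim!: eventually_mono\<close>)

lemma minus_abs_l2:
  assumes "square_integrable f" "square_integrable g"
  shows "abs_l2 f - abs_l2 g = abs_l2 (\<lambda>x. f x - g x)"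
  unfolding minus_l2_def using rep_abs_l2[OF assms(1)] rep_abs_l2[OF assms(2)]
  by (subst abs_l2_eq_iff) (auto intro!: square_integrable_minus square_integrable_rep assms elim: eventually_elim2)

lemma nn_integral_rep_l2:
  "(\<integral>\<^sup>+x. ennreal ((norm (rep_l2 X x))\<^sup>2) \<partial>lebesgue) = ennreal ((norm X)\<^sup>2)"
  unfolding norm_l2_square using square_integrable_rep[of X]
  by (intro nn_integral_eq_integral) (auto simp: square_integrable_def)

text \<open>The weights 4^n keep the integral of the weighted squares finite, since 4^n times the
  square of 4^(-n) is 4^(-n). Almost everywhere the increments are then at most sqrt c times 2^(-n),
  hence summable; no passage to L1 occurs on this space of infinite measure.\<close>

lemma AE_convergent_of_fast_Cauchy:
  fixes X :: "nat \<Rightarrow> 'u::{real_inner, banach} l2"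
  assumes fast: "\<And>n. norm (X (Suc n) - X n) < (1/4) ^ n"
  shows "AE x in lebesgue. convergent (\<lambda>n. rep_l2 (X n) x)"
proof -
  define a where "a n x = (norm (rep_l2 (X (Suc n) - X n) x))\<^sup>2" for n x
  have a_meas: "a n \<in> borel_measurable lebesgue" for n
    using square_integrable_rep[of "X (Suc n) - X n"] unfolding a_def square_integrable_def by blast
  have "(\<integral>\<^sup>+x. (\<Sum>n. ennreal (4 ^ n * a n x)) \<partial>lebesgue) = (\<Sum>n. \<integral>\<^sup>+x. ennreal (4 ^ n * a n x) \<partial>lebesgue)"
    by (intro nn_integral_suminf) (use a_meas in measurable)
  also have "\<dots> = (\<Sum>n. ennreal (4 ^ n * (norm (X (Suc n) - X n))\<^sup>2))"
  proof (rule suminf_cong)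
    fix n
    have "(\<integral>\<^sup>+x. ennreal (4 ^ n * a n x) \<partial>lebesgue) = (\<integral>\<^sup>+x. ennreal (4 ^ n) * ennreal (a n x) \<partial>lebesgue)"
      by (simp add: ennreal_mult' a_def)
    also have "\<dots> = ennreal (4 ^ n) * ennreal ((norm (X (Suc n) - X n))\<^sup>2)"
      unfolding a_def nn_integral_rep_l2[symmetric]
      by (rule nn_integral_cmult) (use a_meas[of n, unfolded a_def] in \<open>measurable\<close>)
    finally show "(\<integral>\<^sup>+x. ennreal (4 ^ n * a n x) \<partial>lebesgue) = ennreal (4 ^ n * (norm (X (Suc n) - X n))\<^sup>2)"
      by (simp add: ennreal_mult')
  qed
  also have "\<dots> \<le> (\<Sum>n. ennreal ((1/4) ^ n))"
  proof (intro suminf_le summableI ennreal_leI)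
    fix n :: nat
    have "(norm (X (Suc n) - X n))\<^sup>2 \<le> ((1/4) ^ n)\<^sup>2" using fast[of n] by (intro power_mono) auto
    then have "4 ^ n * (norm (X (Suc n) - X n))\<^sup>2 \<le> 4 ^ n * ((1/4) ^ n)\<^sup>2" by simp
    also have "\<dots> = (1/4) ^ n" by (simp add: power2_eq_square field_simps)
    finally show "4 ^ n * (norm (X (Suc n) - X n))\<^sup>2 \<le> (1/4) ^ n" .
  qed
  also have "\<dots> = ennreal (\<Sum>n. (1/4) ^ n)" by (intro suminf_ennreal2) (auto intro: summable_geometric)
  finally have "(\<integral>\<^sup>+x. (\<Sum>n. ennreal (4 ^ n * a n x)) \<partial>lebesgue) \<noteq> \<infinity>"
    by (metis ennreal_neq_top infinity_ennreal_def neq_top_trans)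
  moreover have "(\<lambda>x. \<Sum>n. ennreal (4 ^ n * a n x)) \<in> borel_measurable lebesgue"
    using a_meas by measurable
  ultimately have "AE x in lebesgue. (\<Sum>n. ennreal (4 ^ n * a n x)) \<noteq> \<infinity>"
    by (intro nn_integral_PInf_AE)
  moreover have "AE x in lebesgue. \<forall>n. rep_l2 (X (Suc n) - X n) x = rep_l2 (X (Suc n)) x - rep_l2 (X n) x"
    by (simp add: AE_all_countable rep_minus_l2)
  ultimately show ?thesis
  proof eventually_elim
    case (elim x)
    then obtain c where c: "(\<Sum>n. ennreal (4 ^ n * a n x)) = ennreal c" "0 \<le> c"
      by (metis ennreal_cases infinity_ennreal_def)
    have bnd: "norm (rep_l2 (X (Suc n)) x - rep_l2 (X n) x) \<le> sqrt c * (1/2) ^ n" for n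
    proof -
      have "(\<Sum>k\<in>{n}. ennreal (4 ^ k * a k x)) \<le> (\<Sum>n. ennreal (4 ^ n * a n x))"
        by (rule sum_le_suminf) auto
      then have "4 ^ n * a n x \<le> c" using c by simp
      then have "a n x \<le> c * ((1/2) ^ n)\<^sup>2"
        by (simp add: field_simps power2_eq_square flip: power_mult_distrib)
      then have "sqrt (a n x) \<le> sqrt (c * ((1/2) ^ n)\<^sup>2)" by (rule real_sqrt_le_mono)
      then show ?thesis using elim by (simp add: a_def real_sqrt_mult)
    qed
    have "summable (\<lambda>n. sqrt c * (1/2::real) ^ n)" by (intro summable_mult summable_geometric) simp
    then have "summable (\<lambda>n. rep_l2 (X (Suc n)) x - rep_l2 (X n) x)"
      by (rule summable_comparison_test'[where N = 0]) (rule bnd)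
    then have "convergent (\<lambda>n. \<Sum>i<n. rep_l2 (X (Suc i)) x - rep_l2 (X i) x)"
      by (simp add: summable_iff_convergent)
    then have "convergent (\<lambda>n. rep_l2 (X n) x - rep_l2 (X 0) x)"
      unfolding sum_lessThan_telescope[of "\<lambda>i. rep_l2 (X i) x"] .
    from convergent_add[OF this convergent_const[of "rep_l2 (X 0) x"]] show ?case by simp
  qed
qed

text \<open>Riesz-Fischer: a fast subsequence converges almost everywhere to \<open>G\<close>, and
  Fatou turns the Cauchy estimate for \<open>Y n - Y m\<close> into one for \<open>G - Y m\<close>,
  which also shows that \<open>G\<close> is square integrable.\<close>

instance l2 :: ("{real_inner, banach}") banach
proof
  fix X :: "nat \<Rightarrow> 'a l2"
  assume X: "Cauchy X"
  have "\<exists>N. \<forall>m\<ge>N. \<forall>n\<ge>N. norm (X m - X n) < (1/4) ^ k" for k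
    using X unfolding Cauchy_iff by simp
  then obtain N where N: "\<And>k m n. m \<ge> N k \<Longrightarrow> n \<ge> N k \<Longrightarrow> norm (X m - X n) < (1/4) ^ k" by metis
  \<comment> \<open>Partial sums of \<open>N\<close> plus n dominate \<open>N n\<close> and are
    strictly increasing at once.\<close>
  define r where "r n = (\<Sum>k\<le>n. N k) + n" for n
  have r: "strict_mono r" unfolding strict_mono_Suc_iff by (simp add: r_def)
  have rN: "N n \<le> r n" for n unfolding r_def by (intro trans_le_add1 member_le_sum) auto
  define Y where "Y n = X (r n)" for n
  have "norm (Y (Suc n) - Y n) < (1/4) ^ n" for n
    unfolding Y_def using rN[of n] r by (intro N) (auto simp: strict_mono_Suc_iff intro: order_trans less_imp_le)
  then have conv: "AE x in lebesgue. convergent (\<lambda>n. rep_l2 (Y n) x)" by (rule AE_convergent_of_fast_Cauchy)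
  define G where "G x = lim (\<lambda>n. rep_l2 (Y n) x)" for x
  have G: "AE x in lebesgue. (\<lambda>n. rep_l2 (Y n) x) \<longlonglongrightarrow> G x"
    using conv by eventually_elim (simp add: G_def convergent_LIMSEQ_iff)
  have G_meas: "strongly_measurable lebesgue G"
    by (rule completion.strongly_measurable_AE_limit[OF _ G])
      (use square_integrable_rep in \<open>auto simp: square_integrable_def\<close>)
  have est: "square_integrable (\<lambda>x. G x - rep_l2 (Y m) x) \<and> norm (abs_l2 (\<lambda>x. G x - rep_l2 (Y m) x)) \<le> (1/4) ^ k"
    if "m \<ge> k" for m k
  proof -
    have s: "strongly_measurable lebesgue (\<lambda>x. G x - rep_l2 (Y m) x)"
      by (rule strongly_measurable_compose2[OF G_meas, where h = "(-)"])
        (use square_integrable_rep[of "Y m"] in \<open>auto simp: square_integrable_def intro!: continuous_intros\<close>)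
    have meas: "(\<lambda>x. (norm (G x - rep_l2 (Y m) x))\<^sup>2) \<in> borel_measurable lebesgue"
      by (intro completion.strongly_measurable_imp_borel strongly_measurable_compose[OF s] continuous_intros)
    have "AE x in lebesgue. \<forall>n. rep_l2 (Y n - Y m) x = rep_l2 (Y n) x - rep_l2 (Y m) x"
      by (simp add: AE_all_countable rep_minus_l2)
    with G have ae: "AE x in lebesgue. ennreal ((norm (G x - rep_l2 (Y m) x))\<^sup>2) =
        liminf (\<lambda>n. ennreal ((norm (rep_l2 (Y n - Y m) x))\<^sup>2))"
    proof eventually_elim
      case (elim x)
      have "(\<lambda>n. ennreal ((norm (rep_l2 (Y n - Y m) x))\<^sup>2)) \<longlonglongrightarrow> ennreal ((norm (G x - rep_l2 (Y m) x))\<^sup>2)"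
        using elim by (auto intro!: tendsto_intros tendsto_ennrealI)
      from lim_imp_Liminf[OF sequentially_bot this] show ?case by simp
    qed
    have "(\<integral>\<^sup>+x. ennreal ((norm (G x - rep_l2 (Y m) x))\<^sup>2) \<partial>lebesgue) =
        (\<integral>\<^sup>+x. liminf (\<lambda>n. ennreal ((norm (rep_l2 (Y n - Y m) x))\<^sup>2)) \<partial>lebesgue)"
      by (rule nn_integral_cong_AE[OF ae])
    also have "\<dots> \<le> liminf (\<lambda>n. \<integral>\<^sup>+x. ennreal ((norm (rep_l2 (Y n - Y m) x))\<^sup>2) \<partial>lebesgue)"
    proof (rule nn_integral_liminf)
      show "(\<lambda>x. ennreal ((norm (rep_l2 (Y n - Y m) x))\<^sup>2)) \<in> borel_measurable lebesgue" for n
        using square_integrable_rep[of "Y n - Y m"] unfolding square_integrable_def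
        by (intro measurable_compose[OF _ measurable_ennreal]) blast
    qed
    also have "\<dots> \<le> ennreal (((1/4) ^ k)\<^sup>2)"
    proof (rule Liminf_le)
      show "\<forall>\<^sub>F n in sequentially. (\<integral>\<^sup>+x. ennreal ((norm (rep_l2 (Y n - Y m) x))\<^sup>2) \<partial>lebesgue) \<le> ennreal (((1/4) ^ k)\<^sup>2)"
        using eventually_ge_at_top[of k]
      proof eventually_elim
        case (elim n)
        have "norm (Y n - Y m) < (1/4) ^ k"
          unfolding Y_def using rN[of k] strict_mono_less_eq[OF r] elim that by (intro N) (meson order_trans)+
        then show ?case unfolding nn_integral_rep_l2 by (intro ennreal_leI power_mono) auto
      qed
    qed simp
    finally have le: "(\<integral>\<^sup>+x. ennreal ((norm (G x - rep_l2 (Y m) x))\<^sup>2) \<partial>lebesgue) \<le> ennreal (((1/4) ^ k)\<^sup>2)" .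
    then have int: "integrable lebesgue (\<lambda>x. (norm (G x - rep_l2 (Y m) x))\<^sup>2)"
      by (intro integrableI_bounded meas) (auto intro: le_less_trans)
    with s have si: "square_integrable (\<lambda>x. G x - rep_l2 (Y m) x)" by (simp add: square_integrable_def)
    have "ennreal ((norm (abs_l2 (\<lambda>x. G x - rep_l2 (Y m) x)))\<^sup>2) \<le> ennreal (((1/4) ^ k)\<^sup>2)"
      using le nn_integral_eq_integral[OF int] by (simp add: norm_abs_l2[OF si])
    then have "(norm (abs_l2 (\<lambda>x. G x - rep_l2 (Y m) x)))\<^sup>2 \<le> ((1/4) ^ k)\<^sup>2" by simp
    then have "norm (abs_l2 (\<lambda>x. G x - rep_l2 (Y m) x)) \<le> (1/4) ^ k" by (rule power2_le_imp_le) simp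
    with si show ?thesis by blast
  qed
  have "square_integrable (\<lambda>x. (G x - rep_l2 (Y 0) x) + rep_l2 (Y 0) x)"
    using est[of 0 0] by (intro square_integrable_add square_integrable_rep) auto
  then have Gs: "square_integrable G" by simp
  have "Y \<longlonglongrightarrow> abs_l2 G"
  proof (rule Lim_null[THEN iffD2], rule Lim_null_comparison)
    show "\<forall>\<^sub>F n in sequentially. norm (Y n - abs_l2 G) \<le> (1/4) ^ n"
    proof (rule always_eventually, rule allI)
      fix n
      have "abs_l2 G - Y n = abs_l2 (\<lambda>x. G x - rep_l2 (Y n) x)"
        using minus_abs_l2[OF Gs square_integrable_rep[of "Y n"]] by (simp add: abs_rep_l2)
      then show "norm (Y n - abs_l2 G) \<le> (1/4) ^ n" using est[of n n] by (simp add: norm_minus_commute)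
    qed
    show "(\<lambda>n. (1/4::real) ^ n) \<longlonglongrightarrow> 0" by (rule LIMSEQ_power_zero) simp
  qed
  then have "X \<longlonglongrightarrow> abs_l2 G"
    using Cauchy_converges_subseq[OF X r] by (simp add: Y_def[abs_def] o_def)
  then show "convergent X" by (auto simp: convergent_def)
qed

section \<open>Strongly continuous semigroups\<close>

locale strongly_continuous_semigroup =
  fixes S :: "real \<Rightarrow> ('h::banach \<Rightarrow>\<^sub>L 'h)"
  assumes C0: "C0_semigroup S"
begin

lemma S_zero [simp]: "S 0 x = x"
  and S_add: "0 \<le> s \<Longrightarrow> 0 \<le> t \<Longrightarrow> S (s + t) x = S s (S t x)"
  using C0 unfolding C0_semigroup_def by auto

lemma S_tendsto_right: "((\<lambda>t. S t x) \<longlongrightarrow> x) (at 0 within {0..})"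
  using C0 unfolding C0_semigroup_def at_within_Ici_at_right by auto

lemma S_tendsto_sequence:
  assumes "t \<longlonglongrightarrow> 0" "\<And>n. 0 \<le> t n"
  shows "(\<lambda>n. S (t n) x) \<longlonglongrightarrow> x"
proof -
  have "continuous (at 0 within {0..}) (\<lambda>t. S t x)"
    using S_tendsto_right[of x] by (simp add: continuous_within)
  from continuous_within_tendsto_compose[OF this _ assms(1)] assms(2) show ?thesis by simp
qed

text \<open>Otherwise norms blow up along some times tending to 0; each orbit converges along these
  times, hence is bounded, which contradicts uniform boundedness.\<close>

lemma locally_bounded: "\<exists>d>0. \<exists>M\<ge>1. \<forall>t\<in>{0..d}. norm (S t) \<le> M"
proof (rule ccontr)
  assume neg: "\<not> ?thesis"
  have "\<exists>t. 0 \<le> t \<and> t \<le> 1 / real (Suc n) \<and> real (Suc n) < norm (S t)" for n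
  proof (rule ccontr)
    assume "\<not> ?thesis"
    then have "\<forall>t\<in>{0..1 / real (Suc n)}. norm (S t) \<le> real (Suc n)" by (auto simp: not_less)
    moreover have "1 / real (Suc n) > 0" "real (Suc n) \<ge> 1" by auto
    ultimately show False using neg by blast
  qed
  then obtain t where t: "\<And>n. 0 \<le> t n" "\<And>n. t n \<le> 1 / real (Suc n)" "\<And>n. real (Suc n) < norm (S (t n))"
    by metis
  have "t \<longlonglongrightarrow> 0"
    by (rule tendsto_sandwich[OF _ _ tendsto_const LIMSEQ_inverse_real_of_nat])
      (use t in \<open>auto simp: inverse_eq_divide\<close>)
  have "\<exists>K. \<forall>f\<in>range (\<lambda>n. blinfun_apply (S (t n))). norm (f x) \<le> K" for x
  proof -
    have "Bseq (\<lambda>n. S (t n) x)"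
      using S_tendsto_sequence[OF \<open>t \<longlonglongrightarrow> 0\<close> t(1)] by (intro convergent_imp_Bseq convergentI)
    then show ?thesis unfolding Bseq_def by auto
  qed
  then obtain K where K: "0 < K" "\<And>f x. f \<in> range (\<lambda>n. blinfun_apply (S (t n))) \<Longrightarrow> norm (f x) \<le> K * norm x"
    by (rule uniform_boundedness[rotated]) (auto intro: blinfun.bounded_linear_right)
  obtain n :: nat where "K < real n" using reals_Archimedean2 by blast
  moreover have "norm (S (t n)) \<le> K" using K by (intro norm_blinfun_bound) auto
  ultimately show False using t(3)[of n] by simp
qed

lemma exponential_bound: "\<exists>M\<ge>1. \<exists>w\<ge>0. \<forall>t\<ge>0. norm (S t) \<le> M * exp (w * t)"
proof -
  obtain d M where d: "d > 0" "M \<ge> 1" "\<And>t. t \<in> {0..d} \<Longrightarrow> norm (S t) \<le> M"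
    using locally_bounded by blast
  have step: "norm (S t) \<le> M ^ Suc n" if "0 \<le> t" "t \<le> real (Suc n) * d" for n t
    using that
  proof (induction n arbitrary: t)
    case 0
    then show ?case using d(3) by simp
  next
    case (Suc n)
    show ?case
    proof (cases "t \<le> d")
      case True
      then have "norm (S t) \<le> M" using d(3) Suc.prems by simp
      also have "\<dots> \<le> M ^ Suc (Suc n)" using d(2) self_le_power[of M "Suc (Suc n)"] by simp
      finally show ?thesis .
    next
      case False
      have "S t = S d o\<^sub>L S (t - d)"
        using C0 False d(1) unfolding C0_semigroup_def by (metis add.commute diff_add_cancel diff_ge_0_iff_ge less_eq_real_def linear)
      then have "norm (S t) \<le> norm (S d) * norm (S (t - d))" by (simp add: norm_blinfun_compose)
      also have "\<dots> \<le> M * M ^ Suc n"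
        using False Suc.prems d by (intro mult_mono Suc.IH) (auto simp: algebra_simps)
      finally show ?thesis by simp
    qed
  qed
  \<comment> \<open>Chosen so that exp (w d) = M; it is nonnegative because 1 <= M.\<close>
  define w where "w = ln M / d"
  have "norm (S t) \<le> M * exp (w * t)" if "0 \<le> t" for t
  proof -
    define n where "n = nat \<lfloor>t / d\<rfloor>"
    have n: "real n \<le> t / d" "t / d \<le> real (Suc n)"
      using that d(1) unfolding n_def by (simp, linarith)
    then have "t \<le> real (Suc n) * d" using d(1) by (simp add: field_simps)
    then have "norm (S t) \<le> M * M ^ n" using step[OF that] by simp
    also have "M ^ n = exp (real n * ln M)" using d(2) by (simp add: exp_of_nat_mult)
    also have "M * \<dots> \<le> M * exp (w * t)"
    proof -
      have "real n * ln M \<le> t / d * ln M" using n(1) d(2) by (intro mult_right_mono) auto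
      also have "\<dots> = w * t" by (simp add: w_def)
      finally show ?thesis using d(2) by simp
    qed
    finally show ?thesis .
  qed
  moreover have "w \<ge> 0" using d by (simp add: w_def)
  ultimately show ?thesis using d(2) by blast
qed

lemma S_bounded_on: "\<exists>M>0. \<forall>t\<in>{0..b}. \<forall>x. norm (S t x) \<le> M * norm x"
proof -
  obtain M w where M: "M \<ge> 1" "w \<ge> 0" "\<And>t. t \<ge> 0 \<Longrightarrow> norm (S t) \<le> M * exp (w * t)"
    using exponential_bound by blast
  have "norm (S t x) \<le> (M * exp (w * b)) * norm x" if "t \<in> {0..b}" for t x
  proof -
    have "norm (S t x) \<le> norm (S t) * norm x" by (rule norm_blinfun)
    also have "\<dots> \<le> (M * exp (w * b)) * norm x"
    proof (rule mult_right_mono)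
      have "norm (S t) \<le> M * exp (w * t)" using that M(3) by simp
      also have "\<dots> \<le> M * exp (w * b)"
        using that M by (intro mult_left_mono) (auto intro!: mult_left_mono)
      finally show "norm (S t) \<le> M * exp (w * b)" .
    qed simp
    finally show ?thesis .
  qed
  moreover have "M * exp (w * b) > 0" using M(1) by simp
  ultimately show ?thesis by blast
qed

text \<open>Factoring out the semigroup at the earlier of two times leaves right continuity at 0
  times a local bound. This treats left and right neighbourhoods alike.\<close>

lemma continuous_on_orbit: "continuous_on {0..} (\<lambda>t. S t x)"
  unfolding continuous_on_iff
proof (intro ballI allI impI)
  fix t e :: real assume t: "t \<in> {0..}" and "0 < e"
  obtain M where M: "M > 0" "\<And>s x. s \<in> {0..t + 1} \<Longrightarrow> norm (S s x) \<le> M * norm x"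
    using S_bounded_on by blast
  have "\<forall>\<^sub>F h in at 0 within {0..}. dist (S h x) x < e / M"
    using S_tendsto_right[of x] \<open>0 < e\<close> M(1) by (intro tendstoD) auto
  then obtain d where d: "0 < d" "\<And>h. 0 < h \<Longrightarrow> h < d \<Longrightarrow> dist (S h x) x < e / M"
    unfolding eventually_at by (auto simp: dist_real_def)
  have small: "norm (S q x - S p x) < e" if "0 \<le> p" "p \<le> q" "q \<le> t + 1" "q - p < d" for p q
  proof (cases "p = q")
    case False
    have "S q x - S p x = S p (S (q - p) x - x)"
      using S_add[of p "q - p" x] that by (simp add: blinfun.bilinear_simps)
    then have "norm (S q x - S p x) \<le> M * norm (S (q - p) x - x)" using M(2)[of p] that by simp
    also have "\<dots> < M * (e / M)"
      using d(2)[of "q - p"] that False M(1) by (intro mult_strict_left_mono) (auto simp: dist_norm)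
    finally show ?thesis using M(1) by simp
  qed (use \<open>0 < e\<close> in simp)
  show "\<exists>d>0. \<forall>x'\<in>{0..}. dist x' t < d \<longrightarrow> dist (S x' x) (S t x) < e"
  proof (intro exI[of _ "min d 1"] conjI ballI impI)
    fix s assume s: "s \<in> {0..}" "dist s t < min d 1"
    then show "dist (S s x) (S t x) < e"
      using small[of s t] small[of t s] t by (cases "s \<le> t") (auto simp: dist_norm dist_real_def norm_minus_commute)
  qed (use d(1) in simp)
qed

text \<open>The semigroup is continuous only strongly, so the increment of \<open>g\<close> is
  absorbed by the bound on {0..b} and the time is varied on the fixed vector
  \<open>g p\<close>.\<close>

lemma continuous_on_S:
  assumes a: "continuous_on X a" "\<And>p. p \<in> X \<Longrightarrow> a p \<in> {0..b}" and g: "continuous_on X g"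
  shows "continuous_on X (\<lambda>p. S (a p) (g p))"
proof -
  obtain M where M: "M > 0" "\<And>s x. s \<in> {0..b} \<Longrightarrow> norm (S s x) \<le> M * norm x"
    using S_bounded_on by blast
  show ?thesis
    unfolding continuous_on_def
  proof
    fix p assume p: "p \<in> X"
    have "((\<lambda>q. g q - g p) \<longlongrightarrow> 0) (at p within X)"
      using g p by (auto simp: continuous_on_def intro: LIM_zero)
    then have "((\<lambda>q. M * norm (g q - g p)) \<longlongrightarrow> 0) (at p within X)"
      by (intro tendsto_mult_right_zero tendsto_norm_zero)
    then have 1: "((\<lambda>q. S (a q) (g q - g p)) \<longlongrightarrow> 0) (at p within X)"
      by (rule Lim_null_comparison[rotated])
        (use a(2) M(2) in \<open>auto simp: eventually_at_filter intro!: always_eventually\<close>)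
    have "continuous_on X (\<lambda>q. S (a q) (g p))"
      by (rule continuous_on_compose2[OF continuous_on_orbit a(1)]) (use a(2) in force)
    then have 2: "((\<lambda>q. S (a q) (g p)) \<longlongrightarrow> S (a p) (g p)) (at p within X)"
      using p by (simp add: continuous_on_def)
    from tendsto_add[OF 1 2] show "((\<lambda>q. S (a q) (g q)) \<longlongrightarrow> S (a p) (g p)) (at p within X)"
      by (simp add: blinfun.bilinear_simps)
  qed
qed

end

section \<open>The Laplace transform of a semigroup\<close>

text \<open>The integral over {p..q} is at most c/a exp (- a p), so truncated integrals are Cauchy;
  the same bound survives q to infinity, and p = 0 in it is the norm estimate.\<close>

lemma has_integral_exponential_decay:
  fixes f :: "real \<Rightarrow> 'a::banach"
  assumes f: "continuous_on {0..} f" and le: "\<And>s. 0 \<le> s \<Longrightarrow> norm (f s) \<le> c * exp (- a * s)" and a: "0 < a"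
  shows "f integrable_on {0..}" and "norm (integral {0..} f) \<le> c / a"
    and "((\<lambda>b. integral {0..b} f) \<longlongrightarrow> integral {0..} f) at_top"
proof -
  have int: "f integrable_on {p..q}" if "0 \<le> p" for p q
    by (rule integrable_continuous_real) (rule continuous_on_subset[OF f], use that in auto)
  have c: "0 \<le> c" using le[of 0] order_trans[OF norm_ge_zero[of "f 0"]] by simp
  have tail: "norm (integral {p..q} f) \<le> c / a * exp (- a * p)" if "0 \<le> p" "p \<le> q" for p q
  proof -
    have exp_int: "((\<lambda>s. c * exp (- a * s)) has_integral (- c / a * exp (- a * q)) - (- c / a * exp (- a * p))) {p..q}"
      using that(2) a
      by (intro fundamental_theorem_of_calculus)
        (auto intro!: derivative_eq_intros simp flip: has_real_derivative_iff_has_vector_derivative)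
    have "norm (integral {p..q} f) \<le> integral {p..q} (\<lambda>s. c * exp (- a * s))"
      using that exp_int by (intro Henstock_Kurzweil_Integration.integral_norm_bound_integral int le) (auto simp: integrable_on_def)
    also have "\<dots> = c / a * exp (- a * p) - c / a * exp (- a * q)"
      using integral_unique[OF exp_int] by simp
    also have "\<dots> \<le> c / a * exp (- a * p)" using c a by simp
    finally show ?thesis .
  qed
  have diff: "norm (integral {0..q} f - integral {0..p} f) \<le> c / a * exp (- a * p)" if "0 \<le> p" "p \<le> q" for p q
    using tail[OF that] by (simp flip: Henstock_Kurzweil_Integration.integral_combine[OF that int[of 0 q]])
  have "((\<lambda>p. c / a * exp (- a * p)) \<longlongrightarrow> 0) at_top"
    using a by real_asymp
  then have small: "\<forall>\<^sub>F p in at_top. c / a * exp (- a * p) < e" if "0 < e" for e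
    using that by (rule order_tendstoD)
  have "Cauchy (\<lambda>n. integral {0..real n} f)"
  proof (rule metric_CauchyI)
    fix e :: real assume e: "0 < e"
    obtain p where p: "\<And>q. p \<le> q \<Longrightarrow> c / a * exp (- a * q) < e / 2"
      using small[of "e / 2"] e unfolding eventually_at_top_linorder by auto
    obtain N :: nat where N: "max p 0 \<le> real N" using real_arch_simple by blast
    have b: "dist (integral {0..real n} f) (integral {0..real N} f) < e / 2" if "n \<ge> N" for n
      using order.strict_trans1[OF diff[of "real N" "real n"] p[of "real N"]] N that by (simp add: dist_norm)
    show "\<exists>M. \<forall>m\<ge>M. \<forall>n\<ge>M. dist (integral {0..real m} f) (integral {0..real n} f) < e"
      using b dist_triangle_half_l[of _ "integral {0..real N} f" e] by (metis dist_commute)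
  qed
  then obtain y where y: "(\<lambda>n. integral {0..real n} f) \<longlonglongrightarrow> y" by (auto simp: Cauchy_convergent_iff convergent_def)
  have dy: "norm (integral {0..p} f - y) \<le> c / a * exp (- a * p)" if "0 \<le> p" for p
  proof (rule tendsto_upperbound)
    show "(\<lambda>n. norm (integral {0..p} f - integral {0..real n} f)) \<longlonglongrightarrow> norm (integral {0..p} f - y)"
      by (intro tendsto_intros y)
    have "\<forall>\<^sub>F n in sequentially. p \<le> real n" by real_asymp
    then show "\<forall>\<^sub>F n in sequentially. norm (integral {0..p} f - integral {0..real n} f) \<le> c / a * exp (- a * p)"
      by eventually_elim (use diff[OF that] in \<open>metis norm_minus_commute\<close>)
  qed simp
  have h: "(f has_integral y) {0..}"
  proof (rule has_integral'[THEN iffD2], intro allI impI)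
    fix e :: real assume "0 < e"
    then obtain p where p: "\<And>q. p \<le> q \<Longrightarrow> c / a * exp (- a * q) < e"
      using small[of e] unfolding eventually_at_top_linorder by auto
    show "\<exists>B>0. \<forall>u v. ball 0 B \<subseteq> cbox u v \<longrightarrow>
        (\<exists>z. ((\<lambda>x. if x \<in> {0..} then f x else 0) has_integral z) (cbox u v) \<and> norm (z - y) < e)"
    proof (intro exI[of _ "max p 0 + 1"] conjI allI impI)
      fix u v :: real assume "ball 0 (max p 0 + 1) \<subseteq> cbox u v"
      moreover have "max p 0 \<in> ball 0 (max p 0 + 1)" "0 \<in> ball 0 (max p 0 + 1)" by auto
      ultimately have "max p 0 \<in> cbox u v" "0 \<in> cbox u v" by blast+
      then have uv: "u \<le> 0" "p \<le> v" "0 \<le> v" by auto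
      then have eq: "{0..} \<inter> cbox u v = {0..v}" by auto
      have "((\<lambda>x. if x \<in> {0..} then f x else 0) has_integral integral {0..v} f) (cbox u v)"
        unfolding has_integral_restrict_Int eq by (intro integrable_integral int) simp
      moreover have "norm (integral {0..v} f - y) < e" using dy[OF uv(3)] p[OF uv(2)] by simp
      ultimately show "\<exists>z. ((\<lambda>x. if x \<in> {0..} then f x else 0) has_integral z) (cbox u v) \<and> norm (z - y) < e"
        by blast
    qed simp
  qed
  then show "f integrable_on {0..}" by blast
  have yI: "integral {0..} f = y" using h by (rule integral_unique)
  show "norm (integral {0..} f) \<le> c / a" using dy[of 0] by (simp add: yI)
  show "((\<lambda>b. integral {0..b} f) \<longlongrightarrow> integral {0..} f) at_top"
    unfolding yI
    by (rule Lim_null[THEN iffD2], rule Lim_null_comparison[OF eventually_at_top_linorderI[of 0]])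
      (use dy \<open>((\<lambda>p. c / a * exp (- a * p)) \<longlongrightarrow> 0) at_top\<close> in auto)
qed

locale bounded_semigroup = strongly_continuous_semigroup S
  for S :: "real \<Rightarrow> ('h::banach \<Rightarrow>\<^sub>L 'h)" +
  fixes M w :: real
  assumes M: "1 \<le> M" and w: "0 \<le> w" and S_bound: "\<And>t. 0 \<le> t \<Longrightarrow> norm (S t) \<le> M * exp (w * t)"
begin

text \<open>The inverse of k - A written as a Laplace transform, before any generator is mentioned;
  that it inverts k - A is \<open>A_resolvent\<close> together with
  \<open>resolvent_A\<close>.\<close>

definition resolvent :: "real \<Rightarrow> 'h \<Rightarrow> 'h" where
  "resolvent k x = integral {0..} (\<lambda>s. exp (- (k * s)) *\<^sub>R S s x)"

lemma
  assumes k: "w < k"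
  shows laplace_integrable: "(\<lambda>s. exp (- (k * s)) *\<^sub>R S s x) integrable_on {0..}"
    and norm_resolvent_le: "norm (resolvent k x) \<le> M / (k - w) * norm x"
    and laplace_limit: "((\<lambda>b. integral {0..b} (\<lambda>s. exp (- (k * s)) *\<^sub>R S s x)) \<longlongrightarrow> resolvent k x) at_top"
proof -
  have cont: "continuous_on {0..} (\<lambda>s. exp (- (k * s)) *\<^sub>R S s x)"
    by (intro continuous_intros continuous_on_orbit)
  have le: "norm (exp (- (k * s)) *\<^sub>R S s x) \<le> M * norm x * exp (- (k - w) * s)" if "0 \<le> s" for s
  proof -
    have "norm (S s x) \<le> (M * exp (w * s)) * norm x"
      using norm_blinfun[of "S s" x] S_bound[OF that] by (meson mult_right_mono norm_ge_zero order_trans)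
    then have "exp (- (k * s)) * norm (S s x) \<le> exp (- (k * s)) * ((M * exp (w * s)) * norm x)"
      by (intro mult_left_mono) auto
    also have "\<dots> = M * norm x * (exp (- (k * s)) * exp (w * s))" by simp
    also have "exp (- (k * s)) * exp (w * s) = exp (- (k - w) * s)"
      by (simp add: algebra_simps flip: exp_add)
    finally show ?thesis by simp
  qed
  note * = has_integral_exponential_decay[OF cont le]
  show "(\<lambda>s. exp (- (k * s)) *\<^sub>R S s x) integrable_on {0..}" by (rule *(1)) (use k in auto)
  show "norm (resolvent k x) \<le> M / (k - w) * norm x" unfolding resolvent_def using *(2) k by simp
  show "((\<lambda>b. integral {0..b} (\<lambda>s. exp (- (k * s)) *\<^sub>R S s x)) \<longlongrightarrow> resolvent k x) at_top"
    unfolding resolvent_def by (rule *(3)) (use k in auto)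
qed

lemma bounded_linear_resolvent:
  assumes k: "w < k"
  shows "bounded_linear (resolvent k)"
proof (rule bounded_linear_intro)
  show "resolvent k (x + y) = resolvent k x + resolvent k y" for x y
    unfolding resolvent_def
    using Henstock_Kurzweil_Integration.integral_add[OF laplace_integrable[OF k, of x] laplace_integrable[OF k, of y]]
    by (simp add: blinfun.bilinear_simps scaleR_add_right)
  show "resolvent k (r *\<^sub>R x) = r *\<^sub>R resolvent k x" for r x
    unfolding resolvent_def by (simp add: blinfun.bilinear_simps mult.commute flip: integral_cmul)
  show "norm (resolvent k x) \<le> norm x * (M / (k - w))" for x
    using norm_resolvent_le[OF k, of x] by (simp add: mult.commute)
qed

lemma resolvent_commute:
  assumes k: "w < k" and L: "bounded_linear L" "\<And>s x. 0 \<le> s \<Longrightarrow> L (S s x) = S s (L x)"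
  shows "L (resolvent k x) = resolvent k (L x)"
proof -
  interpret bounded_linear L by fact
  have "L (resolvent k x) = integral {0..} (L \<circ> (\<lambda>s. exp (- (k * s)) *\<^sub>R S s x))"
    unfolding resolvent_def by (rule integral_linear[symmetric, OF laplace_integrable[OF k] L(1)])
  also have "\<dots> = resolvent k (L x)"
    unfolding resolvent_def by (rule integral_cong) (simp add: scaleR L(2))
  finally show ?thesis .
qed

lemma S_resolvent: "w < k \<Longrightarrow> 0 \<le> t \<Longrightarrow> S t (resolvent k x) = resolvent k (S t x)"
  by (rule resolvent_commute) (auto simp: blinfun.bounded_linear_right add.commute simp flip: S_add)

lemma resolvent_resolvent: "w < k \<Longrightarrow> w < l \<Longrightarrow> resolvent l (resolvent k x) = resolvent k (resolvent l x)"
  by (rule resolvent_commute) (auto simp: bounded_linear_resolvent S_resolvent)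

text \<open>A shift of the integration variable by h costs the factor exp (k h) and the piece over
  {0..h}. Difference quotients and norm estimates along the semigroup are read off from
  this.\<close>

lemma resolvent_S:
  assumes k: "w < k" and h: "0 \<le> h"
  shows "resolvent k (S h x) = exp (k * h) *\<^sub>R (resolvent k x - integral {0..h} (\<lambda>s. exp (- (k * s)) *\<^sub>R S s x))"
proof -
  let ?f = "\<lambda>s. exp (- (k * s)) *\<^sub>R S s x"
  have int: "?f integrable_on {p..q}" if "0 \<le> p" for p q
    by (rule integrable_continuous_real, rule continuous_on_subset[of "{0..}"])
      (use that in \<open>auto intro!: continuous_intros continuous_on_orbit\<close>)
  have eq: "integral {0..b} (\<lambda>s. exp (- (k * s)) *\<^sub>R S s (S h x)) =
      exp (k * h) *\<^sub>R (integral {0..b + h} ?f - integral {0..h} ?f)" if "0 \<le> b" for b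
  proof -
    have "integral {0..b} (\<lambda>s. exp (- (k * s)) *\<^sub>R S s (S h x)) = integral {0..b} (\<lambda>s. exp (k * h) *\<^sub>R ?f (s + h))"
      by (rule integral_cong) (use h in \<open>auto simp: algebra_simps simp flip: S_add exp_add\<close>)
    also have "\<dots> = exp (k * h) *\<^sub>R integral {h - h..b + h - h} (\<lambda>s. ?f (s + h))"
      by (subst integral_cmul) simp
    also have "integral {h - h..b + h - h} (\<lambda>s. ?f (s + h)) = integral {h..b + h} ?f"
      by (rule integral_shift_real_ivl)
    also have "\<dots> = integral {0..b + h} ?f - integral {0..h} ?f"
      using Henstock_Kurzweil_Integration.integral_combine[of 0 h "b + h" ?f] h that int[of 0 "b + h"]
      by (simp add: algebra_simps)
    finally show ?thesis .
  qed
  have "((\<lambda>b. integral {0..b + h} ?f) \<longlongrightarrow> resolvent k x) at_top"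
    by (rule filterlim_compose[OF laplace_limit[OF k]]) real_asymp
  then have "((\<lambda>b. exp (k * h) *\<^sub>R (integral {0..b + h} ?f - integral {0..h} ?f)) \<longlongrightarrow>
      exp (k * h) *\<^sub>R (resolvent k x - integral {0..h} ?f)) at_top"
    by (intro tendsto_intros)
  moreover have "\<forall>\<^sub>F b in at_top. integral {0..b} (\<lambda>s. exp (- (k * s)) *\<^sub>R S s (S h x)) =
      exp (k * h) *\<^sub>R (integral {0..b + h} ?f - integral {0..h} ?f)"
    using eventually_ge_at_top[of 0] by eventually_elim (rule eq)
  ultimately have "((\<lambda>b. integral {0..b} (\<lambda>s. exp (- (k * s)) *\<^sub>R S s (S h x))) \<longlongrightarrow>
      exp (k * h) *\<^sub>R (resolvent k x - integral {0..h} ?f)) at_top"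
    by (simp add: tendsto_cong)
  with laplace_limit[OF k, of "S h x"] show ?thesis by (rule tendsto_unique[OF trivial_limit_at_top_linorder])
qed

text \<open>From \<open>resolvent_S\<close>, with h <= 1 replacing exponentials by constants. The
  factor of \<open>norm x\<close> tends to 0 with h: this is operator norm convergence, which
  survives taking adjoints.\<close>

lemma norm_resolvent_S_diff:
  assumes k: "w < k" "0 \<le> k" and h: "0 \<le> h" "h \<le> 1"
  shows "norm (resolvent k (S h x - x)) \<le>
    ((exp (k * h) - 1) * (M / (k - w)) + exp k * (M * exp w) * h) * norm x"
proof -
  interpret R: bounded_linear "resolvent k" by (rule bounded_linear_resolvent[OF k(1)])
  let ?f = "\<lambda>s. exp (- (k * s)) *\<^sub>R S s x"
  have e: "0 \<le> exp (k * h) - 1" "exp (k * h) \<le> exp k" using k h by (simp_all add: mult_left_le)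
  have "norm (integral {0..h} ?f) \<le> (M * exp w * norm x) * (h - 0)"
  proof (rule integral_bound)
    show "continuous_on {0..h} ?f"
      by (rule continuous_on_subset[of "{0..}"]) (auto intro!: continuous_intros continuous_on_orbit)
    fix t assume t: "t \<in> {0..h}"
    have "norm (?f t) \<le> 1 * norm (S t x)" unfolding norm_scaleR using t k by (intro mult_right_mono) auto
    also have "\<dots> \<le> norm (S t) * norm x" by (simp add: norm_blinfun)
    also have "\<dots> \<le> (M * exp w) * norm x"
    proof (rule mult_right_mono)
      have "norm (S t) \<le> M * exp (w * t)" using t S_bound by simp
      also have "\<dots> \<le> M * exp w" using t h w M by (intro mult_left_mono) (auto simp: mult_left_le)
      finally show "norm (S t) \<le> M * exp w" .
    qed simp
    finally show "norm (?f t) \<le> M * exp w * norm x" .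
  qed (rule h)
  then have i: "exp (k * h) * norm (integral {0..h} ?f) \<le> exp k * (M * exp w * norm x * h)"
    using e by (intro mult_mono) auto
  have r: "(exp (k * h) - 1) * norm (resolvent k x) \<le> (exp (k * h) - 1) * (M / (k - w) * norm x)"
    by (intro mult_left_mono norm_resolvent_le k e)
  have "resolvent k (S h x - x) = (exp (k * h) - 1) *\<^sub>R resolvent k x - exp (k * h) *\<^sub>R integral {0..h} ?f"
    by (simp add: R.diff resolvent_S[OF k(1) h(1)] algebra_simps)
  then have "norm (resolvent k (S h x - x)) \<le>
      (exp (k * h) - 1) * norm (resolvent k x) + exp (k * h) * norm (integral {0..h} ?f)"
    using norm_triangle_ineq4[of "(exp (k * h) - 1) *\<^sub>R resolvent k x" "exp (k * h) *\<^sub>R integral {0..h} ?f"] e(1)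
    unfolding norm_scaleR by (simp only: abs_of_nonneg abs_exp_cancel)
  also have "\<dots> \<le> (exp (k * h) - 1) * (M / (k - w) * norm x) + exp k * (M * exp w * norm x * h)"
    by (rule add_mono[OF r i])
  finally show ?thesis by (simp only: ring_distribs mult_ac)
qed

text \<open>Divide \<open>resolvent_S\<close> by h: (exp (k h) - 1)/h tends to k, and the mean of
  the integrand over {0..h} tends to its value x at 0.\<close>

lemma resolvent_right_derivative:
  assumes k: "w < k"
  shows "((\<lambda>h. (1 / h) *\<^sub>R (resolvent k (S h x) - resolvent k x)) \<longlongrightarrow> k *\<^sub>R resolvent k x - x) (at_right 0)"
proof -
  let ?f = "\<lambda>s. exp (- (k * s)) *\<^sub>R S s x"
  have "continuous_on {0..1} ?f"
    by (rule continuous_on_subset[of "{0..}"]) (auto intro!: continuous_intros continuous_on_orbit)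
  then have "((\<lambda>u. integral {0..u} ?f) has_vector_derivative ?f 0) (at 0 within {0..1})"
    by (rule integral_has_vector_derivative) simp
  then have "((\<lambda>h. (1 / norm h) *\<^sub>R (integral {0..h} ?f - h *\<^sub>R x)) \<longlongrightarrow> 0) (at_right 0)"
    by (simp add: has_vector_derivative_def has_derivative_within at_within_Icc_at_right)
  moreover have "\<forall>\<^sub>F h in at_right 0. (1 / norm h) *\<^sub>R (integral {0..h} ?f - h *\<^sub>R x) =
      (1 / h) *\<^sub>R integral {0..h} ?f - x"
    using eventually_at_right_less[of 0] by eventually_elim (simp add: scaleR_diff_right)
  ultimately have I: "((\<lambda>h. (1 / h) *\<^sub>R integral {0..h} ?f) \<longlongrightarrow> x) (at_right 0)"
    by (subst Lim_null) (simp add: tendsto_cong)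
  have E: "((\<lambda>h::real. (exp (k * h) - 1) / h) \<longlongrightarrow> k) (at_right 0)" by real_asymp
  have X: "((\<lambda>h::real. exp (k * h)) \<longlongrightarrow> 1) (at_right 0)" by real_asymp
  have "((\<lambda>h. ((exp (k * h) - 1) / h) *\<^sub>R resolvent k x - exp (k * h) *\<^sub>R ((1 / h) *\<^sub>R integral {0..h} ?f))
      \<longlongrightarrow> k *\<^sub>R resolvent k x - 1 *\<^sub>R x) (at_right 0)"
    by (intro tendsto_intros I E X)
  moreover have "\<forall>\<^sub>F h in at_right 0. (1 / h) *\<^sub>R (resolvent k (S h x) - resolvent k x) =
      ((exp (k * h) - 1) / h) *\<^sub>R resolvent k x - exp (k * h) *\<^sub>R ((1 / h) *\<^sub>R integral {0..h} ?f)"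
    using eventually_at_right_less[of 0]
    by eventually_elim (simp add: resolvent_S[OF k] algebra_simps diff_divide_distrib)
  ultimately show ?thesis by (simp add: tendsto_cong)
qed

end

section \<open>Generators and their adjoints\<close>

locale hilbert_generator = bounded_semigroup S M w
  for S :: "real \<Rightarrow> ('h::{real_inner, banach} \<Rightarrow>\<^sub>L 'h)" and M w +
  fixes DA :: "'h set" and A :: "'h \<Rightarrow> 'h" and k0 :: real
  assumes gen: "generates_semigroup DA A S" and k0: "w < k0"
begin

text \<open>The semigroup commutes with the resolvent, so the generator quotient of
  \<open>resolvent k x\<close> is the one computed in
  \<open>resolvent_right_derivative\<close>.\<close>

lemma
  assumes k: "w < k"
  shows resolvent_in_domain: "resolvent k x \<in> DA"
    and A_resolvent: "A (resolvent k x) = k *\<^sub>R resolvent k x - x"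
proof -
  have lim: "((\<lambda>h. (1 / h) *\<^sub>R (S h (resolvent k x) - resolvent k x)) \<longlongrightarrow> k *\<^sub>R resolvent k x - x) (at_right 0)"
  proof -
    have "\<forall>\<^sub>F h in at_right 0. (1 / h) *\<^sub>R (S h (resolvent k x) - resolvent k x) =
        (1 / h) *\<^sub>R (resolvent k (S h x) - resolvent k x)"
      using eventually_at_right_less[of 0] by eventually_elim (simp add: S_resolvent[OF k])
    then have "\<forall>\<^sub>F h in at_right 0. (1 / h) *\<^sub>R (resolvent k (S h x) - resolvent k x) =
        (1 / h) *\<^sub>R (S h (resolvent k x) - resolvent k x)" by eventually_elim (rule sym)
    with resolvent_right_derivative[OF k, of x] show ?thesis by (rule Lim_transform_eventually)
  qed
  then show dom: "resolvent k x \<in> DA" using gen unfolding generates_semigroup_def by blast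
  then have "((\<lambda>h. (1 / h) *\<^sub>R (S h (resolvent k x) - resolvent k x)) \<longlongrightarrow> A (resolvent k x)) (at_right 0)"
    using gen unfolding generates_semigroup_def by blast
  from tendsto_unique[OF _ this lim] show "A (resolvent k x) = k *\<^sub>R resolvent k x - x" by simp
qed

lemma resolvent_A:
  assumes k: "w < k" and x: "x \<in> DA"
  shows "resolvent k (A x) = k *\<^sub>R resolvent k x - x"
proof -
  interpret R: bounded_linear "resolvent k" by (rule bounded_linear_resolvent[OF k])
  have "((\<lambda>t. (1 / t) *\<^sub>R (S t x - x)) \<longlongrightarrow> A x) (at_right 0)"
    using gen x unfolding generates_semigroup_def by blast
  from R.tendsto[OF this] have "((\<lambda>t. (1 / t) *\<^sub>R (resolvent k (S t x) - resolvent k x)) \<longlongrightarrow> resolvent k (A x)) (at_right 0)"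
    by (simp add: R.scaleR R.diff)
  from tendsto_unique[OF _ this resolvent_right_derivative[OF k]] show ?thesis by simp
qed

text \<open>\<open>A\<close> is a bare function whose linearity is not part of the data; this value
  is what turns \<open>A_resolvent\<close> into injectivity of the resolvent.\<close>

lemma A_zero: "A 0 = 0"
proof -
  have lim: "((\<lambda>t. (1 / t) *\<^sub>R (S t 0 - 0)) \<longlongrightarrow> (0 :: 'h)) (at_right 0)"
    by (simp add: blinfun.bilinear_simps)
  then have "0 \<in> DA" using gen unfolding generates_semigroup_def by blast
  then have "((\<lambda>t. (1 / t) *\<^sub>R (S t 0 - 0)) \<longlongrightarrow> A 0) (at_right 0)"
    using gen unfolding generates_semigroup_def by blast
  from tendsto_unique[OF _ this lim] show ?thesis by simp
qed

lemma resolvent_eq_zero: "w < k \<Longrightarrow> resolvent k x = 0 \<Longrightarrow> x = 0"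
  using A_resolvent[of k x] by (simp add: A_zero)

abbreviation R where "R \<equiv> resolvent k0"
abbreviation R' where "R' \<equiv> adjoint R"

lemmas bl_R = bounded_linear_resolvent[OF k0]
lemmas inner_R = inner_adjoint[OF bl_R]
lemmas bl_R' = bounded_linear_adjoint[OF bl_R]

section \<open>Yosida approximation: strong convergence of \<open>J k\<close> and of its
  adjoint\<close>

abbreviation J where "J k x \<equiv> k *\<^sub>R resolvent k x"

lemma bounded_linear_J: "w < k \<Longrightarrow> bounded_linear (J k)"
  by (rule bounded_linear_compose[OF bounded_linear_scaleR_right bounded_linear_resolvent])

text \<open>k/(k - w) is at most 2 once k exceeds 2 w, which makes the bound independent of
  k.\<close>

lemma norm_J_le:
  assumes k: "2 * w < k" "0 < k"
  shows "norm (J k x) \<le> (2 * M) * norm x"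
proof -
  have wk: "w < k" using k w by linarith
  have "norm (J k x) \<le> k * (M / (k - w) * norm x)"
    using mult_left_mono[OF norm_resolvent_le[OF wk, of x], of k] k by simp
  also have "\<dots> = (k / (k - w)) * (M * norm x)" by simp
  also have "\<dots> \<le> 2 * (M * norm x)" using k w wk M by (intro mult_right_mono) (auto simp: field_simps)
  finally show ?thesis by simp
qed

text \<open>J_k - id = A R_k, and R A = k0 R - id is bounded on the domain, so the unbounded
  operator disappears and a factor of order 1/k remains.\<close>

lemma R_J_diff:
  assumes k: "w < k"
  shows "R (J k x - x) = k0 *\<^sub>R R (resolvent k x) - resolvent k x"
  using resolvent_A[OF k0 resolvent_in_domain[OF k, of x]] by (simp add: A_resolvent[OF k])

text \<open>The first factor bounds k0 R - id, the second the resolvent at k.\<close>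

abbreviation rate where "rate k \<equiv> (\<bar>k0\<bar> * (M / (k0 - w)) + 1) * (M / (k - w))"

lemma norm_R_J_diff:
  assumes k: "w < k"
  shows "norm (R (J k x - x)) \<le> rate k * norm x"
proof -
  have "norm (R (J k x - x)) \<le> \<bar>k0\<bar> * norm (R (resolvent k x)) + norm (resolvent k x)"
    unfolding R_J_diff[OF k] using norm_triangle_ineq4[of "k0 *\<^sub>R R (resolvent k x)"] by simp
  also have "\<dots> \<le> \<bar>k0\<bar> * (M / (k0 - w) * norm (resolvent k x)) + norm (resolvent k x)"
    by (intro add_right_mono mult_left_mono norm_resolvent_le k0) simp
  also have "\<dots> = (\<bar>k0\<bar> * (M / (k0 - w)) + 1) * norm (resolvent k x)" by (simp add: algebra_simps)
  also have "\<dots> \<le> (\<bar>k0\<bar> * (M / (k0 - w)) + 1) * (M / (k - w) * norm x)"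
    using M k0 by (intro mult_left_mono norm_resolvent_le k) simp
  finally show ?thesis by simp
qed

lemma R_J_diff_null: "(\<lambda>k. rate (real k)) \<longlonglongrightarrow> 0"
  by real_asymp

lemma eventually_large: "\<forall>\<^sub>F k in sequentially. 2 * w < real k \<and> 0 < real k \<and> w < real k"
proof -
  have "\<forall>\<^sub>F k in sequentially. 2 * w < real k" "\<forall>\<^sub>F k in sequentially. 0 < real k"
    by real_asymp+
  then show ?thesis by eventually_elim (use w in auto)
qed

text \<open>A vector orthogonal to the range of \<open>R'\<close> lies in the kernel of
  \<open>R\<close>, which is trivial.\<close>

lemma range_R'_dense: "closure (range R') = UNIV"
proof (rule dense_subspace_criterion)
  show "subspace (range R')" by (rule linear_subspace_image) (simp_all add: bl_R' bounded_linear.linear)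
  fix y assume y: "\<And>v. v \<in> range R' \<Longrightarrow> v \<bullet> y = 0"
  have "R y \<bullet> v = 0" for v using y[of "R' v"] by (metis inner_R inner_commute rangeI)
  then have "R y = 0" by (metis inner_eq_zero_iff)
  then show "y = 0" by (rule resolvent_eq_zero[OF k0])
qed

lemma eventually_linear_J_diff: "\<forall>\<^sub>F k in sequentially. linear (\<lambda>x. J (real k) x - x)"
  using eventually_large
  by eventually_elim
    (intro bounded_linear.linear bounded_linear_sub bounded_linear_ident bounded_linear_J, simp)

lemma eventually_linear_adjoint_J_diff:
  "\<forall>\<^sub>F k in sequentially. linear (\<lambda>x. adjoint (J (real k)) x - x)"
  using eventually_large
  by eventually_elim
    (intro bounded_linear.linear bounded_linear_sub bounded_linear_ident bounded_linear_adjoint bounded_linear_J, simp)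

lemma eventually_norm_J_diff_le:
  "\<forall>\<^sub>F k in sequentially. \<forall>x. norm (J (real k) x - x) \<le> (2 * M + 1) * norm x"
  using eventually_large
proof eventually_elim
  case (elim k)
  then have "norm (J (real k) x) \<le> (2 * M) * norm x" for x by (intro norm_J_le) auto
  then have "norm (J (real k) x - x) \<le> (2 * M) * norm x + norm x" for x
    using norm_triangle_ineq4[of "J (real k) x" x] by (meson add_right_mono order_trans)
  then show ?case by (simp add: distrib_right)
qed

lemma eventually_norm_adjoint_J_diff_le:
  "\<forall>\<^sub>F k in sequentially. \<forall>x. norm (adjoint (J (real k)) x - x) \<le> (2 * M + 1) * norm x"
  using eventually_large
proof eventually_elim
  case (elim k)
  then have "norm (adjoint (J (real k)) x) \<le> (2 * M) * norm x" for x
    using M by (intro norm_adjoint_le bounded_linear_J norm_J_le) auto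
  then have "norm (adjoint (J (real k)) x - x) \<le> (2 * M) * norm x + norm x" for x
    using norm_triangle_ineq4[of "adjoint (J (real k)) x" x] by (meson add_right_mono order_trans)
  then show ?case by (simp add: distrib_right)
qed

text \<open>Composed with \<open>R'\<close>, the difference is the adjoint of
  \<open>R (J k - id)\<close> and inherits its bound \<open>rate k\<close>; density and the uniform
  bound do the rest.\<close>

lemma adjoint_J_diff_tendsto: "(\<lambda>k. adjoint (J (real k)) x - x) \<longlonglongrightarrow> 0"
proof (rule strong_null_dense[OF eventually_linear_adjoint_J_diff eventually_norm_adjoint_J_diff_le _ range_R'_dense])
  show "(\<lambda>k. adjoint (J (real k)) x - x) \<longlonglongrightarrow> 0" if x: "x \<in> range R'" for x
  proof -
    obtain v where v: "x = R' v" using x by blast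
    have "\<forall>\<^sub>F k in sequentially. norm (adjoint (J (real k)) x - x) \<le>
        rate (real k) * norm v"
      using eventually_large
    proof eventually_elim
      case (elim k)
      let ?c = "rate (real k)"
      let ?T = "\<lambda>x. R (J (real k) x - x)"
      have bT: "bounded_linear ?T"
        using elim by (intro bounded_linear_compose[OF bl_R] bounded_linear_sub bounded_linear_J bounded_linear_ident) auto
      have "?T y \<bullet> v = y \<bullet> (adjoint (J (real k)) x - x)" for y
        using elim by (simp add: inner_R inner_diff_left inner_diff_right v flip: inner_adjoint[OF bounded_linear_J])
      then have "adjoint ?T v = adjoint (J (real k)) x - x" by (rule adjoint_eqI[OF bT])
      moreover have "norm (adjoint ?T v) \<le> ?c * norm v"
        using elim M k0 by (intro norm_adjoint_le[OF bT] norm_R_J_diff) auto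
      ultimately show ?case by simp
    qed
    moreover have "(\<lambda>k. rate (real k) * norm v) \<longlonglongrightarrow> 0"
      by (rule tendsto_mult_left_zero[OF R_J_diff_null])
    ultimately show ?thesis by (rule Lim_null_comparison)
  qed
qed

lemma domain_eq: "DA = range R"
proof
  show "DA \<subseteq> range R"
  proof
    fix x assume x: "x \<in> DA"
    interpret bounded_linear R by (rule bl_R)
    have "x = R (k0 *\<^sub>R x - A x)" using resolvent_A[OF k0 x] by (simp add: diff scaleR)
    then show "x \<in> range R" by blast
  qed
qed (use resolvent_in_domain[OF k0] in blast)

text \<open>\<open>J k\<close> maps into \<open>DA\<close>, so its adjoint annihilates every
  \<open>y\<close> orthogonal to \<open>DA\<close>; these adjoints applied to \<open>y\<close> also
  tend to \<open>y\<close>.\<close>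

lemma domain_dense: "closure DA = UNIV"
proof (rule dense_subspace_criterion)
  show "subspace DA" unfolding domain_eq by (rule linear_subspace_image) (simp_all add: bl_R bounded_linear.linear)
  fix y assume y: "\<And>v. v \<in> DA \<Longrightarrow> v \<bullet> y = 0"
  have "\<forall>\<^sub>F k in sequentially. adjoint (J (real k)) y - y = - y"
    using eventually_large
  proof eventually_elim
    case (elim k)
    have "x \<bullet> adjoint (J (real k)) y = 0" for x
      using y[OF resolvent_in_domain, of "real k" x] elim by (simp flip: inner_adjoint[OF bounded_linear_J])
    then show ?case by (metis inner_eq_zero_iff diff_0)
  qed
  with adjoint_J_diff_tendsto[of y] have "(\<lambda>k::nat. - y) \<longlonglongrightarrow> 0" by (rule Lim_transform_eventually)
  then show "y = 0" by (simp add: LIMSEQ_const_iff)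
qed

text \<open>On \<open>DA\<close>, the range of \<open>R\<close>, commutation brings the smoothing
  factor to the front and \<open>norm_R_J_diff\<close> applies.\<close>

lemma J_diff_tendsto: "(\<lambda>k. J (real k) x - x) \<longlonglongrightarrow> 0"
proof (rule strong_null_dense[OF eventually_linear_J_diff eventually_norm_J_diff_le _ domain_dense])
  show "(\<lambda>k. J (real k) x - x) \<longlonglongrightarrow> 0" if x: "x \<in> DA" for x
  proof -
    obtain v where v: "x = R v" using x domain_eq by blast
    have "\<forall>\<^sub>F k in sequentially. norm (J (real k) x - x) \<le>
        rate (real k) * norm v"
      using eventually_large
    proof eventually_elim
      case (elim k)
      interpret bounded_linear R by (rule bl_R)
      have "J (real k) x - x = R (J (real k) v - v)"
        using elim k0 by (simp add: v diff scaleR resolvent_resolvent)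
      then show ?case using norm_R_J_diff[of "real k" v] elim by simp
    qed
    moreover have "(\<lambda>k. rate (real k) * norm v) \<longlonglongrightarrow> 0"
      by (rule tendsto_mult_left_zero[OF R_J_diff_null])
    ultimately show ?thesis by (rule Lim_null_comparison)
  qed
qed

section \<open>The domain of the adjoint generator as the range of \<open>R'\<close>\<close>

lemma dense_inner_eqI:
  assumes "closure W = UNIV" "\<And>x. x \<in> W \<Longrightarrow> x \<bullet> a = x \<bullet> b"
  shows "a = (b :: 'h)"
proof -
  have "continuous_on (closure W) (\<lambda>x. x \<bullet> (a - b))" by (intro continuous_intros)
  from continuous_constant_on_closure[OF this, of 0] assms have "\<And>x. x \<bullet> (a - b) = 0"
    by (simp add: inner_diff_right)
  then have "a - b = 0" by (metis inner_eq_zero_iff)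
  then show ?thesis by simp
qed

lemma adj_R':
  shows "\<forall>x\<in>DA. A x \<bullet> R' v = x \<bullet> (k0 *\<^sub>R R' v - v)"
proof
  fix x assume "x \<in> DA"
  then show "A x \<bullet> R' v = x \<bullet> (k0 *\<^sub>R R' v - v)"
    by (simp add: resolvent_A[OF k0] inner_simps flip: inner_R)
qed

text \<open>If A x . p = x . q on \<open>DA\<close>, inserting \<open>R x\<close> for x gives R x .
  (k0 p - q) = x . p, so p is the image of k0 p - q under \<open>R'\<close>.\<close>

lemma adj_dom_eq: "adj_dom DA A = range R'"
proof
  show "adj_dom DA A \<subseteq> range R'"
  proof
    fix p assume "p \<in> adj_dom DA A"
    then obtain q where q: "\<forall>x\<in>DA. A x \<bullet> p = x \<bullet> q" unfolding adj_dom_def by blast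
    have "R x \<bullet> (k0 *\<^sub>R p - q) = x \<bullet> p" for x
      using bspec[OF q resolvent_in_domain[OF k0, of x]] by (simp add: A_resolvent[OF k0] inner_simps)
    then have "R' (k0 *\<^sub>R p - q) = p" by (rule adjoint_eqI[OF bl_R])
    then show "p \<in> range R'" by (metis rangeI)
  qed
  show "range R' \<subseteq> adj_dom DA A" using adj_R' unfolding adj_dom_def by blast
qed

lemma R'_in_adj_dom [simp]: "R' v \<in> adj_dom DA A"
  by (simp add: adj_dom_eq)

lemma adj_op_R': "adj_op DA A (R' v) = k0 *\<^sub>R R' v - v"
  unfolding adj_op_def
proof (rule the_equality)
  fix q assume q: "\<forall>x\<in>DA. A x \<bullet> R' v = x \<bullet> q"
  show "q = k0 *\<^sub>R R' v - v"
    by (rule dense_inner_eqI[OF domain_dense]) (use q adj_R'[of v] in auto)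
qed (rule adj_R')

text \<open>The adjoint generator composed with \<open>R'\<close> is the bounded operator k0 R' -
  id. This makes p |-> \<open>B v (R' p)\<close> a bounded functional on H.\<close>

lemma adj_graph_norm_R': "\<exists>c>0. \<forall>v. adj_graph_norm DA A (R' v) \<le> c * norm v"
proof -
  obtain K where K: "K > 0" "\<And>v. norm (R' v) \<le> norm v * K"
    using bounded_linear.pos_bounded[OF bl_R'] by blast
  have "adj_graph_norm DA A (R' v) \<le> (K + (\<bar>k0\<bar> * K + 1)) * norm v" for v
  proof -
    have "adj_graph_norm DA A (R' v) \<le> norm (R' v) + norm (adj_op DA A (R' v))"
      unfolding adj_graph_norm_def by (metis norm_ge_zero power2_norm_eq_inner sqrt_sum_squares_le_sum)
    also have "norm (adj_op DA A (R' v)) \<le> \<bar>k0\<bar> * norm (R' v) + norm v"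
      unfolding adj_op_R' using norm_triangle_ineq4[of "k0 *\<^sub>R R' v" v] by simp
    also have "norm (R' v) + (\<bar>k0\<bar> * norm (R' v) + norm v) \<le> norm v * K + (\<bar>k0\<bar> * (norm v * K) + norm v)"
      using K(2)[of v] by (intro add_mono mult_left_mono) auto
    finally show ?thesis by (simp add: algebra_simps)
  qed
  moreover have "K + (\<bar>k0\<bar> * K + 1) > 0" using K(1) by (simp add: add_pos_nonneg)
  ultimately show ?thesis by blast
qed

text \<open>Density of D(A-star) makes the embedding injective, which gives the description in
  \<open>state\<close> a unique value.\<close>

lemma pivot_inject: "pivot DA A h = pivot DA A h' \<Longrightarrow> h = h'"
proof (rule dense_inner_eqI[OF range_R'_dense])
  fix x assume eq: "pivot DA A h = pivot DA A h'" and "x \<in> range R'"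
  then have "x \<in> adj_dom DA A" by (simp add: adj_dom_eq)
  with fun_cong[OF eq, of x] show "x \<bullet> h = x \<bullet> h'" by (simp add: pivot_def inner_commute)
qed

text \<open>\<open>semigroup_ext\<close> evaluates functionals that are meaningful only on
  D(A-star), so the adjoints must preserve that set; this is the adjoint form of S t commuting with
  R.\<close>

lemma adjoint_S_R':
  assumes t: "0 \<le> t"
  shows "adjoint (S t) (R' v) = R' (adjoint (S t) v)"
proof (rule adjoint_eqI[OF blinfun.bounded_linear_right])
  fix x
  have "S t x \<bullet> R' v = S t (R x) \<bullet> v" by (simp add: S_resolvent[OF k0 t] flip: inner_R)
  then show "S t x \<bullet> R' v = x \<bullet> R' (adjoint (S t) v)"
    by (simp add: inner_adjoint[OF blinfun.bounded_linear_right] flip: inner_R)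
qed

subsection \<open>The adjoint semigroup\<close>

definition S' where "S' t = Blinfun (adjoint (S t))"

lemma S'_apply: "S' t x = adjoint (S t) x"
  unfolding S'_def
  by (simp add: bounded_linear_Blinfun_apply[OF bounded_linear_adjoint[OF blinfun.bounded_linear_right]])

lemma inner_S': "S t x \<bullet> y = x \<bullet> S' t y"
  unfolding S'_apply by (rule inner_adjoint[OF blinfun.bounded_linear_right])

text \<open>\<open>(S' h - id) R'\<close> is the adjoint of \<open>R (S h - id)\<close>, whose norm
  tends to 0 by \<open>norm_resolvent_S_diff\<close>; the local bound extends convergence from the
  range of \<open>R'\<close> to H.\<close>

lemma adjoint_semigroup: "C0_semigroup S'"
  unfolding C0_semigroup_def
proof (intro conjI allI impI)
  have eqI: "X = Y" if "\<And>x y. x \<bullet> blinfun_apply X y = x \<bullet> blinfun_apply Y y" for X Y :: "'h \<Rightarrow>\<^sub>L 'h"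
    by (rule blinfun_eqI) (metis that vector_eq_ldot)
  show "S' 0 = id_blinfun" by (rule eqI) (simp flip: inner_S')
  show "S' (s + t) = S' s o\<^sub>L S' t" if "0 \<le> s" "0 \<le> t" for s t
    by (rule eqI) (use S_add[OF that(2,1)] in \<open>simp add: add.commute flip: inner_S'\<close>)
  fix x
  obtain K where K: "K > 0" "\<And>t x. t \<in> {0..1} \<Longrightarrow> norm (S t x) \<le> K * norm x" using S_bounded_on by blast
  have K': "norm (S' t x) \<le> K * norm x" if "t \<in> {0..1}" for t x
    unfolding S'_apply using K that by (intro norm_adjoint_le blinfun.bounded_linear_right) auto
  define m where "m h = (exp (\<bar>k0\<bar> * h) - 1) * (M / (k0 - w)) + exp \<bar>k0\<bar> * (M * exp w) * h" for h
  have k0': "0 \<le> k0" using k0 w by simp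
  have "(\<lambda>n. S' (h n) x - x) \<longlonglongrightarrow> 0" if h: "h \<longlonglongrightarrow> 0" "\<And>n. 0 \<le> h n" "\<And>n. h n \<le> 1" for h :: "nat \<Rightarrow> real"
  proof (rule strong_null_dense[OF _ _ _ range_R'_dense])
    show "\<forall>\<^sub>F n in sequentially. linear (\<lambda>x. S' (h n) x - x)"
      by (intro always_eventually allI bounded_linear.linear bounded_linear_sub bounded_linear_ident blinfun.bounded_linear_right)
    show "\<forall>\<^sub>F n in sequentially. \<forall>x. norm (S' (h n) x - x) \<le> (K + 1) * norm x"
    proof (intro always_eventually allI)
      fix n x
      have "norm (S' (h n) x) \<le> K * norm x" using K' h by simp
      then show "norm (S' (h n) x - x) \<le> (K + 1) * norm x"
        using norm_triangle_ineq4[of "S' (h n) x" x] by (simp add: algebra_simps)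
    qed
    show "(\<lambda>n. S' (h n) x - x) \<longlonglongrightarrow> 0" if x: "x \<in> range R'" for x
    proof -
      obtain v where v: "x = R' v" using x by blast
      have "norm (S' (h n) x - x) \<le> m (h n) * norm v" for n
      proof -
        let ?T = "\<lambda>x. R (S (h n) x - x)"
        have bT: "bounded_linear ?T"
          by (intro bounded_linear_compose[OF bl_R] bounded_linear_sub bounded_linear_ident blinfun.bounded_linear_right)
        have "?T y \<bullet> v = y \<bullet> (S' (h n) x - x)" for y
          by (simp add: inner_R inner_diff_left inner_diff_right v flip: inner_S')
        then have "adjoint ?T v = S' (h n) x - x" by (rule adjoint_eqI[OF bT])
        moreover have "norm (adjoint ?T v) \<le> m (h n) * norm v"
        proof (rule norm_adjoint_le[OF bT])
          show "0 \<le> m (h n)" using h(2)[of n] k0 M unfolding m_def by (intro add_nonneg_nonneg mult_nonneg_nonneg) auto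
          show "norm (?T y) \<le> m (h n) * norm y" for y
            using norm_resolvent_S_diff[OF k0 k0' h(2,3), of n y] k0' by (simp add: m_def)
        qed
        ultimately show ?thesis by simp
      qed
      moreover have "(\<lambda>n. m (h n) * norm v) \<longlonglongrightarrow> 0"
      proof -
        have "isCont m 0" unfolding m_def by (intro continuous_intros)
        from isCont_tendsto_compose[OF this h(1)] have "(\<lambda>n. m (h n)) \<longlonglongrightarrow> 0" by (simp add: m_def)
        then show ?thesis by (rule tendsto_mult_left_zero)
      qed
      ultimately show ?thesis
        using Lim_null_comparison[of "\<lambda>n. S' (h n) x - x" "\<lambda>n. m (h n) * norm v"] by simp
    qed
  qed
  note seq = this
  show "((\<lambda>t. S' t x) \<longlongrightarrow> x) (at_right 0)"
  proof (rule tendsto_at_right_sequentially[of 0 1])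
    fix h :: "nat \<Rightarrow> real" assume "\<And>n. 0 < h n" "\<And>n. h n < 1" "decseq h" "h \<longlonglongrightarrow> 0"
    then have "(\<lambda>n. S' (h n) x - x) \<longlonglongrightarrow> 0" by (intro seq) (simp_all add: less_imp_le)
    then show "(\<lambda>n. S' (h n) x) \<longlonglongrightarrow> x" by (rule LIM_zero_cancel)
  qed simp
qed

end

section \<open>Quadratic control problems in a Hilbert space of controls\<close>

text \<open>\<open>a\<close> is the free motion and \<open>G\<close> the input map. The bound
  \<open>c\<close> is uniform in t, so that norm convergence of controls forces uniform convergence
  of trajectories.\<close>

locale quadratic_control =
  fixes G :: "'x::{real_inner, banach} \<Rightarrow> real \<Rightarrow> 'h::{real_inner, banach}"
    and a :: "real \<Rightarrow> 'h" and C P0 :: "'h \<Rightarrow>\<^sub>L 'h" and z :: 'h and T c :: real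
  assumes T: "0 < T"
    and P0_sym: "P0 x \<bullet> y = x \<bullet> P0 y"
    and P0_nonneg: "0 \<le> P0 x \<bullet> x"
    and G_linear: "t \<in> {0..T} \<Longrightarrow> linear (\<lambda>f. G f t)"
    and G_cont: "continuous_on {0..T} (G f)"
    and c: "0 \<le> c" and G_bound: "t \<in> {0..T} \<Longrightarrow> norm (G f t) \<le> c * norm f"
    and a_cont: "continuous_on {0..T} a"
begin

definition traj :: "'x \<Rightarrow> real \<Rightarrow> 'h" where "traj f t = a t + G f t"

definition functional :: "'x \<Rightarrow> real" where
  "functional f = (norm f)\<^sup>2 + integral {0..T} (\<lambda>t. (norm (C (traj f t) - z))\<^sup>2) + P0 (traj f T) \<bullet> traj f T"

text \<open>Half of the derivative of the functional at \<open>f\<close> in the direction \<open>g\<close>.\<close>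

definition euler :: "'x \<Rightarrow> 'x \<Rightarrow> real" where
  "euler f g = f \<bullet> g + integral {0..T} (\<lambda>t. (C (traj f t) - z) \<bullet> C (G g t)) + P0 (traj f T) \<bullet> G g T"

lemma T_mem: "T \<in> {0..T}" using T by simp

lemma G_add: "t \<in> {0..T} \<Longrightarrow> G (f + g) t = G f t + G g t"
  and G_scaleR: "t \<in> {0..T} \<Longrightarrow> G (s *\<^sub>R f) t = s *\<^sub>R G f t"
  and G_diff: "t \<in> {0..T} \<Longrightarrow> G (f - g) t = G f t - G g t"
  using linear_add[OF G_linear] linear_scale[OF G_linear] linear_diff[OF G_linear] by simp_all

lemma traj_cont: "continuous_on {0..T} (traj f)"
  unfolding traj_def[abs_def] by (intro continuous_intros a_cont G_cont)

lemmas cont_intros = continuous_intros traj_cont G_cont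
  bounded_linear.continuous_on[OF blinfun.bounded_linear_right]

lemma integrable_traj: "(\<lambda>t. (norm (C (traj f t) - z))\<^sup>2) integrable_on {0..T}"
  by (intro integrable_continuous_real cont_intros)

lemma traj_add: "t \<in> {0..T} \<Longrightarrow> traj (f + s *\<^sub>R g) t = traj f t + s *\<^sub>R G g t"
  unfolding traj_def by (simp add: G_add G_scaleR)

lemma traj_midpoint:
  assumes "t \<in> {0..T}"
  shows "traj ((1/2) *\<^sub>R (f + g)) t = (1/2) *\<^sub>R (traj f t + traj g t)"
proof -
  have "a t = (1/2) *\<^sub>R a t + (1/2) *\<^sub>R a t" by (simp flip: scaleR_add_left)
  moreover have "G ((1/2) *\<^sub>R (f + g)) t = (1/2) *\<^sub>R G f t + (1/2) *\<^sub>R G g t"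
    using assms by (simp only: G_add G_scaleR scaleR_add_right)
  ultimately have "traj ((1/2) *\<^sub>R (f + g)) t =
      ((1/2) *\<^sub>R a t + (1/2) *\<^sub>R a t) + ((1/2) *\<^sub>R G f t + (1/2) *\<^sub>R G g t)"
    unfolding traj_def by (rule arg_cong2)
  also have "\<dots> = (1/2) *\<^sub>R (traj f t + traj g t)" by (simp only: traj_def scaleR_add_right add_ac)
  finally show ?thesis .
qed

text \<open>The gain comes from the control norm alone, by the parallelogram identity; the state
  terms are merely convex.\<close>

lemma functional_midpoint:
  "functional ((1/2) *\<^sub>R (f + g)) \<le> (functional f + functional g) / 2 - (norm (f - g))\<^sup>2 / 4"
proof -
  have "integral {0..T} (\<lambda>t. (norm (C (traj ((1/2) *\<^sub>R (f + g)) t) - z))\<^sup>2) \<le>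
      integral {0..T} (\<lambda>t. ((norm (C (traj f t) - z))\<^sup>2 + (norm (C (traj g t) - z))\<^sup>2) / 2)"
  proof (rule integral_le)
    show "(norm (C (traj ((1/2) *\<^sub>R (f + g)) t) - z))\<^sup>2 \<le>
        ((norm (C (traj f t) - z))\<^sup>2 + (norm (C (traj g t) - z))\<^sup>2) / 2" if "t \<in> {0..T}" for t
    proof -
      have "z = (1/2) *\<^sub>R (z + z)" by (simp flip: scaleR_2)
      then have "C (traj ((1/2) *\<^sub>R (f + g)) t) - z = (1/2) *\<^sub>R ((C (traj f t) - z) + (C (traj g t) - z))"
        unfolding traj_midpoint[OF that] by (simp add: blinfun.bilinear_simps algebra_simps)
      then have "(norm (C (traj ((1/2) *\<^sub>R (f + g)) t) - z))\<^sup>2 =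
          ((norm (C (traj f t) - z))\<^sup>2 + (norm (C (traj g t) - z))\<^sup>2) / 2 -
          (norm ((C (traj f t) - z) - (C (traj g t) - z)))\<^sup>2 / 4"
        by (simp only: midpoint_norm)
      then show ?thesis using zero_le_power2[of "norm ((C (traj f t) - z) - (C (traj g t) - z))"] by linarith
    qed
    show "(\<lambda>t. ((norm (C (traj f t) - z))\<^sup>2 + (norm (C (traj g t) - z))\<^sup>2) / 2) integrable_on {0..T}"
      by (intro integrable_continuous_real cont_intros) simp
  qed (rule integrable_traj)
  also have "\<dots> = (integral {0..T} (\<lambda>t. (norm (C (traj f t) - z))\<^sup>2) + integral {0..T} (\<lambda>t. (norm (C (traj g t) - z))\<^sup>2)) / 2"
    by (simp add: Henstock_Kurzweil_Integration.integral_add[OF integrable_traj integrable_traj])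
  finally have 1: "integral {0..T} (\<lambda>t. (norm (C (traj ((1/2) *\<^sub>R (f + g)) t) - z))\<^sup>2) \<le> \<dots>" .
  define p q where "p = traj f T" and "q = traj g T"
  have "0 \<le> P0 (p - q) \<bullet> (p - q)" by (rule P0_nonneg)
  then have 2: "P0 ((1/2) *\<^sub>R (p + q)) \<bullet> ((1/2) *\<^sub>R (p + q)) \<le> (P0 p \<bullet> p + P0 q \<bullet> q) / 2"
    by (simp add: blinfun.bilinear_simps inner_simps algebra_simps)
  show ?thesis
    using 1 2 unfolding functional_def traj_midpoint[OF T_mem] midpoint_norm p_def[symmetric] q_def[symmetric]
    by argo
qed

lemma functional_nonneg: "0 \<le> functional f"
  unfolding functional_def
  by (intro add_nonneg_nonneg P0_nonneg Henstock_Kurzweil_Integration.integral_nonneg integrable_traj) auto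

text \<open>Symmetry of \<open>P0\<close> merges the two mixed terminal terms into one, which is why
  \<open>euler\<close> is exactly half the derivative.\<close>

lemma functional_expand:
  "functional (f + s *\<^sub>R g) = functional f + 2 * s * euler f g +
     s\<^sup>2 * ((norm g)\<^sup>2 + integral {0..T} (\<lambda>t. (norm (C (G g t)))\<^sup>2) + P0 (G g T) \<bullet> G g T)"
proof -
  have "integral {0..T} (\<lambda>t. (norm (C (traj (f + s *\<^sub>R g) t) - z))\<^sup>2) =
      integral {0..T} (\<lambda>t. (norm (C (traj f t) - z))\<^sup>2 +
        ((2 * s) * ((C (traj f t) - z) \<bullet> C (G g t)) + s\<^sup>2 * (norm (C (G g t)))\<^sup>2))"
  proof (rule integral_cong)
    fix t assume t: "t \<in> {0..T}"
    define p q where "p = C (traj f t) - z" and "q = C (G g t)"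
    have "C (traj (f + s *\<^sub>R g) t) - z = p + s *\<^sub>R q"
      unfolding traj_add[OF t] p_def q_def by (simp add: blinfun.bilinear_simps)
    then show "(norm (C (traj (f + s *\<^sub>R g) t) - z))\<^sup>2 = (norm (C (traj f t) - z))\<^sup>2 +
        ((2 * s) * ((C (traj f t) - z) \<bullet> C (G g t)) + s\<^sup>2 * (norm (C (G g t)))\<^sup>2)"
      unfolding power2_norm_eq_inner p_def[symmetric] q_def[symmetric]
      by (simp add: inner_add_left inner_add_right inner_commute[of q p] power2_eq_square algebra_simps)
  qed
  also have "\<dots> = integral {0..T} (\<lambda>t. (norm (C (traj f t) - z))\<^sup>2) +
      ((2 * s) * integral {0..T} (\<lambda>t. (C (traj f t) - z) \<bullet> C (G g t)) +
       s\<^sup>2 * integral {0..T} (\<lambda>t. (norm (C (G g t)))\<^sup>2))"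
  proof (subst Henstock_Kurzweil_Integration.integral_add)
    show "(\<lambda>t. (norm (C (traj f t) - z))\<^sup>2) integrable_on {0..T}" by (rule integrable_traj)
    show "(\<lambda>t. (2 * s) * ((C (traj f t) - z) \<bullet> C (G g t)) + s\<^sup>2 * (norm (C (G g t)))\<^sup>2) integrable_on {0..T}"
      by (intro integrable_continuous_real cont_intros)
  qed (subst Henstock_Kurzweil_Integration.integral_add,
      (intro integrable_continuous_real cont_intros)+, simp)
  finally have 1: "integral {0..T} (\<lambda>t. (norm (C (traj (f + s *\<^sub>R g) t) - z))\<^sup>2) = \<dots>" .
  define p q where "p = traj f T" and "q = G g T"
  have 2: "P0 (p + s *\<^sub>R q) \<bullet> (p + s *\<^sub>R q) = P0 p \<bullet> p + 2 * s * (P0 p \<bullet> q) + s\<^sup>2 * (P0 q \<bullet> q)"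
    using P0_sym[of q p] by (simp add: blinfun.bilinear_simps inner_simps inner_commute power2_eq_square algebra_simps)
  have 3: "(norm (f + s *\<^sub>R g))\<^sup>2 = (norm f)\<^sup>2 + 2 * s * (f \<bullet> g) + s\<^sup>2 * (norm g)\<^sup>2"
    unfolding power2_norm_eq_inner by (simp add: inner_simps inner_commute power2_eq_square algebra_simps)
  show ?thesis
    unfolding functional_def euler_def traj_add[OF T_mem] 1 3 p_def[symmetric] q_def[symmetric] 2
    by (simp add: algebra_simps)
qed

lemma minimizer_euler:
  assumes "\<And>g. functional f \<le> functional g"
  shows "euler f g = 0"
proof (rule quadratic_nonneg_imp_linear_term_zero)
  show "0 \<le> 2 * s * euler f g +
     s\<^sup>2 * ((norm g)\<^sup>2 + integral {0..T} (\<lambda>t. (norm (C (G g t)))\<^sup>2) + P0 (G g T) \<bullet> G g T)" for s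
    using assms[of "f + s *\<^sub>R g"] unfolding functional_expand by simp
qed

lemma traj_tendsto_uniformly:
  assumes "f \<longlonglongrightarrow> g"
  shows "uniform_limit {0..T} (\<lambda>n. traj (f n)) (traj g) sequentially"
proof (rule uniform_limitI)
  fix e :: real assume "0 < e"
  then have "\<forall>\<^sub>F n in sequentially. dist (f n) g < e / (c + 1)"
    using c by (intro tendstoD[OF assms]) simp
  then show "\<forall>\<^sub>F n in sequentially. \<forall>t\<in>{0..T}. dist (traj (f n) t) (traj g t) < e"
  proof eventually_elim
    case (elim n)
    show ?case
    proof
      fix t assume t: "t \<in> {0..T}"
      have "dist (traj (f n) t) (traj g t) = norm (G (f n - g) t)"
        by (simp add: traj_def dist_norm G_diff[OF t])
      also have "\<dots> \<le> (c + 1) * norm (f n - g)" using G_bound[OF t, of "f n - g"] norm_ge_zero[of "f n - g"] unfolding distrib_right by linarith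
      also have "\<dots> < (c + 1) * (e / (c + 1))" using elim c by (intro mult_strict_left_mono) (auto simp: dist_norm)
      finally show "dist (traj (f n) t) (traj g t) < e" using c by simp
    qed
  qed
qed

end

lemma integral_uniform_tendsto:
  fixes p :: "nat \<Rightarrow> real \<Rightarrow> real"
  assumes p: "uniform_limit {a..b} p q sequentially" "\<forall>\<^sub>F n in sequentially. continuous_on {a..b} (p n)"
    and q: "continuous_on {a..b} q" and ab: "a \<le> b"
  shows "(\<lambda>n. integral {a..b} (p n)) \<longlonglongrightarrow> integral {a..b} q"
proof (rule tendstoI)
  fix e :: real assume "0 < e"
  define d where "d = e / (2 * (b - a + 1))"
  have d: "0 < d" using \<open>0 < e\<close> ab by (simp add: d_def)
  have db: "d * (b - a) < e"
  proof -
    have "d * (b - a) \<le> d * (b - a + 1)" using d by simp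
    also have "\<dots> = e / 2" using ab by (simp add: d_def field_simps)
    finally show ?thesis using \<open>0 < e\<close> by simp
  qed
  from uniform_limitD[OF p(1) d] p(2)
  show "\<forall>\<^sub>F n in sequentially. dist (integral {a..b} (p n)) (integral {a..b} q) < e"
  proof eventually_elim
    case (elim n)
    have "integral {a..b} (p n) - integral {a..b} q = integral {a..b} (\<lambda>t. p n t - q t)"
      by (rule Henstock_Kurzweil_Integration.integral_diff[symmetric]) (intro integrable_continuous_real elim q)+
    moreover have "norm (integral {a..b} (\<lambda>t. p n t - q t)) \<le> d * (b - a)"
    proof (rule integral_bound[OF ab continuous_on_diff[OF elim(2) q]])
      show "norm (p n t - q t) \<le> d" if "t \<in> {a..b}" for t
        using bspec[OF elim(1) that] by (simp add: dist_norm)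
    qed
    ultimately show ?case using db by (simp add: dist_norm)
  qed
qed

text \<open>Phrased for arbitrary uniformly convergent curves, since it yields both continuity of
  the functional and convergence of the minimal costs.\<close>

lemma quadratic_cost_tendsto:
  fixes C P0 :: "'h::real_inner \<Rightarrow>\<^sub>L 'h" and T :: real
  assumes x: "uniform_limit {0..T} x y sequentially" "\<forall>\<^sub>F n in sequentially. continuous_on {0..T} (x n)"
    and y: "continuous_on {0..T} y" and T: "0 < T"
  shows "(\<lambda>n. integral {0..T} (\<lambda>t. (norm (C (x n t) - z))\<^sup>2) + P0 (x n T) \<bullet> x n T)
    \<longlonglongrightarrow> integral {0..T} (\<lambda>t. (norm (C (y t) - z))\<^sup>2) + P0 (y T) \<bullet> y T"
proof (rule tendsto_add)
  have "uniform_limit {0..T} (\<lambda>n t. C (x n t) - z) (\<lambda>t. C (y t) - z) sequentially"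
    by (intro uniform_limit_minus uniform_limit_const
        bounded_linear.uniform_limit[OF blinfun.bounded_linear_right x(1)])
  moreover have yc: "continuous_on {0..T} (\<lambda>t. C (y t) - z)"
    by (intro continuous_intros y bounded_linear.continuous_on[OF blinfun.bounded_linear_right])
  then have "bounded ((\<lambda>t. C (y t) - z) ` {0..T})"
    by (intro compact_imp_bounded compact_continuous_image) auto
  ultimately have "uniform_limit {0..T} (\<lambda>n t. (C (x n t) - z) \<bullet> (C (x n t) - z)) (\<lambda>t. (C (y t) - z) \<bullet> (C (y t) - z)) sequentially"
    by (intro bounded_bilinear.bounded_uniform_limit[OF bounded_bilinear_inner])
  then show "(\<lambda>n. integral {0..T} (\<lambda>t. (norm (C (x n t) - z))\<^sup>2)) \<longlonglongrightarrow> integral {0..T} (\<lambda>t. (norm (C (y t) - z))\<^sup>2)"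
    unfolding power2_norm_eq_inner
  proof (rule integral_uniform_tendsto)
    show "\<forall>\<^sub>F n in sequentially. continuous_on {0..T} (\<lambda>t. (C (x n t) - z) \<bullet> (C (x n t) - z))"
      using x(2) by eventually_elim
        (intro continuous_intros bounded_linear.continuous_on[OF blinfun.bounded_linear_right])
  qed (use T in \<open>auto intro!: continuous_on_inner yc\<close>)
  have "(\<lambda>n. x n T) \<longlonglongrightarrow> y T" using tendsto_uniform_limitI[OF x(1)] T by simp
  then show "(\<lambda>n. P0 (x n T) \<bullet> x n T) \<longlonglongrightarrow> P0 (y T) \<bullet> y T"
    by (intro tendsto_inner bounded_linear.tendsto[OF blinfun.bounded_linear_right])
qed

context quadratic_control
begin

lemma functional_continuous: "continuous_on UNIV functional"
  unfolding continuous_on_sequentially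
proof (intro allI impI ballI)
  fix f :: "nat \<Rightarrow> 'x" and g assume "(\<forall>n. f n \<in> UNIV) \<and> f \<longlonglongrightarrow> g"
  then have f: "f \<longlonglongrightarrow> g" by blast
  have "(\<lambda>n. (norm (f n))\<^sup>2 +
      (integral {0..T} (\<lambda>t. (norm (C (traj (f n) t) - z))\<^sup>2) + P0 (traj (f n) T) \<bullet> traj (f n) T))
    \<longlonglongrightarrow> (norm g)\<^sup>2 + (integral {0..T} (\<lambda>t. (norm (C (traj g t) - z))\<^sup>2) + P0 (traj g T) \<bullet> traj g T)"
    by (intro tendsto_intros f quadratic_cost_tendsto[OF traj_tendsto_uniformly[OF f]] always_eventually allI traj_cont T)
  then show "(functional \<circ> f) \<longlonglongrightarrow> functional g" by (simp only: functional_def o_def add.assoc)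
qed

lemma minimizer_exists: "\<exists>f. \<forall>g. functional f \<le> functional g"
proof -
  obtain f where "\<And>g. g \<in> UNIV \<Longrightarrow> functional f \<le> functional g"
  proof (rule quadratic_minimum[of UNIV functional 0])
    show "continuous_on UNIV functional" by (rule functional_continuous)
    show "0 \<le> functional f" for f by (rule functional_nonneg)
    show "functional ((1/2) *\<^sub>R (f + g)) \<le> (functional f + functional g) / 2 - (norm (f - g))\<^sup>2 / 4" for f g
      by (rule functional_midpoint)
  qed (use that in auto)
  then show ?thesis by blast
qed

end

text \<open>Stability of the minimizer: testing both Euler equations with \<open>e = fk - f\<close> leaves a
  nonnegative term and terms that only involve the errors of \<open>J\<close> and of its adjoint along the
  fixed optimal trajectory of the limit problem.\<close>

lemma minimizer_stability:
  fixes G :: "'x::{real_inner, banach} \<Rightarrow> real \<Rightarrow> 'h::{real_inner, banach}" and C P0 :: "'h \<Rightarrow>\<^sub>L 'h"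
  assumes q: "quadratic_control G a P0 T c"
    and qk: "quadratic_control (\<lambda>f t. J (G f t)) a P0 T ck"
    and J: "bounded_linear J"
    and f: "\<And>g. quadratic_control.functional G a C P0 z T f \<le> quadratic_control.functional G a C P0 z T g"
    and fk: "\<And>g. quadratic_control.functional (\<lambda>f t. J (G f t)) a C P0 z T fk
      \<le> quadratic_control.functional (\<lambda>f t. J (G f t)) a C P0 z T g"
    and e1: "\<And>t. t \<in> {0..T} \<Longrightarrow> norm (J (G f t) - G f t) \<le> \<epsilon>"
    and e2: "\<And>t. t \<in> {0..T} \<Longrightarrow>
      norm (adjoint J (adjoint C (C (a t + G f t) - z)) - adjoint C (C (a t + G f t) - z)) \<le> \<epsilon>"
    and e3: "norm (adjoint J (P0 (a T + G f T)) - P0 (a T + G f T)) \<le> \<epsilon>"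
  shows "(norm (fk - f))\<^sup>2 \<le> ((T * (norm C)\<^sup>2 + norm P0) / 2 + ((T + 1) * c)\<^sup>2) * \<epsilon>\<^sup>2"
proof -
  interpret L: quadratic_control G a C P0 z T c by (rule q)
  interpret K: quadratic_control "\<lambda>f t. J (G f t)" a C P0 z T ck by (rule qk)
  interpret J: bounded_linear J by (rule J)
  define e where "e = fk - f"
  define r where "r t = G f t - J (G f t)" for t
  define x where "x = L.traj f"
  define xk where "xk = K.traj fk"
  define d where "d t = xk t - x t" for t
  have \<epsilon>: "0 \<le> \<epsilon>" using e3 norm_ge_zero order_trans by blast
  note inner_C = inner_adjoint[OF blinfun.bounded_linear_right[of C]]
  note inner_J = inner_adjoint[OF J]
  have Je: "J (G e t) = d t + r t" if "t \<in> {0..T}" for t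
    by (simp add: e_def d_def r_def x_def xk_def L.traj_def K.traj_def L.G_diff[OF that] J.diff)
  have Ge: "norm (G e t) \<le> c * norm e" if "t \<in> {0..T}" for t using L.G_bound[OF that] .
  have r: "norm (r t) \<le> \<epsilon>" if "t \<in> {0..T}" for t using e1[OF that] by (simp add: r_def norm_minus_commute)
  have cross: "- (\<epsilon> * (c * norm e)) \<le> (adjoint J p - p) \<bullet> G e t" if "t \<in> {0..T}" "norm (adjoint J p - p) \<le> \<epsilon>" for t p
  proof -
    have "\<bar>(adjoint J p - p) \<bullet> G e t\<bar> \<le> norm (adjoint J p - p) * norm (G e t)" by (rule Cauchy_Schwarz_ineq2)
    also have "\<dots> \<le> \<epsilon> * (c * norm e)" using that Ge \<epsilon> by (intro mult_mono) auto
    finally show ?thesis by simp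
  qed
  define b where "b = (norm C)\<^sup>2 * \<epsilon>\<^sup>2 / 4 + \<epsilon> * (c * norm e)"
  have low: "- b \<le> (C (xk t) - z) \<bullet> C (J (G e t)) - (C (x t) - z) \<bullet> C (G e t)" if t: "t \<in> {0..T}" for t
  proof -
    have "(C (xk t) - z) \<bullet> C (J (G e t)) - (C (x t) - z) \<bullet> C (G e t) =
        C (d t) \<bullet> C (J (G e t)) + (C (x t) - z) \<bullet> (C (J (G e t)) - C (G e t))"
      by (simp add: d_def blinfun.bilinear_simps inner_simps)
    \<comment> \<open>Completing the square in the unknown \<open>d t\<close>: what may be negative
      involves only the error \<open>r t\<close>.\<close>
    also have "C (d t) \<bullet> C (J (G e t)) = (norm (C (d t) + (1/2) *\<^sub>R C (r t)))\<^sup>2 - (norm (C (r t)))\<^sup>2 / 4"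
      unfolding Je[OF t] power2_norm_eq_inner
      by (simp add: blinfun.bilinear_simps inner_simps inner_commute algebra_simps)
    \<comment> \<open>Passing to adjoints moves J - id from \<open>G e t\<close>, which varies with
      the approximation, to the fixed limit trajectory.\<close>
    also have "(C (x t) - z) \<bullet> (C (J (G e t)) - C (G e t)) =
        (adjoint J (adjoint C (C (x t) - z)) - adjoint C (C (x t) - z)) \<bullet> G e t"
    proof -
      have "p \<bullet> C y = y \<bullet> adjoint C p" for p y by (metis inner_C inner_commute)
      then show ?thesis
        by (simp add: inner_diff_right[of "C (x t) - z"] inner_diff_right[of "G e t"] inner_J inner_commute[of _ "G e t"])
    qed
    finally have eq: "(C (xk t) - z) \<bullet> C (J (G e t)) - (C (x t) - z) \<bullet> C (G e t) =
        (norm (C (d t) + (1/2) *\<^sub>R C (r t)))\<^sup>2 - (norm (C (r t)))\<^sup>2 / 4 +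
        (adjoint J (adjoint C (C (x t) - z)) - adjoint C (C (x t) - z)) \<bullet> G e t" .
    have "norm (C (r t)) \<le> norm C * \<epsilon>"
      using norm_blinfun[of C "r t"] r[OF t] by (meson mult_left_mono norm_ge_zero order_trans)
    then have "(norm (C (r t)))\<^sup>2 \<le> (norm C)\<^sup>2 * \<epsilon>\<^sup>2" using power_mono[of "norm (C (r t))" "norm C * \<epsilon>" 2] by (simp add: power_mult_distrib)
    moreover have "- (\<epsilon> * (c * norm e)) \<le> (adjoint J (adjoint C (C (x t) - z)) - adjoint C (C (x t) - z)) \<bullet> G e t"
      by (rule cross[OF t]) (use e2[OF t] in \<open>simp add: x_def L.traj_def\<close>)
    moreover have "0 \<le> (norm (C (d t) + (1/2) *\<^sub>R C (r t)))\<^sup>2" by simp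
    ultimately show ?thesis unfolding eq b_def by argo
  qed
  have "e \<bullet> e = - (integral {0..T} (\<lambda>t. (C (xk t) - z) \<bullet> C (J (G e t))) - integral {0..T} (\<lambda>t. (C (x t) - z) \<bullet> C (G e t)))
      - (P0 (xk T) \<bullet> J (G e T) - P0 (x T) \<bullet> G e T)"
    using L.minimizer_euler[OF f, of e] K.minimizer_euler[OF fk, of e]
    unfolding L.euler_def K.euler_def x_def[symmetric] xk_def[symmetric] by (simp add: e_def inner_diff_left)
  also have "integral {0..T} (\<lambda>t. (C (xk t) - z) \<bullet> C (J (G e t))) - integral {0..T} (\<lambda>t. (C (x t) - z) \<bullet> C (G e t))
      = integral {0..T} (\<lambda>t. (C (xk t) - z) \<bullet> C (J (G e t)) - (C (x t) - z) \<bullet> C (G e t))"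
    unfolding x_def xk_def
    by (rule Henstock_Kurzweil_Integration.integral_diff[symmetric])
      (intro integrable_continuous_real L.cont_intros K.traj_cont J.continuous_on)+
  finally have ee: "e \<bullet> e = - integral {0..T} (\<lambda>t. (C (xk t) - z) \<bullet> C (J (G e t)) - (C (x t) - z) \<bullet> C (G e t))
      - (P0 (xk T) \<bullet> J (G e T) - P0 (x T) \<bullet> G e T)" .
  have "integral {0..T} (\<lambda>t. - b) \<le> integral {0..T} (\<lambda>t. (C (xk t) - z) \<bullet> C (J (G e t)) - (C (x t) - z) \<bullet> C (G e t))"
  proof (rule integral_le)
    show "(\<lambda>t. (C (xk t) - z) \<bullet> C (J (G e t)) - (C (x t) - z) \<bullet> C (G e t)) integrable_on {0..T}"
      unfolding x_def xk_def by (intro integrable_continuous_real L.cont_intros K.traj_cont J.continuous_on)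
  qed (use low in auto)
  then have I: "- (T * b) \<le> integral {0..T} (\<lambda>t. (C (xk t) - z) \<bullet> C (J (G e t)) - (C (x t) - z) \<bullet> C (G e t))"
    using L.T by simp
  have P: "- (norm P0 * \<epsilon>\<^sup>2 / 4 + \<epsilon> * (c * norm e)) \<le> P0 (xk T) \<bullet> J (G e T) - P0 (x T) \<bullet> G e T"
  proof -
    have "P0 (xk T) \<bullet> J (G e T) - P0 (x T) \<bullet> G e T = P0 (d T) \<bullet> J (G e T) + P0 (x T) \<bullet> (J (G e T) - G e T)"
      by (simp add: d_def blinfun.bilinear_simps inner_simps)
    \<comment> \<open>The same square for the form x, y |-> P0 x . y; symmetry matches the mixed
      terms.\<close>
    also have "P0 (d T) \<bullet> J (G e T) =
        P0 (d T + (1/2) *\<^sub>R r T) \<bullet> (d T + (1/2) *\<^sub>R r T) - (P0 (r T) \<bullet> r T) / 4"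
      unfolding Je[OF L.T_mem] using L.P0_sym[of "r T" "d T"]
      by (simp add: blinfun.bilinear_simps inner_simps inner_commute algebra_simps)
    also have "P0 (x T) \<bullet> (J (G e T) - G e T) = (adjoint J (P0 (x T)) - P0 (x T)) \<bullet> G e T"
      by (simp add: inner_diff_right inner_diff_left inner_commute[of "P0 (x T)"] inner_commute[of _ "G e T"] inner_J)
    finally have eq: "P0 (xk T) \<bullet> J (G e T) - P0 (x T) \<bullet> G e T =
        P0 (d T + (1/2) *\<^sub>R r T) \<bullet> (d T + (1/2) *\<^sub>R r T) - (P0 (r T) \<bullet> r T) / 4 +
        (adjoint J (P0 (x T)) - P0 (x T)) \<bullet> G e T" .
    have "P0 (r T) \<bullet> r T \<le> norm (P0 (r T)) * norm (r T)" by (rule norm_cauchy_schwarz)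
    also have "\<dots> \<le> (norm P0 * \<epsilon>) * \<epsilon>"
    proof (rule mult_mono)
      show "norm (P0 (r T)) \<le> norm P0 * \<epsilon>"
        using norm_blinfun[of P0 "r T"] r[OF L.T_mem] by (meson mult_left_mono norm_ge_zero order_trans)
    qed (use r[OF L.T_mem] \<epsilon> in auto)
    finally have "P0 (r T) \<bullet> r T \<le> norm P0 * \<epsilon>\<^sup>2" by (simp add: power2_eq_square)
    moreover have "- (\<epsilon> * (c * norm e)) \<le> (adjoint J (P0 (x T)) - P0 (x T)) \<bullet> G e T"
      by (rule cross[OF L.T_mem]) (use e3 in \<open>simp add: x_def L.traj_def\<close>)
    moreover have "0 \<le> P0 (d T + (1/2) *\<^sub>R r T) \<bullet> (d T + (1/2) *\<^sub>R r T)" by (rule L.P0_nonneg)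
    ultimately show ?thesis unfolding eq by argo
  qed
  have "(norm e)\<^sup>2 \<le> T * b + (norm P0 * \<epsilon>\<^sup>2 / 4 + \<epsilon> * (c * norm e))"
    using I P ee by (simp add: power2_norm_eq_inner)
  also have "\<dots> = (T * (norm C)\<^sup>2 + norm P0) / 4 * \<epsilon>\<^sup>2 + ((T + 1) * c * \<epsilon>) * norm e"
    by (simp add: b_def algebra_simps add_divide_distrib)
  \<comment> \<open>Young's inequality; absorbing half of |e|^2 on the left doubles the other
    terms.\<close>
  also have "((T + 1) * c * \<epsilon>) * norm e \<le> ((T + 1) * c * \<epsilon>)\<^sup>2 / 2 + (norm e)\<^sup>2 / 2"
    using sum_squares_bound[of "(T + 1) * c * \<epsilon>" "norm e"] by simp
  finally have "(norm e)\<^sup>2 \<le> (T * (norm C)\<^sup>2 + norm P0) / 2 * \<epsilon>\<^sup>2 + ((T + 1) * c * \<epsilon>)\<^sup>2" by simp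
  also have "((T + 1) * c * \<epsilon>)\<^sup>2 = ((T + 1) * c)\<^sup>2 * \<epsilon>\<^sup>2" by (rule power_mult_distrib)
  finally show ?thesis unfolding e_def distrib_right[of _ _ "\<epsilon>\<^sup>2"] .
qed

section \<open>Controls on an interval as square integrable functions on the line\<close>

definition cutoff :: "real \<Rightarrow> (real \<Rightarrow> 'u::real_normed_vector) \<Rightarrow> real \<Rightarrow> 'u" where
  "cutoff T u x = indicator {0<..<T} x *\<^sub>R u x"

lemma strongly_measurable_restrict_iff:
  fixes u :: "real \<Rightarrow> 'u::real_normed_vector"
  assumes X: "X \<in> sets lebesgue"
  shows "strongly_measurable (lebesgue_on X) u \<longleftrightarrow> strongly_measurable lebesgue (\<lambda>x. indicator X x *\<^sub>R u x)"
proof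
  assume "strongly_measurable (lebesgue_on X) u"
  then obtain g where g: "\<And>n. simple_function (lebesgue_on X) (g n)" "AE x in lebesgue_on X. (\<lambda>n. g n x) \<longlonglongrightarrow> u x"
    unfolding strongly_measurable_def by blast
  have "AE x in lebesgue. x \<in> X \<longrightarrow> (\<lambda>n. g n x) \<longlonglongrightarrow> u x"
    using g(2) X by (simp add: AE_restrict_space_iff)
  then have "AE x in lebesgue. (\<lambda>n. indicator X x *\<^sub>R g n x) \<longlonglongrightarrow> indicator X x *\<^sub>R u x"
    by eventually_elim (auto simp: indicator_def)
  moreover have "simple_function lebesgue (\<lambda>x. indicator X x *\<^sub>R g n x)" for n
    using g(1)[of n] X by (simp add: simple_function_restrict_space)
  ultimately show "strongly_measurable lebesgue (\<lambda>x. indicator X x *\<^sub>R u x)"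
    unfolding strongly_measurable_def by (intro exI[of _ "\<lambda>n x. indicator X x *\<^sub>R g n x"]) simp
next
  assume "strongly_measurable lebesgue (\<lambda>x. indicator X x *\<^sub>R u x)"
  then obtain g where g: "\<And>n. simple_function lebesgue (g n)"
    "AE x in lebesgue. (\<lambda>n. g n x) \<longlonglongrightarrow> indicator X x *\<^sub>R u x"
    unfolding strongly_measurable_def by blast
  have "AE x in lebesgue. x \<in> X \<longrightarrow> (\<lambda>n. g n x) \<longlonglongrightarrow> u x"
    using g(2) by eventually_elim (auto simp: indicator_def)
  then have "AE x in lebesgue_on X. (\<lambda>n. g n x) \<longlonglongrightarrow> u x" using X by (simp add: AE_restrict_space_iff)
  moreover have "simple_function (lebesgue_on X) (g n)" for n
    using X simple_function_compose2[OF simple_function_indicator[OF X] g(1)[of n], of "(*\<^sub>R)"]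
    by (simp add: simple_function_restrict_space)
  ultimately show "strongly_measurable (lebesgue_on X) u" unfolding strongly_measurable_def by blast
qed

lemma cutoff_norm: "(norm (cutoff T u x))\<^sup>2 = indicator {0<..<T} x *\<^sub>R (norm (u x))\<^sup>2"
  by (simp add: cutoff_def indicator_def)

lemma L2_controls_iff: "u \<in> L2_controls T \<longleftrightarrow> square_integrable (cutoff T u)"
proof -
  have "strongly_measurable (lebesgue_on {0<..<T}) u \<longleftrightarrow> strongly_measurable lebesgue (cutoff T u)"
    unfolding cutoff_def[abs_def] by (rule strongly_measurable_restrict_iff) simp
  moreover have "integrable (lebesgue_on {0<..<T}) (\<lambda>x. (norm (u x))\<^sup>2) \<longleftrightarrow> integrable lebesgue (\<lambda>x. (norm (cutoff T u x))\<^sup>2)"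
    unfolding cutoff_norm by (rule integrable_restrict_space) simp
  ultimately show ?thesis by (simp add: L2_controls_def square_integrable_def)
qed

text \<open>The class of the extension by zero. Controls on intervals of different length become
  comparable in one Hilbert space.\<close>

definition emb :: "real \<Rightarrow> (real \<Rightarrow> 'u) \<Rightarrow> 'u::real_inner l2" where
  "emb T u = abs_l2 (cutoff T u)"

lemma norm_emb:
  assumes "u \<in> L2_controls T"
  shows "(norm (emb T u))\<^sup>2 = (LINT t|lebesgue_on {0<..<T}. (norm (u t))\<^sup>2)"
  unfolding emb_def norm_abs_l2[OF assms[unfolded L2_controls_iff]] cutoff_norm
  by (rule integral_restrict_space[symmetric]) simp

lemma square_integrable_cutoff:
  assumes "square_integrable f"
  shows "square_integrable (cutoff T f)"
proof -
  have s: "strongly_measurable lebesgue (cutoff T f)"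
    unfolding cutoff_def[abs_def]
    by (rule strongly_measurable_compose2[where h = "(*\<^sub>R)", OF strongly_measurable_simple])
      (use assms in \<open>auto simp: square_integrable_def intro!: continuous_intros simple_function_indicator\<close>)
  have "integrable lebesgue (\<lambda>x. (norm (cutoff T f x))\<^sup>2)"
    unfolding cutoff_norm using assms
    by (intro integrable_mult_indicator) (simp_all add: square_integrable_def)
  with s show ?thesis by (simp add: square_integrable_def)
qed

lemma rep_in_L2_controls: "rep_l2 f \<in> L2_controls T"
  unfolding L2_controls_iff by (rule square_integrable_cutoff[OF square_integrable_rep])

lemma L2_controls_diff: "u \<in> L2_controls T \<Longrightarrow> v \<in> L2_controls T \<Longrightarrow> (\<lambda>t. u t - v t) \<in> L2_controls T"
  and emb_diff: "u \<in> L2_controls T \<Longrightarrow> v \<in> L2_controls T \<Longrightarrow> emb T u - emb T v = emb T (\<lambda>t. u t - v t)"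
proof -
  have eq: "cutoff T (\<lambda>t. u t - v t) = (\<lambda>t. cutoff T u t - cutoff T v t)"
    by (simp add: cutoff_def fun_eq_iff scaleR_diff_right)
  show "u \<in> L2_controls T \<Longrightarrow> v \<in> L2_controls T \<Longrightarrow> (\<lambda>t. u t - v t) \<in> L2_controls T"
    unfolding L2_controls_iff eq by (rule square_integrable_minus)
  show "u \<in> L2_controls T \<Longrightarrow> v \<in> L2_controls T \<Longrightarrow> emb T u - emb T v = emb T (\<lambda>t. u t - v t)"
    unfolding L2_controls_iff emb_def eq by (rule minus_abs_l2)
qed

lemma inner_abs_l2:
  assumes f: "square_integrable f" and g: "square_integrable g"
  shows "abs_l2 f \<bullet> abs_l2 g = (LINT x|lebesgue. f x \<bullet> g x)"
  unfolding inner_l2_def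
proof (rule integral_cong_AE)
  show "(\<lambda>x. rep_l2 (abs_l2 f) x \<bullet> rep_l2 (abs_l2 g) x) \<in> borel_measurable lebesgue"
    using square_integrable_inner[OF square_integrable_rep square_integrable_rep] by blast
  show "(\<lambda>x. f x \<bullet> g x) \<in> borel_measurable lebesgue"
    using square_integrable_inner[OF f g] by blast
  show "AE x in lebesgue. rep_l2 (abs_l2 f) x \<bullet> rep_l2 (abs_l2 g) x = f x \<bullet> g x"
    using rep_abs_l2[OF f] rep_abs_l2[OF g] by eventually_elim simp
qed

lemma inner_emb:
  assumes u: "u \<in> L2_controls T" and q: "q \<in> L2_controls t" and t: "t \<le> T"
  shows "emb T u \<bullet> emb t q = (LINT s|lebesgue_on {0<..<t}. u s \<bullet> q s)"
proof -
  have "emb T u \<bullet> emb t q = (LINT x|lebesgue. cutoff T u x \<bullet> cutoff t q x)"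
    unfolding emb_def by (rule inner_abs_l2) (use u q in \<open>simp_all add: L2_controls_iff\<close>)
  also have "\<dots> = (LINT x|lebesgue. indicator {0<..<t} x *\<^sub>R (u x \<bullet> q x))"
    by (rule Bochner_Integration.integral_cong) (use t in \<open>auto simp: cutoff_def indicator_def\<close>)
  also have "\<dots> = (LINT s|lebesgue_on {0<..<t}. u s \<bullet> q s)"
    by (rule integral_restrict_space[symmetric]) simp
  finally show ?thesis .
qed

text \<open>A class \<open>f\<close> may live outside {0<..<T}; the factor supported in {0<..<t}
  does not see that part.\<close>

lemma inner_emb_rep:
  assumes q: "q \<in> L2_controls t" and t: "t \<le> T"
  shows "emb T (rep_l2 f) \<bullet> emb t q = f \<bullet> emb t q"
proof -
  have q': "square_integrable (cutoff t q)" using q by (simp add: L2_controls_iff)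
  have "emb T (rep_l2 f) \<bullet> emb t q = (LINT x|lebesgue. cutoff T (rep_l2 f) x \<bullet> cutoff t q x)"
    unfolding emb_def by (intro inner_abs_l2 q' square_integrable_cutoff square_integrable_rep)
  also have "\<dots> = (LINT x|lebesgue. rep_l2 f x \<bullet> cutoff t q x)"
    by (rule Bochner_Integration.integral_cong) (use t in \<open>auto simp: cutoff_def indicator_def\<close>)
  also have "\<dots> = abs_l2 (rep_l2 f) \<bullet> abs_l2 (cutoff t q)"
    by (rule inner_abs_l2[symmetric, OF square_integrable_rep q'])
  finally show ?thesis by (simp add: emb_def abs_rep_l2)
qed

lemma norm_emb_rep_le: "(norm (emb T (rep_l2 f)))\<^sup>2 \<le> (norm f)\<^sup>2"
proof -
  have "(LINT x|lebesgue. (norm (cutoff T (rep_l2 f) x))\<^sup>2) \<le> (LINT x|lebesgue. (norm (rep_l2 f x))\<^sup>2)"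
  proof (rule integral_mono)
    show "integrable lebesgue (\<lambda>x. (norm (cutoff T (rep_l2 f) x))\<^sup>2)"
      using square_integrable_cutoff[OF square_integrable_rep] unfolding square_integrable_def by blast
    show "integrable lebesgue (\<lambda>x. (norm (rep_l2 f x))\<^sup>2)"
      using square_integrable_rep[of f] by (simp add: square_integrable_def)
  qed (simp add: cutoff_norm indicator_def)
  then show ?thesis
    unfolding norm_l2_square[of f] emb_def norm_abs_l2[OF square_integrable_cutoff[OF square_integrable_rep]] .
qed

lemma
  fixes p :: "real \<Rightarrow> real"
  assumes p: "continuous_on {0..T} p"
  shows integrable_open_interval: "integrable (lebesgue_on {0<..<T}) p"
    and LINT_open_interval: "(LINT t|lebesgue_on {0<..<T}. p t) = integral {0..T} p"
proof -
  have "integrable lebesgue (\<lambda>x. indicator {0..T} x *\<^sub>R p x)"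
    using continuous_imp_integrable_real[OF p] by (subst (asm) integrable_restrict_space) auto
  then have "integrable lebesgue (\<lambda>x. indicator {0<..<T} x *\<^sub>R (indicator {0..T} x *\<^sub>R p x))"
    by (rule integrable_mult_indicator[rotated]) simp
  then have "integrable lebesgue (\<lambda>x. indicator {0<..<T} x *\<^sub>R p x)"
    by (rule Bochner_Integration.integrable_cong[THEN iffD1, rotated 2]) (auto simp: indicator_def)
  then show int: "integrable (lebesgue_on {0<..<T}) p" by (subst integrable_restrict_space) auto
  show "(LINT t|lebesgue_on {0<..<T}. p t) = integral {0..T} p"
    unfolding integral_open_interval_real by (rule lebesgue_integral_eq_integral[OF int]) simp
qed

text \<open>Even in a non-separable space a continuous curve has separable range, with the values at
  rational times as dense subset.\<close>

lemma continuous_in_L2_controls: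
  fixes q :: "real \<Rightarrow> 'u::real_normed_vector"
  assumes q: "continuous_on {0..t} q"
  shows "q \<in> L2_controls t"
proof -
  have "strongly_measurable lebesgue (cutoff t q)"
  proof (rule strongly_measurable_if_separable)
    \<comment> \<open>0 is the value of the cutoff outside the interval.\<close>
    let ?D = "insert 0 (q ` (\<rat> \<inter> {0..t}))"
    show "countable ?D" by (intro countable_insert countable_image countable_subset[OF _ countable_rat]) auto
    have "cutoff t q s \<in> closure ?D" for s
    proof (cases "s \<in> {0<..<t}")
      case True
      have "q s \<in> closure (q ` (\<rat> \<inter> {0..t}))"
        unfolding closure_approachable
      proof (intro allI impI)
        fix e :: real assume "0 < e"
        then obtain d where d: "0 < d" "\<And>r. r \<in> {0..t} \<Longrightarrow> dist r s < d \<Longrightarrow> dist (q r) (q s) < e"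
          using q True unfolding continuous_on_iff by (metis atLeastAtMost_iff greaterThanLessThan_iff less_imp_le)
        obtain r where r: "r \<in> \<rat>" "max 0 (s - d) < r" "r < s"
          using Rats_dense_in_real[of "max 0 (s - d)" s] True d(1) by auto
        then show "\<exists>y\<in>q ` (\<rat> \<inter> {0..t}). dist y (q s) < e"
          using d(2)[of r] True by (auto simp: dist_real_def)
      qed
      then show ?thesis using True closure_mono[of "q ` (\<rat> \<inter> {0..t})" ?D] by (auto simp: cutoff_def)
    next
      case False
      then show ?thesis using closure_subset[of ?D] by (auto simp: cutoff_def)
    qed
    then show "AE x in lebesgue. cutoff t q x \<in> closure ?D" by simp
    fix v
    \<comment> \<open>Outside the interval the cutoff has distance \<open>dist 0 v\<close> from
      \<open>v\<close>; subtracting this constant allows extension by zero.\<close>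
    have "(\<lambda>x. dist (q x) v - dist 0 v) \<in> borel_measurable (lebesgue_on {0<..<t})"
      by (intro continuous_imp_measurable_on_sets_lebesgue continuous_intros continuous_on_subset[OF q]) auto
    then have "(\<lambda>x. if x \<in> {0<..<t} then dist (q x) v - dist 0 v else 0) \<in> borel_measurable lebesgue"
      by (rule borel_measurable_if_I) simp
    then have "(\<lambda>x. (if x \<in> {0<..<t} then dist (q x) v - dist 0 v else 0) + dist 0 v) \<in> borel_measurable lebesgue"
      by (intro borel_measurable_add) auto
    then show "(\<lambda>x. dist (cutoff t q x) v) \<in> borel_measurable lebesgue"
      by (rule measurable_cong[THEN iffD1, rotated]) (auto simp: cutoff_def)
  qed
  moreover have "integrable (lebesgue_on {0<..<t}) (\<lambda>x. (norm (q x))\<^sup>2)"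
    by (intro integrable_open_interval continuous_intros q)
  then have "integrable lebesgue (\<lambda>x. (norm (cutoff t q x))\<^sup>2)"
    unfolding cutoff_norm by (subst (asm) integrable_restrict_space) auto
  ultimately show ?thesis by (simp add: L2_controls_iff square_integrable_def)
qed

section \<open>Solutions of the controlled equation\<close>

locale control_system = hilbert_generator S M w DA A k0
  for S :: "real \<Rightarrow> ('h::{real_inner, banach} \<Rightarrow>\<^sub>L 'h)" and M w DA A k0 +
  fixes B :: "'u::{real_inner, banach} \<Rightarrow> 'h \<Rightarrow> real" and T :: real
  assumes B: "B \<in> control_operators DA A" and adm: "admissible DA A S B" and T: "0 < T"
begin

text \<open>In \<open>D(A*)'\<close> this is \<open>b = (k0 - A)\<^sup>-\<^sup>1 B\<close>, since \<open>D(A*)\<close> is the range of \<open>R'\<close>.\<close>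

definition b :: "'u \<Rightarrow> 'h" where "b v = (SOME y. \<forall>p. B v (R' p) = y \<bullet> p)"

interpretation R': bounded_linear R' by (rule bl_R')

text \<open>Riesz representation for p |-> \<open>B v (R' p)\<close>, bounded on H by
  \<open>adj_graph_norm_R'\<close>.\<close>

lemma B_R': "B v (R' p) = b v \<bullet> p"
proof -
  have Bv: "B v \<in> adj_dual DA A" using B by (simp add: control_operators_def)
  then obtain K where K: "\<And>p. p \<in> adj_dom DA A \<Longrightarrow> \<bar>B v p\<bar> \<le> K * adj_graph_norm DA A p"
    unfolding adj_dual_def by blast
  obtain c where c: "c > 0" "\<And>p. adj_graph_norm DA A (R' p) \<le> c * norm p" using adj_graph_norm_R' by blast
  have "bounded_linear (\<lambda>p. B v (R' p))"
  proof (rule bounded_linear_intro)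
    show "B v (R' (p + q)) = B v (R' p) + B v (R' q)" for p q
      using Bv unfolding adj_dual_def by (simp add: R'.add)
    show "B v (R' (r *\<^sub>R p)) = r *\<^sub>R B v (R' p)" for r p
      using Bv unfolding adj_dual_def by (simp add: R'.scaleR)
    show "norm (B v (R' p)) \<le> norm p * (\<bar>K\<bar> * c)" for p
    proof -
      have "\<bar>B v (R' p)\<bar> \<le> K * adj_graph_norm DA A (R' p)" by (rule K) simp
      also have "\<dots> \<le> \<bar>K\<bar> * adj_graph_norm DA A (R' p)"
        by (intro mult_right_mono) (auto simp: adj_graph_norm_def)
      also have "\<dots> \<le> \<bar>K\<bar> * (c * norm p)" by (intro mult_left_mono c) simp
      finally show ?thesis by (simp add: mult_ac)
    qed
  qed
  from riesz_representation[OF this] have "\<exists>y. \<forall>p. B v (R' p) = y \<bullet> p" by metis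
  then have "\<forall>p. B v (R' p) = b v \<bullet> p" unfolding b_def by (rule someI_ex)
  then show ?thesis by blast
qed

lemma bounded_linear_b: "bounded_linear b"
proof -
  have dual_bdd: "bdd_above ((\<lambda>p. \<bar>B v p\<bar>) ` {p \<in> adj_dom DA A. adj_graph_norm DA A p \<le> 1})" for v
  proof -
    obtain K where K: "\<And>p. p \<in> adj_dom DA A \<Longrightarrow> \<bar>B v p\<bar> \<le> K * adj_graph_norm DA A p"
    proof -
      have "B v \<in> adj_dual DA A" using B by (simp add: control_operators_def)
      then show ?thesis using that unfolding adj_dual_def by blast
    qed
    have "\<bar>B v p\<bar> \<le> \<bar>K\<bar>" if "p \<in> adj_dom DA A" "adj_graph_norm DA A p \<le> 1" for p
    proof -
      have "\<bar>B v p\<bar> \<le> \<bar>K\<bar> * adj_graph_norm DA A p"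
        by (rule order_trans[OF K[OF that(1)] mult_right_mono]) (auto simp: adj_graph_norm_def)
      also have "\<dots> \<le> \<bar>K\<bar> * 1" by (intro mult_left_mono that) simp
      finally show ?thesis by simp
    qed
    then show ?thesis by (intro bdd_aboveI[of _ "\<bar>K\<bar>"]) auto
  qed
  obtain K where K: "\<And>v. adj_dual_norm DA A (B v) \<le> K * norm v"
    using B unfolding control_operators_def by blast
  obtain c where c: "c > 0" "\<And>p. adj_graph_norm DA A (R' p) \<le> c * norm p" using adj_graph_norm_R' by blast
  show ?thesis
  proof (rule bounded_linear_intro)
    have "B (v + u) (R' p) = B v (R' p) + B u (R' p)" for u v p
      using B by (simp add: control_operators_def)
    then show "b (v + u) = b v + b u" for u v
      unfolding B_R' by (metis inner_add_left vector_eq_rdot)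
    have "B (r *\<^sub>R v) (R' p) = r * B v (R' p)" for r v p
      using B by (simp add: control_operators_def)
    then show "b (r *\<^sub>R v) = r *\<^sub>R b v" for r v
      unfolding B_R' by (metis inner_scaleR_left vector_eq_rdot)
    show "norm (b v) \<le> norm v * (K * c)" for v
    proof (cases "b v = 0")
      case True
      \<comment> \<open>\<open>K\<close> carries no sign; nonnegativity of K |v| comes from the dual
        norm, a bounded supremum of absolute values over a set containing 0.\<close>
      have "0 \<le> adj_dual_norm DA A (B v)"
      proof -
        have "0 \<in> adj_dom DA A" using R'_in_adj_dom[of 0] by (simp add: R'.zero)
        moreover have "adj_graph_norm DA A 0 \<le> 1" using c(2)[of 0] by (simp add: R'.zero)
        ultimately have "\<bar>B v 0\<bar> \<le> adj_dual_norm DA A (B v)"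
          unfolding adj_dual_norm_def using dual_bdd by (intro cSUP_upper) auto
        then show ?thesis by linarith
      qed
      then have "0 \<le> K * norm v" using K[of v] by linarith
      from mult_nonneg_nonneg[OF this less_imp_le[OF c(1)]] show ?thesis using True by (simp add: mult_ac)
    next
      case False
      \<comment> \<open>The direction of \<open>b v\<close>, scaled so that \<open>R' p\<close> lies
        in the unit ball of the graph norm.\<close>
      define p where "p = (1 / (c * norm (b v))) *\<^sub>R b v"
      have "adj_graph_norm DA A (R' p) \<le> 1" using c(2)[of p] False c(1) by (simp add: p_def)
      then have "\<bar>B v (R' p)\<bar> \<le> adj_dual_norm DA A (B v)"
        unfolding adj_dual_norm_def using dual_bdd by (intro cSUP_upper) auto
      also have "\<dots> \<le> K * norm v" by (rule K)
      finally have "\<bar>b v \<bullet> p\<bar> \<le> K * norm v" unfolding B_R' .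
      moreover have "b v \<bullet> p = norm (b v) / c"
        using False by (simp add: p_def dot_square_norm power2_eq_square)
      ultimately have "norm (b v) / c \<le> K * norm v" by linarith
      then show ?thesis using c(1) by (simp add: field_simps)
    qed
  qed
qed

lemma adj_semigroup: "strongly_continuous_semigroup S'"
  by unfold_locales (rule adjoint_semigroup)

text \<open>The representing control: the input term at time t, paired with \<open>R' p\<close>, is
  the inner product of the control with this function.\<close>

definition kernel :: "real \<Rightarrow> 'h \<Rightarrow> real \<Rightarrow> 'u" where
  "kernel t p s = adjoint b (S' (t - s) p)"

lemma kernel_L2: "kernel t p \<in> L2_controls t"
proof (rule continuous_in_L2_controls)
  have "continuous_on {0..t} (\<lambda>s. S' (t - s) p)"
    by (rule strongly_continuous_semigroup.continuous_on_S[OF adj_semigroup, where b = t])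
      (auto intro!: continuous_intros)
  then show "continuous_on {0..t} (kernel t p)"
    unfolding kernel_def[abs_def] by (rule bounded_linear.continuous_on[OF bounded_linear_adjoint[OF bounded_linear_b]])
qed

lemma input_map_eq:
  assumes u: "u \<in> L2_controls T" and t: "t \<le> T"
  shows "input_map DA A S B u t (R' p) = emb T u \<bullet> emb t (kernel t p)"
proof -
  have "input_map DA A S B u t (R' p) = (LINT s|lebesgue_on {0<..<t}. semigroup_ext DA A S (t - s) (B (u s)) (R' p))"
    by (simp add: input_map_def)
  also have "\<dots> = (LINT s|lebesgue_on {0<..<t}. u s \<bullet> kernel t p s)"
  proof (rule Bochner_Integration.integral_cong[OF refl])
    fix s assume "s \<in> space (lebesgue_on {0<..<t})"
    then have "0 \<le> t - s" by simp
    then show "semigroup_ext DA A S (t - s) (B (u s)) (R' p) = u s \<bullet> kernel t p s"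
      by (simp add: semigroup_ext_def adjoint_S_R' B_R' kernel_def S'_apply inner_adjoint[OF bounded_linear_b])
  qed
  also have "\<dots> = emb T u \<bullet> emb t (kernel t p)"
    by (rule inner_emb[symmetric, OF u kernel_L2 t])
  finally show ?thesis .
qed

text \<open>The input term at time \<open>t\<close> of any control whose class is \<open>f\<close>, in weak form: the pairing with
  \<open>R' p \<in> D(A*)\<close> is an inner product of controls.\<close>

definition G :: "'u l2 \<Rightarrow> real \<Rightarrow> 'h" where
  "G f t = (SOME h. \<forall>p. h \<bullet> R' p = f \<bullet> emb t (kernel t p))"

lemma inner_range_eqI: "(\<And>p. x \<bullet> R' p = y \<bullet> R' p) \<Longrightarrow> x = y"
  by (rule dense_inner_eqI[OF range_R'_dense]) (auto simp: inner_commute)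

text \<open>Admissibility applied to a representative gives a continuous curve satisfying the
  defining relation of \<open>G\<close>; density of the range of \<open>R'\<close> identifies the
  two.\<close>

lemma
  shows G_R': "t \<in> {0..T} \<Longrightarrow> G f t \<bullet> R' p = f \<bullet> emb t (kernel t p)"
    and continuous_G: "continuous_on {0..T} (G f)"
proof -
  have "rep_l2 f \<in> L2_controls T" by (rule rep_in_L2_controls)
  then obtain x where x: "continuous_on {0..T} x"
    "\<And>t. t \<in> {0..T} \<Longrightarrow> pivot DA A (x t) = input_map DA A S B (rep_l2 f) t"
    using adm T unfolding admissible_def by blast
  have x_eq: "x t \<bullet> R' p = f \<bullet> emb t (kernel t p)" if "t \<in> {0..T}" for t p
  proof -
    have "x t \<bullet> R' p = input_map DA A S B (rep_l2 f) t (R' p)"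
      using fun_cong[OF x(2)[OF that], of "R' p"] by (simp add: pivot_def)
    then show ?thesis
      using that by (simp add: input_map_eq rep_in_L2_controls inner_emb_rep kernel_L2)
  qed
  have G: "G f t \<bullet> R' p = f \<bullet> emb t (kernel t p)" if "t \<in> {0..T}" for t p
  proof -
    have "\<exists>h. \<forall>p. h \<bullet> R' p = f \<bullet> emb t (kernel t p)" using x_eq[OF that] by blast
    then have "\<forall>p. G f t \<bullet> R' p = f \<bullet> emb t (kernel t p)" unfolding G_def by (rule someI_ex)
    then show ?thesis by blast
  qed
  then show "t \<in> {0..T} \<Longrightarrow> G f t \<bullet> R' p = f \<bullet> emb t (kernel t p)" .
  have "G f t = x t" if "t \<in> {0..T}" for t
    by (rule inner_range_eqI) (simp add: G[OF that] x_eq[OF that])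
  then show "continuous_on {0..T} (G f)"
    by (intro continuous_on_eq[OF x(1)]) simp
qed

lemma input_map_G:
  assumes "u \<in> L2_controls T" "t \<in> {0..T}"
  shows "input_map DA A S B u t (R' p) = G (emb T u) t \<bullet> R' p"
  using assms by (simp add: input_map_eq G_R')

lemma linear_G:
  assumes t: "t \<in> {0..T}"
  shows "linear (\<lambda>f. G f t)"
proof (rule linearI)
  show "G (f + g) t = G f t + G g t" for f g
    by (rule inner_range_eqI) (simp add: inner_add_left G_R'[OF t])
  show "G (r *\<^sub>R f) t = r *\<^sub>R G f t" for r f
    by (rule inner_range_eqI) (simp add: G_R'[OF t])
qed

text \<open>The functionals \<open>f \<mapsto> G f t \<bullet> R' p\<close> are inner products with elements of \<open>'u l2\<close>, hence bounded,
  and admissibility bounds them pointwise after division by \<open>norm (R' p)\<close>. So uniform boundedness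
  applies although nothing is known in advance about the continuity of \<open>G\<close>.\<close>

lemma bounded_G: "\<exists>c>0. \<forall>f. \<forall>t\<in>{0..T}. norm (G f t) \<le> c * norm f"
proof -
  define F where "F = (\<lambda>(t, p) f. (f \<bullet> emb t (kernel t p)) / norm (R' p)) ` ({0..T} \<times> UNIV)"
  have lin: "bounded_linear l" if "l \<in> F" for l
    using that unfolding F_def
    by (auto intro!: bounded_linear_divide bounded_linear_compose[OF bounded_linear_divide bounded_linear_inner_left])
  have pt: "\<exists>K. \<forall>l\<in>F. norm (l f) \<le> K" for f
  proof -
    have "bounded (G f ` {0..T})"
      by (intro compact_imp_bounded compact_continuous_image continuous_G) simp
    then obtain K where K: "\<And>t. t \<in> {0..T} \<Longrightarrow> norm (G f t) \<le> K" unfolding bounded_iff by blast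
    have "\<bar>(f \<bullet> emb t (kernel t p)) / norm (R' p)\<bar> \<le> K" if t: "t \<in> {0..T}" for t p
    proof (cases "R' p = 0")
      \<comment> \<open>Division by zero gives 0, so only 0 <= K is at stake.\<close>
      case True
      then show ?thesis using order_trans[OF norm_ge_zero K[OF t]] by simp
    next
      case False
      have "\<bar>f \<bullet> emb t (kernel t p)\<bar> \<le> norm (G f t) * norm (R' p)"
        unfolding G_R'[OF t, symmetric] by (rule Cauchy_Schwarz_ineq2)
      also have "\<dots> \<le> K * norm (R' p)" by (intro mult_right_mono K t) simp
      finally show ?thesis using False by (simp add: field_simps abs_divide)
    qed
    then show ?thesis unfolding F_def by (intro exI[of _ K]) auto
  qed
  obtain K where K: "0 < K" "\<And>l f. l \<in> F \<Longrightarrow> norm (l f) \<le> K * norm f"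
    using uniform_boundedness[OF lin pt] by metis
  have "norm (G f t) \<le> K * norm f" if t: "t \<in> {0..T}" for f t
  proof -
    have "\<bar>G f t \<bullet> R' p\<bar> \<le> K * norm f * norm (R' p)" for p
    proof (cases "R' p = 0")
      case False
      have "(\<lambda>f. (f \<bullet> emb t (kernel t p)) / norm (R' p)) \<in> F" unfolding F_def using t by force
      from K(2)[OF this, of f] show ?thesis using False by (simp add: G_R'[OF t] field_simps abs_divide)
    qed simp
    then have sub: "range R' \<subseteq> {y. \<bar>G f t \<bullet> y\<bar> \<le> K * norm f * norm y}" by auto
    have "closed {y. \<bar>G f t \<bullet> y\<bar> \<le> K * norm f * norm y}"
      by (intro closed_Collect_le continuous_intros)
    \<comment> \<open>Density extends the bound to every y, in particular to y =
      \<open>G f t\<close>.\<close>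
    from closure_minimal[OF sub this] have "\<bar>G f t \<bullet> G f t\<bar> \<le> K * norm f * norm (G f t)"
      unfolding range_R'_dense by blast
    then have "norm (G f t) * norm (G f t) \<le> (K * norm f) * norm (G f t)"
      by (simp flip: power2_norm_eq_inner add: power2_eq_square)
    then show ?thesis using K(1) by (cases "norm (G f t) = 0") auto
  qed
  with K(1) show ?thesis by blast
qed

section \<open>States of the original system and of its Yosida approximations\<close>

lemma state_eqI:
  assumes "\<And>p. input_map DA A S B0 u t (R' p) = x \<bullet> R' p"
  shows "state DA A S B0 \<xi> u t = S t \<xi> + x"
  unfolding state_def
proof (rule the_equality)
  show eq: "pivot DA A (S t \<xi> + x) = (\<lambda>\<phi>\<in>adj_dom DA A. pivot DA A (S t \<xi>) \<phi> + input_map DA A S B0 u t \<phi>)"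
  proof
    fix y
    show "pivot DA A (S t \<xi> + x) y = (\<lambda>\<phi>\<in>adj_dom DA A. pivot DA A (S t \<xi>) \<phi> + input_map DA A S B0 u t \<phi>) y"
      by (cases "y \<in> adj_dom DA A") (auto simp: pivot_def inner_add_left adj_dom_eq assms)
  qed
  show "h = S t \<xi> + x" if "pivot DA A h = (\<lambda>\<phi>\<in>adj_dom DA A. pivot DA A (S t \<xi>) \<phi> + input_map DA A S B0 u t \<phi>)" for h
    by (rule pivot_inject) (simp add: that eq)
qed

lemma state_B:
  assumes "u \<in> L2_controls T" "t \<in> {0..T}"
  shows "state DA A S B \<xi> u t = S t \<xi> + G (emb T u) t"
  by (rule state_eqI) (rule input_map_G[OF assms])

lemma yosida_eq: "yosida S k x = J (real k) x"
  by (simp add: yosida_def resolvent_def)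

text \<open>Hilbert's resolvent equation for k and k0, multiplied by k. It writes values of
  \<open>J k\<close> as values of \<open>R\<close>.\<close>

lemma resolvent_identity:
  assumes k: "w < k"
  shows "J k x = k *\<^sub>R R x + (k0 - k) *\<^sub>R R (J k x)"
proof -
  interpret R: bounded_linear R by (rule bl_R)
  have "R (J k x) - R x = k0 *\<^sub>R R (resolvent k x) - resolvent k x"
    using R_J_diff[OF k, of x] by (simp only: R.diff)
  then have "k *\<^sub>R (R (J k x) - R x) = k *\<^sub>R (k0 *\<^sub>R R (resolvent k x) - resolvent k x)" by simp
  then show ?thesis by (simp add: R.scaleR algebra_simps)
qed

text \<open>Formally \<open>J\<^sub>k B = J\<^sub>k (k0 - A) b\<close> with \<open>J\<^sub>k A = k (J\<^sub>k - id)\<close>.\<close>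

lemma yosida_control_eq:
  assumes k: "w < real k"
  shows "yosida_control S B k v = real k *\<^sub>R b v + (k0 - real k) *\<^sub>R J (real k) (b v)"
proof -
  note bl_J = bounded_linear_J[OF k]
  have y: "yosida S k = J (real k)" by (rule ext) (rule yosida_eq)
  define h where "h = real k *\<^sub>R b v + (k0 - real k) *\<^sub>R J (real k) (b v)"
  \<comment> \<open>\<open>B v\<close> is known through its values on the range of
    \<open>R'\<close>, so a preimage is needed.\<close>
  have adj: "adjoint (J (real k)) p = R' (real k *\<^sub>R p + (k0 - real k) *\<^sub>R adjoint (J (real k)) p)" for p
  proof (rule adjoint_eqI[OF bl_J])
    fix x
    have RJ: "R (J (real k) x) = J (real k) (R x)"
      using bounded_linear.linear[OF bl_R] by (simp add: linear_scale resolvent_resolvent[OF k k0])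
    have "J (real k) x \<bullet> p = real k * (R x \<bullet> p) + (k0 - real k) * (J (real k) (R x) \<bullet> p)"
      by (subst resolvent_identity[OF k]) (simp only: RJ inner_add_left inner_scaleR_left)
    also have "\<dots> = R x \<bullet> (real k *\<^sub>R p + (k0 - real k) *\<^sub>R adjoint (J (real k)) p)"
      by (simp only: inner_adjoint[OF bl_J] inner_add_right inner_scaleR_right)
    finally show "J (real k) x \<bullet> p = x \<bullet> R' (real k *\<^sub>R p + (k0 - real k) *\<^sub>R adjoint (J (real k)) p)"
      by (simp only: inner_R)
  qed
  have h: "h \<bullet> p = B v (adjoint (yosida S k) p)" for p
  proof -
    have "B v (adjoint (yosida S k) p) = b v \<bullet> (real k *\<^sub>R p + (k0 - real k) *\<^sub>R adjoint (J (real k)) p)"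
      unfolding y by (subst adj) (rule B_R')
    also have "\<dots> = h \<bullet> p"
      unfolding h_def by (simp add: inner_add_right inner_add_left flip: inner_adjoint[OF bl_J])
    finally show ?thesis by simp
  qed
  have "h' = h" if "\<forall>p. h' \<bullet> p = B v (adjoint (yosida S k) p)" for h'
  proof -
    have "h' \<bullet> p = h \<bullet> p" for p using that h by simp
    then show ?thesis by (metis vector_eq_rdot)
  qed
  then have "yosida_ext S k (B v) = h"
    unfolding yosida_ext_def using h by (intro the_equality) auto
  then show ?thesis by (simp add: yosida_control_def h_def)
qed

text \<open>Formally \<open>R\<close> cancels k0 - A in J_k (k0 - A) b; only bounded operators
  remain.\<close>

lemma R_yosida_control:
  assumes k: "w < real k"
  shows "R (yosida_control S B k v) = J (real k) (b v)"
proof -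
  interpret R: bounded_linear R by (rule bl_R)
  show ?thesis
    unfolding yosida_control_eq[OF k] R.add R.scaleR
    using resolvent_identity[OF k, of "b v"] by (simp add: R.scaleR)
qed

text \<open>The factor \<open>J k\<close> is moved to the test element: testing with
  \<open>R' p\<close> becomes testing the original input with \<open>R' ?q\<close>.\<close>

lemma input_map_yosida:
  assumes k: "w < real k" and u: "u \<in> L2_controls T" and t: "t \<in> {0..T}"
  shows "input_map DA A S (yosida_control_dual DA A S B k) u t (R' p) = J (real k) (G (emb T u) t) \<bullet> R' p"
proof -
  note bl_J = bounded_linear_J[OF k]
  let ?q = "adjoint (J (real k)) p"
  have "input_map DA A S (yosida_control_dual DA A S B k) u t (R' p) =
      (LINT s|lebesgue_on {0<..<t}. semigroup_ext DA A S (t - s) (yosida_control_dual DA A S B k (u s)) (R' p))"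
    by (simp add: input_map_def)
  also have "\<dots> = (LINT s|lebesgue_on {0<..<t}. semigroup_ext DA A S (t - s) (B (u s)) (R' ?q))"
  proof (rule Bochner_Integration.integral_cong[OF refl])
    fix s assume "s \<in> space (lebesgue_on {0<..<t})"
    then have ts: "0 \<le> t - s" by simp
    have "semigroup_ext DA A S (t - s) (yosida_control_dual DA A S B k (u s)) (R' p) =
        yosida_control S B k (u s) \<bullet> R' (S' (t - s) p)"
      by (simp add: semigroup_ext_def yosida_control_dual_def pivot_def adjoint_S_R'[OF ts] S'_apply)
    also have "\<dots> = J (real k) (b (u s)) \<bullet> S' (t - s) p"
      by (simp add: R_yosida_control[OF k] flip: inner_R)
    also have "\<dots> = J (real k) (S (t - s) (b (u s))) \<bullet> p"
      by (simp add: S_resolvent[OF k ts] blinfun.scaleR_right flip: inner_S')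
    also have "\<dots> = b (u s) \<bullet> S' (t - s) ?q"
      by (simp only: inner_adjoint[OF bl_J] inner_S')
    also have "\<dots> = semigroup_ext DA A S (t - s) (B (u s)) (R' ?q)"
      by (simp add: semigroup_ext_def adjoint_S_R'[OF ts] B_R' S'_apply)
    finally show "semigroup_ext DA A S (t - s) (yosida_control_dual DA A S B k (u s)) (R' p) =
        semigroup_ext DA A S (t - s) (B (u s)) (R' ?q)" .
  qed
  also have "\<dots> = input_map DA A S B u t (R' ?q)" by (simp add: input_map_def)
  also have "\<dots> = R (G (emb T u) t) \<bullet> ?q" by (simp add: input_map_G[OF u t] inner_R)
  also have "\<dots> = J (real k) (R (G (emb T u) t)) \<bullet> p" by (rule inner_adjoint[OF bl_J, symmetric])
  also have "J (real k) (R (G (emb T u) t)) = R (J (real k) (G (emb T u) t))"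
    using bounded_linear.linear[OF bl_R] by (simp add: linear_scale resolvent_resolvent[OF k k0])
  also have "\<dots> \<bullet> p = J (real k) (G (emb T u) t) \<bullet> R' p" by (rule inner_R)
  finally show ?thesis .
qed

lemma state_yosida:
  assumes "w < real k" "u \<in> L2_controls T" "t \<in> {0..T}"
  shows "state DA A S (yosida_control_dual DA A S B k) \<xi> u t = S t \<xi> + J (real k) (G (emb T u) t)"
  by (rule state_eqI) (rule input_map_yosida[OF assms])

end

section \<open>The linear quadratic problem\<close>

locale lq_problem = control_system S M w DA A k0 B T
  for S :: "real \<Rightarrow> ('h::{real_inner, banach} \<Rightarrow>\<^sub>L 'h)" and M w DA A k0
    and B :: "'u::{real_inner, banach} \<Rightarrow> 'h \<Rightarrow> real" and T +
  fixes C P0 :: "'h \<Rightarrow>\<^sub>L 'h" and z \<xi> :: 'h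
  assumes P0_sym: "\<And>x y. P0 x \<bullet> y = x \<bullet> P0 y" and P0_nonneg: "\<And>x. 0 \<le> P0 x \<bullet> x"
begin

lemma free_cont: "continuous_on {0..T} (\<lambda>t. S t \<xi>)"
  by (rule continuous_on_subset[OF continuous_on_orbit]) auto

text \<open>A control system whose solutions are \<open>S t \<xi> + Gx u t\<close>: this covers both the original
  system and its Yosida approximations.\<close>

definition realizes :: "('u l2 \<Rightarrow> real \<Rightarrow> 'h) \<Rightarrow> real \<Rightarrow> ('u \<Rightarrow> 'h \<Rightarrow> real) \<Rightarrow> bool" where
  "realizes Gx c B0 \<longleftrightarrow> quadratic_control Gx (\<lambda>t. S t \<xi>) P0 T c \<and>
     (\<forall>u\<in>L2_controls T. \<forall>t\<in>{0..T}. state DA A S B0 \<xi> u t = S t \<xi> + Gx (emb T u) t) \<and>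
     (\<forall>f. \<forall>t\<in>{0..T}. Gx (emb T (rep_l2 f)) t = Gx f t)"

abbreviation Phi :: "('u l2 \<Rightarrow> real \<Rightarrow> 'h) \<Rightarrow> 'u l2 \<Rightarrow> real" where
  "Phi Gx \<equiv> quadratic_control.functional Gx (\<lambda>t. S t \<xi>) C P0 z T"

lemma G_emb_rep: "t \<in> {0..T} \<Longrightarrow> G (emb T (rep_l2 f)) t = G f t"
  by (rule inner_range_eqI) (simp add: G_R' inner_emb_rep kernel_L2)

lemma realizes_B:
  assumes c: "0 < c" "\<And>f t. t \<in> {0..T} \<Longrightarrow> norm (G f t) \<le> c * norm f"
  shows "realizes G c B"
proof -
  have "quadratic_control G (\<lambda>t. S t \<xi>) P0 T c"
    unfolding quadratic_control_def
    by (intro conjI allI impI T P0_sym P0_nonneg linear_G continuous_G free_cont c less_imp_le[OF c(1)])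
  then show ?thesis by (simp add: realizes_def state_B G_emb_rep)
qed

lemma realizes_yosida:
  assumes c: "0 < c" "\<And>f t. t \<in> {0..T} \<Longrightarrow> norm (G f t) \<le> c * norm f"
    and k: "2 * w < real k" "0 < real k" "w < real k"
  shows "realizes (\<lambda>f t. J (real k) (G f t)) (2 * M * c) (yosida_control_dual DA A S B k)"
proof -
  have "quadratic_control (\<lambda>f t. J (real k) (G f t)) (\<lambda>t. S t \<xi>) P0 T (2 * M * c)"
    unfolding quadratic_control_def
  proof (intro conjI allI impI)
    show "linear (\<lambda>f. J (real k) (G f t))" if "t \<in> {0..T}" for t
      using linear_compose[OF linear_G[OF that] bounded_linear.linear[OF bounded_linear_J[OF k(3)]]] by (simp add: o_def)
    show "continuous_on {0..T} (\<lambda>t. J (real k) (G f t))" for f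
      by (rule bounded_linear.continuous_on[OF bounded_linear_J[OF k(3)] continuous_G])
    show "norm (J (real k) (G f t)) \<le> 2 * M * c * norm f" if "t \<in> {0..T}" for f t
    proof -
      have "norm (J (real k) (G f t)) \<le> 2 * M * norm (G f t)" by (rule norm_J_le[OF k(1,2)])
      also have "\<dots> \<le> 2 * M * (c * norm f)" using M by (intro mult_left_mono c(2) that) simp
      finally show ?thesis by (simp add: mult.assoc)
    qed
  qed (use c M T P0_sym P0_nonneg free_cont in auto)
  then show ?thesis by (simp add: realizes_def state_yosida[OF k(3)] G_emb_rep)
qed

context
  fixes Gx c B0
  assumes real: "realizes Gx c B0"
begin

interpretation Q: quadratic_control Gx "\<lambda>t. S t \<xi>" C P0 z T c
  using real by (simp add: realizes_def)

lemma state_realized: "u \<in> L2_controls T \<Longrightarrow> t \<in> {0..T} \<Longrightarrow> state DA A S B0 \<xi> u t = Q.traj (emb T u) t"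
  using real by (simp add: realizes_def Q.traj_def)

lemma continuous_state: "u \<in> L2_controls T \<Longrightarrow> continuous_on {0..T} (state DA A S B0 \<xi> u)"
  by (rule continuous_on_eq[OF Q.traj_cont]) (simp add: state_realized)

lemma cost_eq:
  assumes u: "u \<in> L2_controls T"
  shows "cost DA A S B0 C P0 z T \<xi> u = Q.functional (emb T u)"
proof -
  have cont: "continuous_on {0..T} (\<lambda>t. (norm (C (Q.traj (emb T u) t) - z))\<^sup>2)"
    by (intro Q.cont_intros)
  have "(LINT t|lebesgue_on {0<..<T}. (norm (C (state DA A S B0 \<xi> u t) - z))\<^sup>2 + (norm (u t))\<^sup>2) =
      (LINT t|lebesgue_on {0<..<T}. (norm (C (Q.traj (emb T u) t) - z))\<^sup>2 + (norm (u t))\<^sup>2)"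
    by (rule Bochner_Integration.integral_cong) (simp_all add: state_realized[OF u])
  also have "\<dots> = integral {0..T} (\<lambda>t. (norm (C (Q.traj (emb T u) t) - z))\<^sup>2) + (norm (emb T u))\<^sup>2"
    unfolding LINT_open_interval[OF cont, symmetric] norm_emb[OF u]
    by (rule Bochner_Integration.integral_add[OF integrable_open_interval[OF cont]])
      (use u in \<open>simp add: L2_controls_def\<close>)
  finally show ?thesis
    by (simp add: cost_def Q.functional_def state_realized[OF u Q.T_mem])
qed

lemma cost_state:
  assumes u: "u \<in> L2_controls T"
  shows "cost DA A S B0 C P0 z T \<xi> u = (norm (emb T u))\<^sup>2 +
    (integral {0..T} (\<lambda>t. (norm (C (state DA A S B0 \<xi> u t) - z))\<^sup>2) +
     P0 (state DA A S B0 \<xi> u T) \<bullet> state DA A S B0 \<xi> u T)"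
proof -
  have "integral {0..T} (\<lambda>t. (norm (C (state DA A S B0 \<xi> u t) - z))\<^sup>2) =
      integral {0..T} (\<lambda>t. (norm (C (Q.traj (emb T u) t) - z))\<^sup>2)"
    by (rule integral_cong) (simp add: state_realized[OF u])
  then show ?thesis
    by (simp add: cost_eq[OF u] Q.functional_def state_realized[OF u Q.T_mem])
qed

text \<open>Cutting a class off outside {0<..<T} keeps the trajectory and does not increase the
  norm. Hence minimizing over all classes on the line amounts to minimizing over controls on the
  interval.\<close>

lemma functional_emb_rep: "Q.functional (emb T (rep_l2 f)) \<le> Q.functional f"
proof -
  have traj: "Q.traj (emb T (rep_l2 f)) t = Q.traj f t" if "t \<in> {0..T}" for t
    using real that by (simp add: realizes_def Q.traj_def)
  have "integral {0..T} (\<lambda>t. (norm (C (Q.traj (emb T (rep_l2 f)) t) - z))\<^sup>2) =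
      integral {0..T} (\<lambda>t. (norm (C (Q.traj f t) - z))\<^sup>2)"
    by (rule integral_cong) (simp add: traj)
  then show ?thesis
    unfolding Q.functional_def traj[OF Q.T_mem] using norm_emb_rep_le[of T f] by simp
qed

lemma optimal_control_iff:
  "optimal_control DA A S B0 C P0 z T \<xi> u \<longleftrightarrow>
     u \<in> L2_controls T \<and> (\<forall>g. Q.functional (emb T u) \<le> Q.functional g)"
proof
  assume opt: "optimal_control DA A S B0 C P0 z T \<xi> u"
  then have u: "u \<in> L2_controls T" by (simp add: optimal_control_def)
  have "Q.functional (emb T u) \<le> Q.functional g" for g
  proof -
    have "cost DA A S B0 C P0 z T \<xi> u \<le> cost DA A S B0 C P0 z T \<xi> (rep_l2 g)"
      using opt rep_in_L2_controls unfolding optimal_control_def by blast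
    then show ?thesis
      using functional_emb_rep[of g] by (simp add: cost_eq[OF u] cost_eq[OF rep_in_L2_controls])
  qed
  with u show "u \<in> L2_controls T \<and> (\<forall>g. Q.functional (emb T u) \<le> Q.functional g)" by blast
next
  assume "u \<in> L2_controls T \<and> (\<forall>g. Q.functional (emb T u) \<le> Q.functional g)"
  then show "optimal_control DA A S B0 C P0 z T \<xi> u" by (simp add: optimal_control_def cost_eq)
qed

lemma optimal_control_exists: "\<exists>u. optimal_control DA A S B0 C P0 z T \<xi> u"
proof -
  obtain f where f: "\<And>g. Q.functional f \<le> Q.functional g" using Q.minimizer_exists by blast
  have "Q.functional (emb T (rep_l2 f)) \<le> Q.functional g" for g
    using functional_emb_rep[of f] f[of g] by linarith
  then show ?thesis using optimal_control_iff rep_in_L2_controls by blast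
qed

end

lemma INF_cost_eq:
  assumes "optimal_control DA A S B0 C P0 z T \<xi> u"
  shows "(INF v\<in>L2_controls T. cost DA A S B0 C P0 z T \<xi> v) = cost DA A S B0 C P0 z T \<xi> u"
  using assms unfolding optimal_control_def by (intro cInf_eq_minimum) auto

lemma converges_L2_emb:
  assumes fk: "\<forall>\<^sub>F k in sequentially. u k \<in> L2_controls T" and f: "v \<in> L2_controls T"
    and lim: "(\<lambda>k. emb T (u k)) \<longlonglongrightarrow> emb T v"
  shows "converges_L2 T u v"
proof -
  have "\<forall>\<^sub>F k in sequentially. norm (emb T (u k) - emb T v) = sqrt (LINT t|lebesgue_on {0<..<T}. (norm (u k t - v t))\<^sup>2)"
    using fk
  proof eventually_elim
    case (elim k)
    then show ?case
      using norm_emb[OF L2_controls_diff[OF elim f]] by (simp add: emb_diff[OF elim f] real_sqrt_unique)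
  qed
  moreover have "(\<lambda>k. norm (emb T (u k) - emb T v)) \<longlonglongrightarrow> 0"
    using lim by (intro tendsto_norm_zero LIM_zero)
  ultimately have "(\<lambda>k. sqrt (LINT t|lebesgue_on {0<..<T}. (norm (u k t - v t))\<^sup>2)) \<longlonglongrightarrow> 0"
    by (rule Lim_transform_eventually[rotated])
  with fk f show ?thesis by (simp add: converges_L2_def)
qed

text \<open>The constant \<open>K\<close> depends neither on k nor on the tolerance, so in
  \<open>minimizer_stability\<close> any tolerance may be used for all large k.\<close>

lemma minimizers_converge:
  assumes c: "0 < c" "\<And>f t. t \<in> {0..T} \<Longrightarrow> norm (G f t) \<le> c * norm f"
    and f: "\<And>g. Phi G f \<le> Phi G g"
    and fk: "\<forall>\<^sub>F k in sequentially. \<forall>g. Phi (\<lambda>f t. J (real k) (G f t)) (fk k) \<le> Phi (\<lambda>f t. J (real k) (G f t)) g"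
  shows "fk \<longlonglongrightarrow> f"
    and "uniform_limit {0..T} (\<lambda>k t. S t \<xi> + J (real k) (G (fk k) t)) (\<lambda>t. S t \<xi> + G f t) sequentially"
proof -
  define K where "K = (T * (norm C)\<^sup>2 + norm P0) / 2 + ((T + 1) * c)\<^sup>2"
  have K: "0 \<le> K" using T unfolding K_def by (intro add_nonneg_nonneg divide_nonneg_nonneg mult_nonneg_nonneg) auto
  have Q: "quadratic_control G (\<lambda>t. S t \<xi>) P0 T c" using realizes_B[OF c] by (simp add: realizes_def)
  define q where "q t = adjoint C (C (S t \<xi> + G f t) - z)" for t
  have bC: "bounded_linear (adjoint C)" by (rule bounded_linear_adjoint[OF blinfun.bounded_linear_right])
  have q_cont: "continuous_on {0..T} q"
    unfolding q_def
    by (intro bounded_linear.continuous_on[OF bC] bounded_linear.continuous_on[OF blinfun.bounded_linear_right]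
        continuous_intros free_cont continuous_G)
  have small: "\<forall>\<^sub>F k in sequentially. (norm (fk k - f))\<^sup>2 \<le> K * \<epsilon>\<^sup>2 \<and> (\<forall>t\<in>{0..T}. norm (J (real k) (G f t) - G f t) < \<epsilon>)"
    if \<epsilon>: "0 < \<epsilon>" for \<epsilon>
  proof -
    have 1: "\<forall>\<^sub>F k in sequentially. \<forall>x\<in>G f ` {0..T}. norm (J (real k) x - x) < \<epsilon>"
      by (rule strong_null_uniform_on_compact[OF eventually_linear_J_diff eventually_norm_J_diff_le J_diff_tendsto _ \<epsilon>])
        (intro compact_continuous_image continuous_G compact_Icc)
    have 2: "\<forall>\<^sub>F k in sequentially. \<forall>x\<in>insert (P0 (S T \<xi> + G f T)) (q ` {0..T}). norm (adjoint (J (real k)) x - x) < \<epsilon>"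
      by (rule strong_null_uniform_on_compact[OF eventually_linear_adjoint_J_diff eventually_norm_adjoint_J_diff_le adjoint_J_diff_tendsto _ \<epsilon>])
        (intro compact_insert compact_continuous_image q_cont compact_Icc)
    from 1 2 fk eventually_large show ?thesis
    proof eventually_elim
      case (elim k)
      have Qk: "quadratic_control (\<lambda>f t. J (real k) (G f t)) (\<lambda>t. S t \<xi>) P0 T (2 * M * c)"
        using realizes_yosida[OF c, of k] elim(4) by (simp add: realizes_def)
      have "(norm (fk k - f))\<^sup>2 \<le> K * \<epsilon>\<^sup>2"
        unfolding K_def
      proof (rule minimizer_stability[OF Q Qk])
        show "bounded_linear (J (real k))" using elim(4) by (intro bounded_linear_J) simp
        show "norm (J (real k) (G f t) - G f t) \<le> \<epsilon>" if "t \<in> {0..T}" for t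
          using elim(1) that by (auto intro: less_imp_le)
        show "norm (adjoint (J (real k)) (adjoint C (C (S t \<xi> + G f t) - z)) - adjoint C (C (S t \<xi> + G f t) - z)) \<le> \<epsilon>"
          if "t \<in> {0..T}" for t
          using elim(2) that unfolding q_def[symmetric] by (auto intro: less_imp_le)
        show "norm (adjoint (J (real k)) (P0 (S T \<xi> + G f T)) - P0 (S T \<xi> + G f T)) \<le> \<epsilon>"
          using elim(2) by (auto intro: less_imp_le)
      qed (use f elim(3) in auto)
      with elim(1) show ?case by auto
    qed
  qed
  have conv: "\<forall>\<^sub>F k in sequentially. norm (fk k - f) < e" if e: "0 < e" for e
  proof -
    \<comment> \<open>With this tolerance the bound stays below e^2, because K < (K + 1)^2; this
      includes K = 0.\<close>
    have \<epsilon>: "0 < e / (K + 1)" using e K by simp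
    have "K * (e / (K + 1))\<^sup>2 < e\<^sup>2"
    proof -
      have "K < (K + 1)\<^sup>2" using K mult_nonneg_nonneg[OF K K] unfolding power2_eq_square ring_distribs by linarith
      then have "K / (K + 1)\<^sup>2 < 1" using K by simp
      then have "e\<^sup>2 * (K / (K + 1)\<^sup>2) < e\<^sup>2 * 1" using e by (intro mult_strict_left_mono) auto
      then show ?thesis by (simp add: power_divide mult.commute)
    qed
    with small[OF \<epsilon>] show ?thesis
      by (auto elim!: eventually_mono intro!: power_less_imp_less_base[of _ 2 e] less_imp_le[OF e])
  qed
  show lim: "fk \<longlonglongrightarrow> f"
    by (rule tendstoI) (simp add: dist_norm conv)
  show "uniform_limit {0..T} (\<lambda>k t. S t \<xi> + J (real k) (G (fk k) t)) (\<lambda>t. S t \<xi> + G f t) sequentially"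
  proof (rule uniform_limitI)
    fix e :: real assume e: "0 < e"
    \<comment> \<open>Half of \<open>e\<close> goes to the control error, amplified by at most 2 M
      c; the other half to J_k - id along \<open>G f\<close>.\<close>
    define d where "d = e / (2 * (2 * M * c))"
    have Mc: "0 < 2 * M * c" using M c by simp
    then have d: "0 < d" using e by (simp add: d_def)
    have "0 < e / 2" using e by simp
    from small[OF this] conv[OF d] eventually_large
    show "\<forall>\<^sub>F k in sequentially. \<forall>t\<in>{0..T}. dist (S t \<xi> + J (real k) (G (fk k) t)) (S t \<xi> + G f t) < e"
    proof eventually_elim
      case (elim k)
      show ?case
      proof
        fix t assume t: "t \<in> {0..T}"
        have lin: "linear (J (real k))" using elim(3) by (intro bounded_linear.linear bounded_linear_J) simp
        have "norm (J (real k) (G (fk k - f) t)) \<le> 2 * M * norm (G (fk k - f) t)"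
          using elim(3) by (intro norm_J_le) auto
        also have "\<dots> \<le> 2 * M * (c * norm (fk k - f))" using M by (intro mult_left_mono c(2) t) simp
        also have "\<dots> = (2 * M * c) * norm (fk k - f)" by simp
        also have "\<dots> < (2 * M * c) * d" using elim(2) Mc by (rule mult_strict_left_mono)
        also have "\<dots> = e / 2" using M c by (simp add: d_def)
        finally have 1: "norm (J (real k) (G (fk k - f) t)) < e / 2" .
        have 2: "norm (J (real k) (G f t) - G f t) < e / 2" using elim(1) t by blast
        have "J (real k) (G (fk k - f) t) = J (real k) (G (fk k) t) - J (real k) (G f t)"
          using linear_diff[OF linear_G[OF t], of "fk k" f] linear_diff[OF lin] by simp
        then have "(S t \<xi> + J (real k) (G (fk k) t)) - (S t \<xi> + G f t) =
            J (real k) (G (fk k - f) t) + (J (real k) (G f t) - G f t)"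
          by simp
        then have "dist (S t \<xi> + J (real k) (G (fk k) t)) (S t \<xi> + G f t) =
            norm (J (real k) (G (fk k - f) t) + (J (real k) (G f t) - G f t))"
          by (simp only: dist_norm)
        then show "dist (S t \<xi> + J (real k) (G (fk k) t)) (S t \<xi> + G f t) < e"
          using norm_triangle_ineq[of "J (real k) (G (fk k - f) t)" "J (real k) (G f t) - G f t"] 1 2 by linarith
      qed
    qed
  qed
qed

subsection \<open>The adjoint state\<close>

lemma adjoint_state_eq:
  "adjoint_state S C P0 z T x t =
     S' (T - t) (P0 (x T)) + integral {t..T} (\<lambda>s. S' (s - t) (adjoint C (C (x s) - z)))"
  by (simp add: adjoint_state_def S'_apply)

lemma continuous_adjoint_source:
  assumes x: "continuous_on {0..T} x"
  shows "continuous_on {0..T} (\<lambda>s. adjoint C (C (x s) - z))"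
  by (intro bounded_linear.continuous_on[OF bounded_linear_adjoint[OF blinfun.bounded_linear_right]]
      bounded_linear.continuous_on[OF blinfun.bounded_linear_right] continuous_intros x)

text \<open>Extending the integrand by \<open>S' 0 = id\<close> to \<open>s < t\<close> makes it jointly continuous, so that
  the integral over \<open>{t..T}\<close> is a continuous parameter integral over \<open>{0..T}\<close> minus an
  indefinite integral.\<close>

lemma continuous_adjoint_state:
  assumes x: "continuous_on {0..T} x"
  shows "continuous_on {0..T} (adjoint_state S C P0 z T x)"
proof -
  interpret S': strongly_continuous_semigroup S' by (rule adj_semigroup)
  define g where "g s = adjoint C (C (x s) - z)" for s
  have g: "continuous_on {0..T} g" unfolding g_def by (rule continuous_adjoint_source[OF x])
  define F where "F t s = S' (max (s - t) 0) (g s)" for t s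
  have F: "continuous_on ({0..T} \<times> {0..T}) (\<lambda>(t, s). F t s)"
    unfolding F_def case_prod_unfold
    by (rule S'.continuous_on_S[where b = T])
      (auto intro!: continuous_intros continuous_on_compose2[OF g])
  have F1: "continuous_on {0..T} (F t)" if "t \<in> {0..T}" for t
    unfolding F_def
    by (rule S'.continuous_on_S[where b = T]) (use that in \<open>auto intro!: continuous_intros g\<close>)
  have "continuous_on {0..T} (\<lambda>t. integral (cbox 0 T) (F t))"
    by (rule integral_continuous_on_param) (use F in simp)
  moreover have "continuous_on {0..T} (\<lambda>t. integral {0..t} g)"
    by (rule indefinite_integral_continuous_1) (rule integrable_continuous_real[OF g])
  moreover have "continuous_on {0..T} (\<lambda>t. S' (T - t) (P0 (x T)))"
    by (rule S'.continuous_on_S[where b = T]) (auto intro!: continuous_intros)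
  ultimately have "continuous_on {0..T} (\<lambda>t. S' (T - t) (P0 (x T)) + (integral (cbox 0 T) (F t) - integral {0..t} g))"
    by (intro continuous_on_add continuous_on_diff)
  then show ?thesis
  proof (rule continuous_on_eq)
    fix t assume t: "t \<in> {0..T}"
    have "integral {0..t} (F t) + integral {t..T} (F t) = integral {0..T} (F t)"
      by (rule Henstock_Kurzweil_Integration.integral_combine)
        (use t integrable_continuous_real[OF F1[OF t]] in auto)
    moreover have "integral {0..t} (F t) = integral {0..t} g"
      by (rule integral_cong) (simp add: F_def)
    moreover have "integral {t..T} (F t) = integral {t..T} (\<lambda>s. S' (s - t) (g s))"
      by (rule integral_cong) (simp add: F_def)
    ultimately show "S' (T - t) (P0 (x T)) + (integral (cbox 0 T) (F t) - integral {0..t} g) = adjoint_state S C P0 z T x t"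
      unfolding adjoint_state_eq g_def[symmetric] by (simp add: algebra_simps)
  qed
qed

text \<open>The adjoint state is affine in the state, so \<open>z\<close> cancels in differences and
  linear estimates remain.\<close>

lemma adjoint_state_lipschitz:
  "\<exists>L>0. \<forall>x y. \<forall>d\<ge>0. continuous_on {0..T} x \<longrightarrow> continuous_on {0..T} y \<longrightarrow> (\<forall>t\<in>{0..T}. norm (x t - y t) \<le> d) \<longrightarrow>
     (\<forall>t\<in>{0..T}. norm (adjoint_state S C P0 z T x t - adjoint_state S C P0 z T y t) \<le> L * d)"
proof -
  interpret S': strongly_continuous_semigroup S' by (rule adj_semigroup)
  obtain N where N: "0 < N" "\<And>t v. t \<in> {0..T} \<Longrightarrow> norm (S' t v) \<le> N * norm v"
    using S'.S_bounded_on by blast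
  have nC: "norm (adjoint C v) \<le> norm C * norm v" for v
    by (rule norm_adjoint_le[OF blinfun.bounded_linear_right]) (auto simp: norm_blinfun)
  interpret C': bounded_linear "adjoint C" by (rule bounded_linear_adjoint[OF blinfun.bounded_linear_right])
  \<comment> \<open>Terminal and integral contributions; + 1 keeps \<open>L\<close> positive when
    \<open>P0\<close> and \<open>C\<close> vanish.\<close>
  define L where "L = N * norm P0 + N * (norm C * norm C) * T + 1"
  have L: "L > 0" using N T unfolding L_def by (intro add_nonneg_pos add_nonneg_nonneg mult_nonneg_nonneg) auto
  have "norm (adjoint_state S C P0 z T x t - adjoint_state S C P0 z T y t) \<le> L * d"
    if d: "0 \<le> d" and x: "continuous_on {0..T} x" and y: "continuous_on {0..T} y"
      and xy: "\<And>t. t \<in> {0..T} \<Longrightarrow> norm (x t - y t) \<le> d" and t: "t \<in> {0..T}" for x y d t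
  proof -
    define gx where "gx s = S' (s - t) (adjoint C (C (x s) - z))" for s
    define gy where "gy s = S' (s - t) (adjoint C (C (y s) - z))" for s
    have cont: "continuous_on {t..T} (\<lambda>s. S' (s - t) (adjoint C (C (v s) - z)))" if "continuous_on {0..T} v" for v
      by (rule S'.continuous_on_S[where b = T])
        (use t in \<open>auto intro!: continuous_intros continuous_on_subset[OF continuous_adjoint_source[OF that]]\<close>)
    have gx: "continuous_on {t..T} gx" unfolding gx_def by (rule cont[OF x])
    have gy: "continuous_on {t..T} gy" unfolding gy_def by (rule cont[OF y])
    have "norm (integral {t..T} (\<lambda>s. gx s - gy s)) \<le> (N * (norm C * norm C) * d) * (T - t)"
    proof (rule integral_bound)
      show "t \<le> T" using t by simp
      show "continuous_on {t..T} (\<lambda>s. gx s - gy s)" by (rule continuous_on_diff[OF gx gy])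
      fix s assume s: "s \<in> {t..T}"
      have "gx s - gy s = S' (s - t) (adjoint C (C (x s - y s)))"
        by (simp add: gx_def gy_def blinfun.diff_right C'.diff)
      then have "norm (gx s - gy s) \<le> N * norm (adjoint C (C (x s - y s)))"
        using N(2)[of "s - t"] s t by simp
      also have "norm (adjoint C (C (x s - y s))) \<le> norm C * norm (C (x s - y s))" by (rule nC)
      also have "norm (C (x s - y s)) \<le> norm C * norm (x s - y s)" by (rule norm_blinfun)
      also have "norm (x s - y s) \<le> d" by (rule xy) (use s t in auto)
      finally show "norm (gx s - gy s) \<le> N * (norm C * norm C) * d"
        using N(1) by (simp add: mult_left_mono mult.assoc)
    qed
    also have "\<dots> \<le> (N * (norm C * norm C) * d) * T"
      using N d t by (intro mult_left_mono mult_nonneg_nonneg) auto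
    finally have 1: "norm (integral {t..T} (\<lambda>s. gx s - gy s)) \<le> N * (norm C * norm C) * d * T" .
    have "norm (S' (T - t) (P0 (x T - y T))) \<le> N * norm (P0 (x T - y T))"
      using N(2)[of "T - t"] t by simp
    also have "\<dots> \<le> N * (norm P0 * d)"
    proof (rule mult_left_mono)
      have "norm (P0 (x T - y T)) \<le> norm P0 * norm (x T - y T)" by (rule norm_blinfun)
      also have "\<dots> \<le> norm P0 * d" using T by (intro mult_left_mono xy) auto
      finally show "norm (P0 (x T - y T)) \<le> norm P0 * d" .
    qed (use N in simp)
    finally have 2: "norm (S' (T - t) (P0 (x T - y T))) \<le> N * norm P0 * d" by (simp add: mult.assoc)
    have "integral {t..T} (\<lambda>s. gx s - gy s) = integral {t..T} gx - integral {t..T} gy"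
      by (intro Henstock_Kurzweil_Integration.integral_diff integrable_continuous_real gx gy)
    then have "adjoint_state S C P0 z T x t - adjoint_state S C P0 z T y t =
        S' (T - t) (P0 (x T - y T)) + integral {t..T} (\<lambda>s. gx s - gy s)"
      unfolding adjoint_state_eq gx_def gy_def by (simp add: blinfun.diff_right)
    then have "norm (adjoint_state S C P0 z T x t - adjoint_state S C P0 z T y t) \<le>
        N * norm P0 * d + N * (norm C * norm C) * d * T"
      using norm_triangle_ineq[of "S' (T - t) (P0 (x T - y T))" "integral {t..T} (\<lambda>s. gx s - gy s)"] 1 2 by simp
    also have "\<dots> \<le> L * d" using d by (simp add: L_def algebra_simps)
    finally show ?thesis .
  qed
  with L show ?thesis by blast
qed

lemma converges_C_adjoint_state:
  assumes xk: "\<forall>\<^sub>F k in sequentially. continuous_on {0..T} (xk k)" and x: "continuous_on {0..T} x"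
    and lim: "uniform_limit {0..T} xk x sequentially"
  shows "converges_C T (\<lambda>k. adjoint_state S C P0 z T (xk k)) (adjoint_state S C P0 z T x)"
  unfolding converges_C_def
proof (intro conjI)
  show "\<forall>\<^sub>F k in sequentially. continuous_on {0..T} (adjoint_state S C P0 z T (xk k))"
    using xk by eventually_elim (rule continuous_adjoint_state)
  show "continuous_on {0..T} (adjoint_state S C P0 z T x)" by (rule continuous_adjoint_state[OF x])
  obtain L where L: "0 < L" "\<And>x y d t. \<lbrakk>0 \<le> d; continuous_on {0..T} x; continuous_on {0..T} y;
      \<forall>t\<in>{0..T}. norm (x t - y t) \<le> d; t \<in> {0..T}\<rbrakk> \<Longrightarrow>
      norm (adjoint_state S C P0 z T x t - adjoint_state S C P0 z T y t) \<le> L * d"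
    using adjoint_state_lipschitz by blast
  show "uniform_limit {0..T} (\<lambda>k. adjoint_state S C P0 z T (xk k)) (adjoint_state S C P0 z T x) sequentially"
  proof (rule uniform_limitI)
    fix e :: real assume e: "0 < e"
    define d where "d = e / (2 * L)"
    have d: "0 < d" "L * d < e" using e L(1) by (simp_all add: d_def)
    from uniform_limitD[OF lim d(1)] xk
    show "\<forall>\<^sub>F k in sequentially. \<forall>t\<in>{0..T}. dist (adjoint_state S C P0 z T (xk k) t) (adjoint_state S C P0 z T x t) < e"
    proof eventually_elim
      case (elim k)
      have "\<forall>t\<in>{0..T}. norm (xk k t - x t) \<le> d" using elim(1) by (auto simp: dist_norm intro: less_imp_le)
      note le = L(2)[OF less_imp_le[OF d(1)] elim(2) x this]
      show ?case
        by (intro ballI) (rule le_less_trans[OF le[folded dist_norm] d(2)])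
    qed
  qed
qed

end

theorem lemma4p3:
  fixes DA :: "'h::{real_inner, banach} set"
    and A :: "'h \<Rightarrow> 'h"
    and S :: "real \<Rightarrow> ('h \<Rightarrow>\<^sub>L 'h)"
    and B :: "'u::{real_inner, banach} \<Rightarrow> 'h \<Rightarrow> real"
    and C P0 :: "'h \<Rightarrow>\<^sub>L 'h"
    and z \<xi> :: 'h
    and T :: real
  assumes "generates_semigroup DA A S"
    and "B \<in> control_operators DA A"
    and "admissible DA A S B"
    and "\<forall>x y. P0 x \<bullet> y = x \<bullet> P0 y"
    and "\<forall>x. 0 \<le> P0 x \<bullet> x"
    and "0 < T"
  shows
    "(\<lambda>k. INF u\<in>L2_controls T. cost DA A S (yosida_control_dual DA A S B k) C P0 z T \<xi> u)
       \<longlonglongrightarrow> (INF u\<in>L2_controls T. cost DA A S B C P0 z T \<xi> u) \<and>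
     (\<exists>u. optimal_control DA A S B C P0 z T \<xi> u) \<and>
     (\<forall>\<^sub>F k in sequentially.
        \<exists>u. optimal_control DA A S (yosida_control_dual DA A S B k) C P0 z T \<xi> u) \<and>
     (\<forall>(uopt_k :: nat \<Rightarrow> real \<Rightarrow> 'u) uopt.
        (\<forall>\<^sub>F k in sequentially.
           optimal_control DA A S (yosida_control_dual DA A S B k) C P0 z T \<xi> (uopt_k k)) \<longrightarrow>
        optimal_control DA A S B C P0 z T \<xi> uopt \<longrightarrow>
        (let xopt_k = (\<lambda>k. state DA A S (yosida_control_dual DA A S B k) \<xi> (uopt_k k));
             xopt = state DA A S B \<xi> uopt
         in converges_L2 T uopt_k uopt \<and>
            converges_C T xopt_k xopt \<and>
            converges_C T (\<lambda>k. adjoint_state S C P0 z T (xopt_k k)) (adjoint_state S C P0 z T xopt)))"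
proof -
  have gen: "strongly_continuous_semigroup S"
    using assms(1) by unfold_locales (simp add: generates_semigroup_def)
  obtain M w where M: "1 \<le> M" "0 \<le> w" "\<And>t. 0 \<le> t \<Longrightarrow> norm (S t) \<le> M * exp (w * t)"
    using strongly_continuous_semigroup.exponential_bound[OF gen] by blast
  interpret strongly_continuous_semigroup S by (rule gen)
  \<comment> \<open>Any number above \<open>w\<close> may serve as \<open>k0\<close>.\<close>
  interpret lq_problem S M w DA A "w + 1" B T C P0 z \<xi>
    by unfold_locales (use assms M in auto)
  obtain c where c: "0 < c" "\<And>f t. t \<in> {0..T} \<Longrightarrow> norm (G f t) \<le> c * norm f"
    using bounded_G by blast
  let ?Bk = "yosida_control_dual DA A S B"
  let ?J = "\<lambda>k x. real k *\<^sub>R resolvent (real k) x"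
  let ?opt = "\<lambda>B u. optimal_control DA A S B C P0 z T \<xi> u"
  have RB: "realizes G c B" by (rule realizes_B[OF c])
  interpret Q: quadratic_control G "\<lambda>t. S t \<xi>" C P0 z T c using RB by (simp add: realizes_def)
  have Rk: "\<forall>\<^sub>F k in sequentially. realizes (\<lambda>f t. ?J k (G f t)) (2 * M * c) (?Bk k)"
    using eventually_large by eventually_elim (rule realizes_yosida[OF c], auto)
  have ex: "\<exists>u. ?opt B u" by (rule optimal_control_exists[OF RB])
  have exk: "\<forall>\<^sub>F k in sequentially. \<exists>u. ?opt (?Bk k) u"
    using Rk by eventually_elim (rule optimal_control_exists)
  have conv: "converges_L2 T uk u \<and>
      converges_C T (\<lambda>k. state DA A S (?Bk k) \<xi> (uk k)) (state DA A S B \<xi> u) \<and>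
      converges_C T (\<lambda>k. adjoint_state S C P0 z T (state DA A S (?Bk k) \<xi> (uk k)))
        (adjoint_state S C P0 z T (state DA A S B \<xi> u)) \<and>
      (\<lambda>k. cost DA A S (?Bk k) C P0 z T \<xi> (uk k)) \<longlonglongrightarrow> cost DA A S B C P0 z T \<xi> u"
    if uk: "\<forall>\<^sub>F k in sequentially. ?opt (?Bk k) (uk k)" and u: "?opt B u" for uk u
  proof -
    let ?x = "state DA A S B \<xi> u"
    let ?xk = "\<lambda>k. state DA A S (?Bk k) \<xi> (uk k)"
    have uL2: "u \<in> L2_controls T" using u by (simp add: optimal_control_def)
    have ukL2: "\<forall>\<^sub>F k in sequentially. uk k \<in> L2_controls T"
      using uk by eventually_elim (simp add: optimal_control_def)
    have min: "\<And>g. Phi G (emb T u) \<le> Phi G g" using u optimal_control_iff[OF RB] by blast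
    have mink: "\<forall>\<^sub>F k in sequentially. \<forall>g. Phi (\<lambda>f t. ?J k (G f t)) (emb T (uk k)) \<le> Phi (\<lambda>f t. ?J k (G f t)) g"
      using uk Rk by eventually_elim (use optimal_control_iff in blast)
    have lim: "(\<lambda>k. emb T (uk k)) \<longlonglongrightarrow> emb T u"
      "uniform_limit {0..T} (\<lambda>k t. S t \<xi> + ?J k (G (emb T (uk k)) t)) (\<lambda>t. S t \<xi> + G (emb T u) t) sequentially"
      by (rule minimizers_converge[OF c min mink]; assumption?)+
    have L2: "converges_L2 T uk u" by (rule converges_L2_emb[OF ukL2 uL2 lim(1)])
    have xk_cont: "\<forall>\<^sub>F k in sequentially. continuous_on {0..T} (?xk k)"
      using Rk ukL2 by eventually_elim (rule continuous_state)
    have x_cont: "continuous_on {0..T} ?x" by (rule continuous_state[OF RB uL2])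
    have x_lim: "uniform_limit {0..T} ?xk ?x sequentially"
    proof (rule uniform_limit_cong[THEN iffD1, OF _ _ lim(2)])
      show "\<forall>\<^sub>F k in sequentially. \<forall>t\<in>{0..T}. S t \<xi> + ?J k (G (emb T (uk k)) t) = ?xk k t"
        using Rk ukL2 by eventually_elim (auto simp: realizes_def)
      show "S t \<xi> + G (emb T u) t = ?x t" if "t \<in> {0..T}" for t
        using RB uL2 that by (simp add: realizes_def)
    qed
    have "(\<lambda>k. (norm (emb T (uk k)))\<^sup>2 + (integral {0..T} (\<lambda>t. (norm (C (?xk k t) - z))\<^sup>2) + P0 (?xk k T) \<bullet> ?xk k T))
        \<longlonglongrightarrow> (norm (emb T u))\<^sup>2 + (integral {0..T} (\<lambda>t. (norm (C (?x t) - z))\<^sup>2) + P0 (?x T) \<bullet> ?x T)"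
      by (rule tendsto_add[OF tendsto_power[OF tendsto_norm[OF lim(1)]] quadratic_cost_tendsto[OF x_lim xk_cont x_cont assms(6)]])
    note lim_cost = this[folded cost_state[OF RB uL2]]
    have "(\<lambda>k. cost DA A S (?Bk k) C P0 z T \<xi> (uk k)) \<longlonglongrightarrow> cost DA A S B C P0 z T \<xi> u"
    proof (rule Lim_transform_eventually[OF lim_cost])
      show "\<forall>\<^sub>F k in sequentially. (norm (emb T (uk k)))\<^sup>2 +
          (integral {0..T} (\<lambda>t. (norm (C (?xk k t) - z))\<^sup>2) + P0 (?xk k T) \<bullet> ?xk k T) =
          cost DA A S (?Bk k) C P0 z T \<xi> (uk k)"
        using Rk ukL2 by eventually_elim (rule cost_state[symmetric])
    qed
    with L2 xk_cont x_cont x_lim converges_C_adjoint_state[OF xk_cont x_cont x_lim] show ?thesis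
      by (simp add: converges_C_def)
  qed
  have inf: "(\<lambda>k. INF u\<in>L2_controls T. cost DA A S (?Bk k) C P0 z T \<xi> u)
      \<longlonglongrightarrow> (INF u\<in>L2_controls T. cost DA A S B C P0 z T \<xi> u)"
  proof -
    obtain u where u: "?opt B u" using ex by blast
    \<comment> \<open>A selection of minimizers, meaningful for large k; their costs are the infima,
      so \<open>conv\<close> yields the limit.\<close>
    define uk where "uk k = (SOME v. ?opt (?Bk k) v)" for k
    have uk: "\<forall>\<^sub>F k in sequentially. ?opt (?Bk k) (uk k)"
      using exk by eventually_elim (simp add: uk_def someI_ex)
    have "(\<lambda>k. cost DA A S (?Bk k) C P0 z T \<xi> (uk k)) \<longlonglongrightarrow> cost DA A S B C P0 z T \<xi> u"
      using conv[OF uk u] by blast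
    then show ?thesis
      unfolding INF_cost_eq[OF u]
      by (rule Lim_transform_eventually) (use uk in \<open>eventually_elim, simp add: INF_cost_eq\<close>)
  qed
  show ?thesis
    unfolding Let_def using inf ex exk conv by blast
qed

end
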